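(* Let $f \in K(z)$ be a nonconstant rational function, and let $U \subset \mathbb{P}^{1,\mathrm{an}}_K$ be a compressive domain for $f$. Then $U$ contains a classical fixed point of $f$, i.e., there is a point $y \in \mathbb{P}^1(K) \cap U$ with $f(y) = y$.
   Context: $K$ is an algebraically closed field that is complete with respect to a nontrivial nonarchimedean absolute value; $\tilde K$ is its residue field. $\mathbb{P}^{1,\mathrm{an}}_K$ is the Berkovich (analytic) projective line over $K$; its classical points are the type I points, identified with $\mathbb{P}^1(K)$. A nonconstant $f\in K(z)$ acts on $\mathbb{P}^{1,\mathrm{an}}_K$. For $x \in \mathbb{P}^{1,\mathrm{an}}_K$, $T_x$ is the set of tangent directions at $x$, i.e. the connected components of $\mathbb{P}^{1,\mathrm{an}}_K \smallsetminus \{x\}$; the component corresponding to $\vec v \in T_x$ is denoted $B_x(\vec v)^-$ (an open disk when $x$ is of type II or III). If $f(x) = x$, then $f$ induces a map $T_x f : T_x \to T_x$; if $x$ is of type II, $T_x$ is identified with $\mathbb{P}^1(\tilde K)$ and $T_x f$ with a nonconstant rational function over $\tilde K$. A direction $\vec v\in T_x$ at a type II fixed point $x$ is critically fixed if $T_x f(\vec v) = \vec v$ and $\vec v$ is a critical point of $T_x f$ (ramification index at least $2$). Type III fixed points have no critically fixed directions. A simple domain is the intersection of finitely many open disks $B_x(\vec v)^-$ with boundary points $x$ of type II or III. A compressive domain for $f$ is a simple domain $U = \bigcap_{i=1}^n B_{x_i}(\vec v_i)^-$ with topological boundary $\partial U = \{x_1, \ldots, x_n\}$ (the $x_i$ distinct)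 such that, for each $i$, $f(x_i) = x_i$ and $\vec v_i \in T_{x_i}$ is a critically fixed direction for $T_{x_i} f$. The case $n = 0$, $U = \mathbb{P}^{1,\mathrm{an}}_K$, is allowed. *)

theory Defs
  imports "HOL-Analysis.Analysis" "HOL-Computational_Algebra.Computational_Algebra"
begin

section \<open>Nonarchimedean fields and their residue fields\<close>

text \<open>
  The metric is the one induced by the absolute value, so that completeness of the field is the
  class \<^class>\<open>complete_space\<close>.
\<close>

class nonarch_field = field + metric_space +
  fixes absval :: "'a \<Rightarrow> real"
  assumes dist_absval: "dist x y = absval (x - y)"
    and absval_mult: "absval (x * y) = absval x * absval y"
    and absval_add_le_max: "absval (x + y) \<le> max (absval x) (absval y)"
    and absval_nontrivial: "\<exists>x. x \<noteq> 0 \<and> absval x \<noteq> 1"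
begin

lemma absval_zero [simp]: "absval 0 = 0"
  using dist_absval[of 0 0] by simp

lemma absval_eq_zero [simp]: "absval x = 0 \<longleftrightarrow> x = 0"
  by (metis dist_absval dist_eq_0_iff diff_zero)

lemma absval_ge_zero [simp]: "0 \<le> absval x"
  using dist_absval[of x 0] zero_le_dist[of x 0] by simp

lemma absval_one [simp]: "absval 1 = 1"
proof -
  have "absval 1 * absval 1 = absval (1 :: 'a)"
    using absval_mult[of 1 1] by simp
  then show ?thesis
    by simp
qed

lemma absval_minus [simp]: "absval (- x) = absval x"
  using dist_absval[of x 0] dist_absval[of 0 x] dist_commute[of x 0] by simp

lemma absval_diff_le_max: "absval (x - y) \<le> max (absval x) (absval y)"
  using absval_add_le_max[of x "- y"] by simp

end

lemma absval_inverse: "absval (inverse (x::'a::nonarch_field)) = inverse (absval x)"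
proof (cases "x = 0")
  case False
  then have "absval x * absval (inverse x) = 1"
    using absval_mult[of x "inverse x"] by simp
  then show ?thesis
    using inverse_unique[of "absval x"] by simp
qed simp

text \<open>The residue field is the valuation ring modulo its maximal ideal.\<close>

definition residue_rel :: "'a::nonarch_field \<Rightarrow> 'a \<Rightarrow> bool" where
  "residue_rel x y \<longleftrightarrow> absval x \<le> 1 \<and> absval y \<le> 1 \<and> absval (x - y) < 1"

lemma residue_rel_add:
  assumes "residue_rel x x'" "residue_rel y y'"
  shows "residue_rel (x + y) (x' + y')"
proof -
  have "absval ((x + y) - (x' + y')) \<le> max (absval (x - x')) (absval (y - y'))"
    using absval_add_le_max[of "x - x'" "y - y'"] by (simp add: algebra_simps)
  then show ?thesis
    using assms absval_add_le_max[of x y] absval_add_le_max[of x' y']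
    unfolding residue_rel_def by linarith
qed

lemma residue_rel_minus: "residue_rel x y \<Longrightarrow> residue_rel (- x) (- y)"
  using absval_minus[of "x - y"] unfolding residue_rel_def by simp

lemma residue_rel_mult:
  assumes "residue_rel x x'" "residue_rel y y'"
  shows "residue_rel (x * y) (x' * y')"
proof -
  have le: "absval x \<le> 1" "absval x' \<le> 1" "absval y \<le> 1" "absval y' \<le> 1"
    and lt: "absval (x - x') < 1" "absval (y - y') < 1"
    using assms by (auto simp: residue_rel_def)
  have "absval (x * (y - y')) \<le> absval (y - y')" "absval ((x - x') * y') \<le> absval (x - x')"
    using le by (auto simp: absval_mult mult_left_le_one_le mult_right_le_one_le)
  moreover have "absval (x * y - x' * y') \<le> max (absval (x * (y - y'))) (absval ((x - x') * y'))"
    using absval_add_le_max[of "x * (y - y')" "(x - x') * y'"] by (simp add: algebra_simps)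
  ultimately have "absval (x * y - x' * y') < 1"
    using lt by linarith
  then show ?thesis
    using le by (auto simp: residue_rel_def absval_mult mult_le_one)
qed

lemma residue_rel_inverse:
  assumes "residue_rel x y"
  shows "residue_rel (if absval x < 1 then 0 else inverse x) (if absval y < 1 then 0 else inverse y)"
proof -
  have le: "absval x \<le> 1" "absval y \<le> 1" and lt: "absval (x - y) < 1" "absval (y - x) < 1"
    using assms absval_minus[of "x - y"] by (auto simp: residue_rel_def)
  have iff: "absval x < 1 \<longleftrightarrow> absval y < 1"
    using absval_add_le_max[of "x - y" y] absval_add_le_max[of "y - x" x] lt by auto
  show ?thesis
  proof (cases "absval x < 1")
    case True
    then show ?thesis
      using iff by (simp add: residue_rel_def)
  next
    case False
    then have one: "absval x = 1" "absval y = 1"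
      using le iff by auto
    then have "x \<noteq> 0" "y \<noteq> 0"
      by auto
    then have "inverse x - inverse y = inverse x * (y - x) * inverse y"
      by (simp add: field_simps)
    then have "absval (inverse x - inverse y) = absval (y - x)"
      using one by (simp add: absval_mult absval_inverse)
    then show ?thesis
      using one lt by (simp add: residue_rel_def absval_inverse)
  qed
qed

quotient_type (overloaded) 'a residue = "'a::nonarch_field" / partial: residue_rel
proof (rule part_equivpI)
  show "\<exists>x::'a. residue_rel x x"
    by (rule exI[of _ 0]) (simp add: residue_rel_def)
  show "symp (residue_rel :: 'a \<Rightarrow> _)"
    using absval_minus by (metis (no_types) minus_diff_eq residue_rel_def sympI)
  show "transp (residue_rel :: 'a \<Rightarrow> _)"
  proof (rule transpI)
    fix x y z :: 'a
    assume "residue_rel x y" "residue_rel y z"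
    then show "residue_rel x z"
      using absval_add_le_max[of "x - y" "y - z"] by (auto simp: residue_rel_def)
  qed
qed

instantiation residue :: (nonarch_field) field
begin

lift_definition zero_residue :: "'a residue" is 0
  by (simp add: residue_rel_def)

lift_definition one_residue :: "'a residue" is 1
  by (simp add: residue_rel_def)

lift_definition plus_residue :: "'a residue \<Rightarrow> 'a residue \<Rightarrow> 'a residue" is "(+)"
  by (rule residue_rel_add)

lift_definition uminus_residue :: "'a residue \<Rightarrow> 'a residue" is uminus
  by (rule residue_rel_minus)

lift_definition times_residue :: "'a residue \<Rightarrow> 'a residue \<Rightarrow> 'a residue" is "(*)"
  by (rule residue_rel_mult)

lift_definition inverse_residue :: "'a residue \<Rightarrow> 'a residue"
  is "\<lambda>x. if absval x < 1 then 0 else inverse x"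
  by (rule residue_rel_inverse)

definition minus_residue :: "'a residue \<Rightarrow> 'a residue \<Rightarrow> 'a residue" where
  "minus_residue x y = x + - y"

definition divide_residue :: "'a residue \<Rightarrow> 'a residue \<Rightarrow> 'a residue" where
  "divide_residue x y = x * inverse y"

instance
proof
  fix a b c :: "'a residue"
  show "a + b + c = a + (b + c)"
    by transfer (metis add.assoc residue_rel_add)
  show "a + b = b + a"
    by transfer (metis add.commute residue_rel_add)
  show "0 + a = a"
    by transfer simp
  show "- a + a = 0"
    by transfer (simp add: residue_rel_def)
  show "a - b = a + - b"
    by (simp add: minus_residue_def)
  show "a * b * c = a * (b * c)"
    by transfer (auto simp: residue_rel_def absval_mult mult.assoc mult_le_one)
  show "a * b = b * a"
    by transfer (auto simp: residue_rel_def absval_mult mult.commute mult_le_one)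
  show "1 * a = a"
    by transfer simp
  show "(a + b) * c = a * c + b * c"
    by transfer (metis distrib_right residue_rel_add residue_rel_mult)
  show "(0 :: 'a residue) \<noteq> 1"
    by transfer (simp add: residue_rel_def)
  show "a \<noteq> 0 \<Longrightarrow> inverse a * a = 1"
  proof transfer
    fix x :: 'a
    assume "residue_rel x x" and nz: "\<not> residue_rel x 0"
    then have "absval x = 1"
      by (auto simp: residue_rel_def)
    then show "residue_rel ((if absval x < 1 then 0 else inverse x) * x) 1"
      by (cases "x = 0") (auto simp: residue_rel_def)
  qed
  show "a div b = a * inverse b"
    by (simp add: divide_residue_def)
  show "inverse (0 :: 'a residue) = 0"
    by transfer (simp add: residue_rel_def)
qed

end


section \<open>Rational functions and their action on the projective line\<close>

text \<open>
  The field \<open>k(z)\<close> is \<^typ>\<open>'k poly fract\<close>, and \<open>\<P>\<^sup>1(k)\<close> is \<^typ>\<open>'k option\<close> with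
  \<^const>\<open>None\<close> as the point at infinity.
\<close>

definition lowest_terms :: "'k::field poly fract \<Rightarrow> 'k poly \<times> 'k poly" where
  "lowest_terms f = (SOME pq. snd pq \<noteq> 0 \<and> coprime (fst pq) (snd pq) \<and> f = Fract (fst pq) (snd pq))"

abbreviation numer :: "'k::field poly fract \<Rightarrow> 'k poly" where
  "numer f \<equiv> fst (lowest_terms f)"

abbreviation denom :: "'k::field poly fract \<Rightarrow> 'k poly" where
  "denom f \<equiv> snd (lowest_terms f)"

lemma lowest_terms_exist:
  fixes p q :: "'k::field poly"
  assumes "q \<noteq> 0"
  shows "\<exists>p' q'. q' \<noteq> 0 \<and> coprime p' q' \<and> Fract p q = Fract p' q'"
  using assms
proof (induction "degree q" arbitrary: p q rule: less_induct)
  case less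
  show ?case
  proof (cases "coprime p q")
    case False
    then obtain c where c: "c dvd p" "c dvd q" "\<not> c dvd 1"
      by (auto simp: coprime_def)
    then obtain p' q' where pq: "p = c * p'" "q = c * q'"
      by (auto simp: dvd_def)
    have nz: "c \<noteq> 0" "q' \<noteq> 0"
      using less.prems pq by auto
    have "degree c \<noteq> 0"
      using c(3) nz(1) is_unit_iff_degree by blast
    then have "degree q' < degree q"
      using nz pq by (simp add: degree_mult_eq)
    then obtain p'' q'' where "q'' \<noteq> 0" "coprime p'' q''" "Fract p' q' = Fract p'' q''"
      using less.hyps nz by blast
    moreover have "Fract p q = Fract p' q'"
      using nz pq by (simp add: eq_fract)
    ultimately show ?thesis
      by auto
  qed (use less.prems in auto)
qed

lemma lowest_terms:
  fixes f :: "'k::field poly fract"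
  shows "denom f \<noteq> 0" "coprime (numer f) (denom f)" "f = Fract (numer f) (denom f)"
proof -
  obtain p q where "q \<noteq> 0" "f = Fract p q"
    by (cases f)
  then have "\<exists>pq. snd pq \<noteq> 0 \<and> coprime (fst pq) (snd pq) \<and> f = Fract (fst pq) (snd pq)"
    using lowest_terms_exist[of q p] by auto
  then have "snd (lowest_terms f) \<noteq> 0 \<and> coprime (numer f) (denom f) \<and> f = Fract (numer f) (denom f)"
    unfolding lowest_terms_def by (rule someI_ex)
  then show "denom f \<noteq> 0" "coprime (numer f) (denom f)" "f = Fract (numer f) (denom f)"
    by auto
qed

definition nonconstant :: "'k::field poly fract \<Rightarrow> bool" where
  "nonconstant f \<longleftrightarrow> (\<nexists>c. f = to_fract [:c:])"

definition rat_degree :: "'k::field poly fract \<Rightarrow> nat" where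
  "rat_degree f = max (degree (numer f)) (degree (denom f))"

fun rat_eval :: "'k::field poly fract \<Rightarrow> 'k option \<Rightarrow> 'k option" where
  "rat_eval f (Some c) =
     (if poly (denom f) c = 0 then None else Some (poly (numer f) c / poly (denom f) c))"
| "rat_eval f None =
     (if degree (denom f) < degree (numer f) then None
      else Some (coeff (numer f) (degree (denom f)) / lead_coeff (denom f)))"

text \<open>
  For nonconstant \<open>f\<close>, the numerator of \<open>f - f(c)\<close> in lowest terms (of \<open>1 / f\<close> if
  \<open>f(c) = \<infinity>\<close>), seen as a form of degree \<^term>\<open>rat_degree f\<close>, vanishes at \<open>c\<close> to an order
  that is the ramification index of \<open>f\<close> at \<open>c\<close>. A form given by a polynomial \<open>h\<close> vanishes at
  infinity to order \<^term>\<open>rat_degree f - degree h\<close>.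
\<close>

definition ramification_index :: "'k::field poly fract \<Rightarrow> 'k option \<Rightarrow> nat" where
  "ramification_index f c =
     (let h = (case rat_eval f c of Some b \<Rightarrow> numer f - smult b (denom f) | None \<Rightarrow> denom f)
      in case c of Some a \<Rightarrow> order a h | None \<Rightarrow> rat_degree f - degree h)"


section \<open>The Berkovich projective line\<close>

definition berk_affine :: "('a::nonarch_field poly \<Rightarrow> real) set" where
  "berk_affine = {s. (\<forall>p. 0 \<le> s p) \<and> (\<forall>p q. s (p * q) = s p * s q) \<and>
     (\<forall>p q. s (p + q) \<le> max (s p) (s q)) \<and> (\<forall>c. s [:c:] = absval c)}"

type_synonym 'a berk_point = "('a poly \<Rightarrow> real) option"

text \<open>
  The topology of a function type is that of pointwise convergence, so the first argument below is
  the Berkovich affine line with its usual topology. The projective line adds one point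
  \<^const>\<open>None\<close> at infinity.
\<close>

definition berk_P1 :: "'a::nonarch_field berk_point topology" where
  "berk_P1 = Alexandroff_compactification (top_of_set berk_affine)"

fun classical_point :: "'a::nonarch_field option \<Rightarrow> 'a berk_point" where
  "classical_point (Some a) = Some (\<lambda>p. absval (poly p a))"
| "classical_point None = None"

definition disk_point :: "'a::nonarch_field \<Rightarrow> real \<Rightarrow> 'a berk_point" where
  "disk_point a r = Some (\<lambda>p. SUP z\<in>cball a r. absval (poly p z))"

definition type_II :: "'a::nonarch_field berk_point \<Rightarrow> bool" where
  "type_II x \<longleftrightarrow> (\<exists>a r. 0 < r \<and> r \<in> range (absval :: 'a \<Rightarrow> real) \<and> x = disk_point a r)"

definition type_III :: "'a::nonarch_field berk_point \<Rightarrow> bool" where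
  "type_III x \<longleftrightarrow> (\<exists>a r. 0 < r \<and> r \<notin> range (absval :: 'a \<Rightarrow> real) \<and> x = disk_point a r)"

text \<open>
  A point \<open>s\<close> is mapped to the seminorm \<open>g \<mapsto> |g \<circ> f|\<close>, where the seminorm \<open>s\<close> is extended to
  those rational functions whose denominator is not in its kernel.
\<close>

definition seminorm_fract :: "('a::nonarch_field poly \<Rightarrow> real) \<Rightarrow> 'a poly fract \<Rightarrow> real" where
  "seminorm_fract s h = s (numer h) / s (denom h)"

definition poly_comp_fract :: "'a::field poly \<Rightarrow> 'a poly fract \<Rightarrow> 'a poly fract" where
  "poly_comp_fract g f = poly (map_poly (\<lambda>c. to_fract [:c:]) g) f"

fun berk_map :: "'a::nonarch_field poly fract \<Rightarrow> 'a berk_point \<Rightarrow> 'a berk_point" where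
  "berk_map f (Some s) =
     (if s (denom f) = 0 then None else Some (\<lambda>g. seminorm_fract s (poly_comp_fract g f)))"
| "berk_map f None = classical_point (rat_eval f None)"


section \<open>Tangent directions\<close>

text \<open>A direction at \<open>x\<close> is identified with the component \<open>B\<^sub>x(v)\<^sup>-\<close> that it names.\<close>

definition directions :: "'a::nonarch_field berk_point \<Rightarrow> 'a berk_point set set" where
  "directions x = connected_components_of (subtopology berk_P1 (topspace berk_P1 - {x}))"

definition direction_towards :: "'a::nonarch_field berk_point \<Rightarrow> 'a berk_point \<Rightarrow> 'a berk_point set"
  where "direction_towards x y =
    connected_component_of_set (subtopology berk_P1 (topspace berk_P1 - {x})) y"

text \<open>
  \<open>T\<^sub>x f\<close> sends \<open>v\<close> to the direction at \<open>f(x)\<close> containing the images of all points of \<open>v\<close> that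
  are sufficiently close to \<open>x\<close>.
\<close>

definition tangent_map ::
  "'a::nonarch_field poly fract \<Rightarrow> 'a berk_point \<Rightarrow> 'a berk_point set \<Rightarrow> 'a berk_point set" where
  "tangent_map f x v =
     (THE w. w \<in> directions (berk_map f x) \<and>
       (\<exists>V. openin berk_P1 V \<and> x \<in> V \<and> berk_map f ` (V \<inter> v) \<subseteq> w))"

text \<open>
  The identification of \<open>\<P>\<^sup>1\<close> over the residue field with the directions at the type II point
  \<^term>\<open>disk_point a (absval b)\<close>: in the coordinate \<open>(z - a) / b\<close> this is the Gauss point, and a
  residue class corresponds to the direction containing the classical points that reduce to it.
\<close>

fun residue_direction ::
  "'a::nonarch_field \<Rightarrow> 'a \<Rightarrow> 'a residue option \<Rightarrow> 'a berk_point set" where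
  "residue_direction a b (Some u) =
     direction_towards (disk_point a (absval b)) (classical_point (Some (a + b * rep_residue u)))"
| "residue_direction a b None = direction_towards (disk_point a (absval b)) None"

text \<open>
  Under this identification \<open>T\<^sub>x f\<close> is given by a rational function \<open>\<phi>\<close> over the (infinite) residue
  field, which is uniquely determined by its values. A change of \<open>a\<close> and \<open>b\<close> conjugates \<open>\<phi>\<close> by an
  affine map and preserves ramification indices.
\<close>

definition critically_fixed ::
  "'a::nonarch_field poly fract \<Rightarrow> 'a berk_point \<Rightarrow> 'a berk_point set \<Rightarrow> bool" where
  "critically_fixed f x v \<longleftrightarrow>
     type_II x \<and> berk_map f x = x \<and> v \<in> directions x \<and> tangent_map f x v = v \<and>
     (\<exists>a b \<phi> c. b \<noteq> 0 \<and> x = disk_point a (absval b) \<and> nonconstant \<phi> \<and>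
        (\<forall>u. tangent_map f x (residue_direction a b u) = residue_direction a b (rat_eval \<phi> u)) \<and>
        v = residue_direction a b c \<and> 2 \<le> ramification_index \<phi> c)"


section \<open>Simple and compressive domains\<close>

definition open_disk :: "'a::nonarch_field berk_point \<Rightarrow> 'a berk_point set \<Rightarrow> bool" where
  "open_disk x D \<longleftrightarrow> (type_II x \<or> type_III x) \<and> D \<in> directions x"

text \<open>For \<open>n = 0\<close> the intersection below is the whole space.\<close>

definition compressive_domain ::
  "'a::nonarch_field poly fract \<Rightarrow> 'a berk_point set \<Rightarrow> bool" where
  "compressive_domain f U \<longleftrightarrow>
     (\<exists>(n::nat) x v. inj_on x {..<n} \<and> (\<forall>i<n. open_disk (x i) (v i)) \<and>
        U = topspace berk_P1 \<inter> (\<Inter>i<n. v i) \<and>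
        berk_P1 frontier_of U = x ` {..<n} \<and>
        (\<forall>i<n. berk_map f (x i) = x i \<and> critically_fixed f (x i) (v i)))"

end

theory Submission
  imports Defs
begin

text \<open>
  Write \<open>f = p / q\<close> in lowest terms. The classical fixed points of \<open>f\<close> other than infinity are the
  roots of \<open>P = z q - p\<close>, that is, the poles of the differential form
  \<open>dz / (z - f(z)) = (q / P) dz\<close>. Suppose that the compressive domain \<open>U\<close> contains no classical
  fixed point, so that all these poles lie outside \<open>U\<close>, in the complements of the disks
  \<open>v\<^sub>i\<close> that cut out \<open>U\<close>. The complements are pairwise disjoint, because the boundary points are
  distinct and each of them is in the closure of \<open>U\<close>. The contradiction comes from the residues of
  the form.

  Let \<open>\<zeta>(a, r)\<close> be a boundary point whose direction contains infinity. The classical points in the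
  complement of the direction form the disk \<open>|z - a| \<le> r\<close>. That the direction is critically fixed
  implies \<open>|f(z) - a| > |z - a|\<close> on circles of radius \<open>\<rho>\<close> slightly larger than \<open>r\<close>; hence
  \<open>|1 / (z - f(z))| < 1 / \<rho>\<close> there, and the sum of the residues in the disk has absolute value
  less than 1. If the direction does not contain infinity, it is a disk \<open>|z - a| < r\<close> for a suitable
  \<open>a\<close>, and \<open>|f(z) - a| < |z - a|\<close> on circles of radius slightly smaller than \<open>r\<close>; then
  \<open>1 / (z - f(z))\<close> is close to \<open>1 / (z - a)\<close>, and the sum of the residues in this disk differs from
  1 by less than 1. There is at most one boundary point of the second kind. If there is one, the
  poles in its disk are exactly those in the complements belonging to the first kind, and so a
  number that differs from 1 by less than 1 is a sum of numbers of absolute value less than 1. If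
  there is none, then infinity lies in \<open>U\<close> and is not fixed, so that \<open>z q / P\<close> tends to 1 at
  infinity and the sum of all residues is exactly 1, although each disk contributes less than 1.
  Both are impossible for a nonarchimedean absolute value.

  The residues are algebraic: the sum of the residues of \<open>g / (A B)\<close> at the roots of the monic
  polynomial \<open>A\<close> is the top coefficient of the numerator over \<open>A\<close> in the partial fraction
  decomposition. The lemmas \<open>residue_small\<close> and \<open>residue_near_one\<close> are the two estimates above, and
  \<open>fixed_point_residue_contradiction\<close> is the counting argument.

  It remains to get the two inequalities for \<open>f\<close> out of the definition of a critically fixed
  direction (\<open>critically_fixed_cases\<close>). At a fixed disk point, \<open>p\<close> and \<open>q\<close> can be scaled and reduced
  to polynomials over the residue field. The tangent map is computed only at the residue classes that
  are not zeros of the reduced denominator, where \<open>f\<close> maps an open disk into an open disk. This is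
  enough, as a rational function over the infinite residue field is determined by infinitely many of
  its values; so the function that describes the tangent map is the quotient of the two reductions
  (\<open>tangent_map_is_reduction\<close>). Ramification index at least 2 thus forces a gap between the degrees,
  or between the vanishing orders, of the two reductions, and the gap gives the inequalities on
  nearby circles. The topological input is that a ball together with its boundary point is closed
  (\<open>openin_outside_ball\<close>), which confines the tangent directions to balls.
\<close>

section \<open>Gauss norms\<close>

lemma absval_sum_le:
  fixes g :: "'b \<Rightarrow> 'a::nonarch_field"
  assumes "\<And>i. i \<in> A \<Longrightarrow> absval (g i) \<le> B" "0 \<le> B"
  shows "absval (sum g A) \<le> B"
  using assms
proof (induction A rule: infinite_finite_induct)
  case (insert x F)
  then show ?case
    using absval_add_le_max[of "g x" "sum g F"] by (simp, smt (verit))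
qed auto

lemma absval_sum_less:
  fixes g :: "'b \<Rightarrow> 'a::nonarch_field"
  assumes "\<And>i. i \<in> A \<Longrightarrow> absval (g i) < B" "0 < B"
  shows "absval (sum g A) < B"
  using assms
proof (induction A rule: infinite_finite_induct)
  case (insert x F)
  then show ?case
    using absval_add_le_max[of "g x" "sum g F"] by (simp, smt (verit))
qed auto

lemma absval_power: "absval ((x::'a::nonarch_field) ^ n) = absval x ^ n"
  by (induction n) (simp_all add: absval_mult)

lemma absval_divide: "absval ((x::'a::nonarch_field) / y) = absval x / absval y"
  by (simp add: divide_inverse absval_mult absval_inverse)

lemma absval_diff_commute: "absval ((x::'a::nonarch_field) - y) = absval (y - x)"
  using absval_minus[of "x - y"] by simp

lemma absval_pos: "x \<noteq> 0 \<Longrightarrow> 0 < absval (x::'a::nonarch_field)"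
  using absval_ge_zero[of x] absval_eq_zero[of x] by linarith

lemma absval_add_eq:
  fixes x y :: "'a::nonarch_field"
  assumes "absval y < absval x"
  shows "absval (x + y) = absval x"
  using absval_add_le_max[of x y] absval_diff_le_max[of "x + y" y] assms by auto

definition gauss_norm :: "real \<Rightarrow> 'a::nonarch_field poly \<Rightarrow> real" where
  "gauss_norm r p = (MAX i\<in>{..degree p}. absval (coeff p i) * r ^ i)"

lemma gauss_norm_attained: "\<exists>i\<le>degree p. gauss_norm r p = absval (coeff p i) * r ^ i"
proof -
  have "gauss_norm r p \<in> (\<lambda>i. absval (coeff p i) * r ^ i) ` {..degree p}"
    unfolding gauss_norm_def by (rule Max_in) auto
  then show ?thesis by auto
qed

lemma gauss_norm_nonneg: "0 \<le> r \<Longrightarrow> 0 \<le> gauss_norm r p"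
  using gauss_norm_attained[of p r] by auto

lemma gauss_norm_ge:
  assumes "0 \<le> r"
  shows "absval (coeff p i) * r ^ i \<le> gauss_norm r p"
proof (cases "i \<le> degree p")
  case True
  then show ?thesis unfolding gauss_norm_def by (intro Max_ge) auto
next
  case False
  then show ?thesis using gauss_norm_nonneg[OF assms, of p] by (simp add: coeff_eq_0)
qed

lemma gauss_norm_leI: "(\<And>i. absval (coeff p i) * r ^ i \<le> B) \<Longrightarrow> gauss_norm r p \<le> B"
  using gauss_norm_attained[of p r] by auto

lemma gauss_norm_const [simp]: "gauss_norm r [:c:] = absval c"
  by (simp add: gauss_norm_def)

lemma gauss_norm_linear: "gauss_norm r [:c, 1:] = max (absval c) r"
proof -
  have "{..Suc 0} = {0, 1}" by auto
  then show ?thesis by (simp add: gauss_norm_def)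
qed

lemma gauss_norm_zero_radius: "gauss_norm 0 p = absval (coeff p 0)"
proof (rule antisym)
  show "gauss_norm 0 p \<le> absval (coeff p 0)"
    by (rule gauss_norm_leI) (auto simp: power_0_left)
  show "absval (coeff p 0) \<le> gauss_norm 0 p"
    using gauss_norm_ge[of 0 p 0] by simp
qed

lemma gauss_norm_add:
  assumes "0 \<le> r"
  shows "gauss_norm r (p + q) \<le> max (gauss_norm r p) (gauss_norm r q)"
proof (rule gauss_norm_leI)
  fix i
  have "absval (coeff (p + q) i) * r ^ i \<le> max (absval (coeff p i)) (absval (coeff q i)) * r ^ i"
    using assms by (simp add: absval_add_le_max mult_right_mono)
  also have "\<dots> = max (absval (coeff p i) * r ^ i) (absval (coeff q i) * r ^ i)"
    using assms by (simp add: max_mult_distrib_right)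
  also have "\<dots> \<le> max (gauss_norm r p) (gauss_norm r q)"
    using gauss_norm_ge[OF assms] by (meson max.mono)
  finally show "absval (coeff (p + q) i) * r ^ i \<le> max (gauss_norm r p) (gauss_norm r q)" .
qed

lemma gauss_norm_eq_zero:
  assumes "0 < r" shows "gauss_norm r p = 0 \<longleftrightarrow> p = 0"
proof
  assume "gauss_norm r p = 0"
  then have "absval (coeff p i) * r ^ i \<le> 0" for i
    using gauss_norm_ge[of r p i] assms by simp
  then have "coeff p i = 0" for i
    using assms by (metis absval_eq_zero absval_ge_zero antisym_conv mult_le_0_iff mult_pos_pos
        not_less order_less_le zero_less_power)
  then show "p = 0" by (simp add: poly_eq_iff)
qed (use gauss_norm_const[of r 0] in simp)

text \<open>
  The last index at which the maximum is attained is what makes the Gauss norm multiplicative: in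
  the coefficient of a product at the sum of two last indices, a single term dominates.
\<close>

lemma gauss_norm_last_index:
  assumes "0 \<le> r"
  obtains i where "gauss_norm r p = absval (coeff p i) * r ^ i"
    "\<And>j. i < j \<Longrightarrow> p \<noteq> 0 \<Longrightarrow> 0 < r \<Longrightarrow> absval (coeff p j) * r ^ j < gauss_norm r p"
proof -
  define S where "S = {i. i \<le> degree p \<and> gauss_norm r p = absval (coeff p i) * r ^ i}"
  have S: "finite S" "S \<noteq> {}"
    using gauss_norm_attained[of p r] by (auto simp: S_def)
  have "Max S \<in> S" using S by simp
  moreover have "absval (coeff p j) * r ^ j < gauss_norm r p" if "Max S < j" "p \<noteq> 0" "0 < r" for j
  proof (cases "j \<le> degree p")
    case True
    then have "j \<notin> S" using that S Max_ge[of S j] by auto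
    then show ?thesis
      using True gauss_norm_ge[OF assms, of p j] by (auto simp: S_def)
  next
    case False
    have "gauss_norm r p > 0"
      using gauss_norm_eq_zero[of r p] gauss_norm_nonneg[of r p] that by linarith
    then show ?thesis using False by (simp add: coeff_eq_0)
  qed
  ultimately show ?thesis using that by (auto simp: S_def)
qed

lemma gauss_norm_mult:
  assumes "0 \<le> r"
  shows "gauss_norm r (p * q) = gauss_norm r p * gauss_norm r q"
proof (cases "r = 0 \<or> p = 0 \<or> q = 0")
  case True
  then show ?thesis
  proof (elim disjE)
    assume "r = 0"
    then show ?thesis by (simp add: gauss_norm_zero_radius coeff_mult absval_mult)
  qed (use gauss_norm_const[of r 0] in auto)
next
  case False
  then have r: "0 < r" and nz: "p \<noteq> 0" "q \<noteq> 0" using assms by auto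
  let ?P = "gauss_norm r p" and ?Q = "gauss_norm r q"
  have pos: "?P > 0" "?Q > 0"
    using gauss_norm_eq_zero[OF r] gauss_norm_nonneg[OF assms] nz by (metis less_le)+
  have split: "absval (coeff p i * coeff q (n - i)) * r ^ n =
      (absval (coeff p i) * r ^ i) * (absval (coeff q (n - i)) * r ^ (n - i))" if "i \<le> n" for i n
    using that by (simp add: absval_mult power_add[symmetric] algebra_simps)
  show ?thesis
  proof (rule antisym)
    show "gauss_norm r (p * q) \<le> ?P * ?Q"
    proof (rule gauss_norm_leI)
      fix n
      have "absval (\<Sum>i\<le>n. coeff p i * coeff q (n - i)) \<le> ?P * ?Q / r ^ n"
      proof (rule absval_sum_le)
        fix i assume "i \<in> {..n}"
        then have "absval (coeff p i * coeff q (n - i)) * r ^ n \<le> ?P * ?Q"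
          unfolding split[of i n, simplified] using split[of i n]
          using gauss_norm_ge[OF assms, of p i] gauss_norm_ge[OF assms, of q "n - i"] pos r
          by (simp add: mult_mono)
        then show "absval (coeff p i * coeff q (n - i)) \<le> ?P * ?Q / r ^ n"
          using r by (simp add: pos_le_divide_eq)
      qed (use pos r in auto)
      then show "absval (coeff (p * q) n) * r ^ n \<le> ?P * ?Q"
        using r by (simp add: coeff_mult pos_le_divide_eq)
    qed
  next
    obtain i0 where i0: "?P = absval (coeff p i0) * r ^ i0"
        "\<And>j. i0 < j \<Longrightarrow> absval (coeff p j) * r ^ j < ?P"
      using gauss_norm_last_index[OF assms, of p] nz r by metis
    obtain j0 where j0: "?Q = absval (coeff q j0) * r ^ j0"
        "\<And>j. j0 < j \<Longrightarrow> absval (coeff q j) * r ^ j < ?Q"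
      using gauss_norm_last_index[OF assms, of q] nz r by metis
    let ?n = "i0 + j0"
    have lt: "x * y < A * B" if "x < A" "y \<le> B" "0 \<le> x" "0 \<le> y" "0 < B" for x y A B :: real
      using that by (meson mult_left_mono mult_strict_right_mono le_less_trans)
    have "absval (\<Sum>i\<in>{..?n} - {i0}. coeff p i * coeff q (?n - i)) < ?P * ?Q / r ^ ?n"
    proof (rule absval_sum_less)
      fix i assume i: "i \<in> {..?n} - {i0}"
      have "(absval (coeff p i) * r ^ i) * (absval (coeff q (?n - i)) * r ^ (?n - i)) < ?P * ?Q"
      proof (cases "i0 < i")
        case True
        then show ?thesis
          using i0(2)[OF True] gauss_norm_ge[OF assms, of q "?n - i"] pos r
          by (intro lt) auto
      next
        case False
        then have "j0 < ?n - i" using i by auto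
        then show ?thesis
          using j0(2) gauss_norm_ge[OF assms, of p i] pos r
          by (subst mult.commute, subst (2) mult.commute, intro lt) auto
      qed
      then show "absval (coeff p i * coeff q (?n - i)) < ?P * ?Q / r ^ ?n"
        using split[of i ?n] i r by (simp add: pos_less_divide_eq)
    qed (use pos r in auto)
    moreover have main: "absval (coeff p i0 * coeff q j0) = ?P * ?Q / r ^ ?n"
      using i0(1) j0(1) r by (simp add: absval_mult power_add)
    moreover have "coeff (p * q) ?n =
        coeff p i0 * coeff q j0 + (\<Sum>i\<in>{..?n} - {i0}. coeff p i * coeff q (?n - i))"
      by (simp add: coeff_mult sum.remove[of "{..?n}" i0])
    ultimately have "absval (coeff (p * q) ?n) = ?P * ?Q / r ^ ?n"
      by (metis absval_add_eq)
    then have "?P * ?Q = absval (coeff (p * q) ?n) * r ^ ?n"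
      using r by simp
    then show "?P * ?Q \<le> gauss_norm r (p * q)"
      using gauss_norm_ge[OF assms, of "p * q" ?n] by simp
  qed
qed

text \<open>
  For \<open>r > 0\<close> this is the seminorm of the point \<open>\<zeta>(a, r)\<close>. It is defined through the coefficients
  of the expansion at \<open>a\<close>, not as a supremum, so that \<open>r\<close> can be any nonnegative real: the circles in
  the residue argument and the paths in the Berkovich line need radii outside the value group, and
  \<open>r = 0\<close> gives the classical points.
\<close>

definition disk_norm :: "'a::nonarch_field \<Rightarrow> real \<Rightarrow> 'a poly \<Rightarrow> real" where
  "disk_norm a r p = gauss_norm r (p \<circ>\<^sub>p [:a, 1:])"

lemma disk_norm_nonneg: "0 \<le> r \<Longrightarrow> 0 \<le> disk_norm a r p"
  by (simp add: disk_norm_def gauss_norm_nonneg)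

lemma disk_norm_mult: "0 \<le> r \<Longrightarrow> disk_norm a r (p * q) = disk_norm a r p * disk_norm a r q"
  by (simp add: disk_norm_def pcompose_mult gauss_norm_mult)

lemma disk_norm_add: "0 \<le> r \<Longrightarrow> disk_norm a r (p + q) \<le> max (disk_norm a r p) (disk_norm a r q)"
  by (simp add: disk_norm_def pcompose_add gauss_norm_add)

lemma disk_norm_const [simp]: "disk_norm a r [:c:] = absval c"
  by (simp add: disk_norm_def)

lemma disk_norm_zero [simp]: "disk_norm a r 0 = 0"
  using disk_norm_const[of a r 0] by simp

lemma disk_norm_one [simp]: "disk_norm a r 1 = 1"
  using disk_norm_const[of a r 1] by (simp add: one_pCons)

lemma disk_norm_linear: "disk_norm a r [:- c, 1:] = max (absval (a - c)) r"
  by (simp add: disk_norm_def gauss_norm_linear pcompose_pCons)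

lemma disk_norm_zero_radius: "disk_norm a 0 p = absval (poly p a)"
  by (simp add: disk_norm_def gauss_norm_zero_radius coeff_pcompose_0)

lemma disk_norm_eq_zero: "0 < r \<Longrightarrow> disk_norm a r p = 0 \<longleftrightarrow> p = 0"
  by (simp add: disk_norm_def gauss_norm_eq_zero pcompose_eq_0_iff)

lemma disk_norm_pos: "0 < r \<Longrightarrow> p \<noteq> 0 \<Longrightarrow> 0 < disk_norm a r p"
  using disk_norm_eq_zero disk_norm_nonneg by (metis less_le)

lemma disk_norm_power: "0 \<le> r \<Longrightarrow> disk_norm a r (p ^ n) = disk_norm a r p ^ n"
  by (induction n) (simp_all add: disk_norm_mult)

lemma disk_norm_smult: "0 \<le> r \<Longrightarrow> disk_norm a r (smult c p) = absval c * disk_norm a r p"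
  using disk_norm_mult[of r a "[:c:]" p] by simp

lemma disk_norm_minus: "0 \<le> r \<Longrightarrow> disk_norm a r (- p) = disk_norm a r p"
  using disk_norm_smult[of r a "-1" p] by simp

lemma disk_norm_diff: "0 \<le> r \<Longrightarrow> disk_norm a r (p - q) \<le> max (disk_norm a r p) (disk_norm a r q)"
  using disk_norm_add[of r a p "- q"] by (simp add: disk_norm_minus)

lemma disk_norm_add_eq:
  assumes "0 \<le> r" "disk_norm a r q < disk_norm a r p"
  shows "disk_norm a r (p + q) = disk_norm a r p"
  using disk_norm_add[OF assms(1), of a p q] disk_norm_diff[OF assms(1), of a "p + q" q] assms(2) by auto

lemma disk_norm_lead_coeff:
  assumes "0 \<le> r"
  shows "absval (lead_coeff p) * r ^ degree p \<le> disk_norm a r p"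
proof -
  have "lead_coeff (p \<circ>\<^sub>p [:a, 1:]) = lead_coeff p"
    by (subst lead_coeff_comp) auto
  then show ?thesis
    using gauss_norm_ge[OF assms, of "p \<circ>\<^sub>p [:a, 1:]" "degree p"]
    by (simp add: disk_norm_def degree_pcompose)
qed

section \<open>Partial fractions and residues\<close>

definition root_poly :: "'a::field multiset \<Rightarrow> 'a poly" where
  "root_poly M = (\<Prod>\<alpha>\<in>#M. [:- \<alpha>, 1:])"

lemma root_poly_empty [simp]: "root_poly {#} = 1"
  and root_poly_add_mset [simp]: "root_poly (add_mset \<alpha> M) = [:- \<alpha>, 1:] * root_poly M"
  and root_poly_union: "root_poly (M + N) = root_poly M * root_poly N"
  by (simp_all add: root_poly_def)

lemma root_poly_sum: "root_poly (\<Sum>i\<in>I. M i) = (\<Prod>i\<in>I. root_poly (M i))"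
  by (induction I rule: infinite_finite_induct) (simp_all add: root_poly_union)

lemma lead_coeff_root_poly [simp]: "lead_coeff (root_poly M) = 1"
  by (induction M) (simp_all only: root_poly_empty root_poly_add_mset lead_coeff_mult, simp_all)

lemma root_poly_nonzero [simp]: "root_poly M \<noteq> 0"
  using lead_coeff_root_poly[of M] by (metis leading_coeff_0_iff zero_neq_one)

lemma degree_root_poly: "degree (root_poly M) = size M"
proof (induction M)
  case (add \<alpha> M)
  then show ?case
    using root_poly_nonzero[of M] by (simp only: root_poly_add_mset, subst degree_mult_eq) auto
qed simp

lemma poly_root_poly_eq_0: "poly (root_poly M) x = 0 \<longleftrightarrow> x \<in># M"
  by (induction M) auto

lemma factor_root_poly:
  fixes p :: "'a::alg_closed_field poly"
  assumes "p \<noteq> 0"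
  shows "p = smult (lead_coeff p) (root_poly (proots p))"
proof -
  obtain A where A: "size A = degree p" "p = smult (lead_coeff p) (\<Prod>x\<in>#A. [:- x, 1:])"
    using alg_closed_imp_factorization[OF assms] by blast
  have "proots (\<Prod>x\<in>#A. [:- x, 1:]) = A"
  proof (induction A)
    case (add x A)
    have "(\<Prod>x\<in>#A. [:- x, 1:]) \<noteq> 0"
      using root_poly_nonzero[of A] by (simp add: root_poly_def)
    then have "proots ([:- x, 1:] * (\<Prod>x\<in>#A. [:- x, 1:])) = {#x#} + A"
      by (subst proots_mult) (auto simp: add)
    then show ?case by (simp only: image_mset_add_mset prod_mset.add_mset) simp
  qed simp
  then have "proots p = A"
    using assms by (subst A(2)) simp
  then show ?thesis using A(2) by (simp add: root_poly_def)
qed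

lemma disk_norm_root_poly_inside:
  assumes "0 \<le> \<rho>" "\<And>\<alpha>. \<alpha> \<in># M \<Longrightarrow> absval (\<alpha> - a) \<le> \<rho>"
  shows "disk_norm a \<rho> (root_poly M) = \<rho> ^ size M"
  using assms(2)
proof (induction M)
  case (add \<alpha> M)
  then have "absval (a - \<alpha>) \<le> \<rho>"
    by (simp add: absval_diff_commute)
  then show ?case
    using add assms(1)
    by (simp only: root_poly_add_mset disk_norm_mult disk_norm_linear) (simp add: max_def)
qed simp

text \<open>
  A monic polynomial without roots in a disk is constant on the disk up to a smaller error, since
  this holds for each factor \<open>z - \<beta> = (a - \<beta>) + (z - a)\<close>.
\<close>

lemma disk_norm_sub_value_less:
  assumes "0 \<le> \<rho>" "\<And>\<beta>. \<beta> \<in># N \<Longrightarrow> \<rho> < absval (\<beta> - a)"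
  shows "disk_norm a \<rho> (root_poly N - [:poly (root_poly N) a:]) < absval (poly (root_poly N) a)"
  using assms(2)
proof (induction N)
  case (add \<beta> N)
  let ?B = "root_poly N" let ?b = "poly ?B a"
  have far: "\<rho> < absval (a - \<beta>)"
    using add.prems[of \<beta>] by (simp add: absval_diff_commute)
  have IH: "disk_norm a \<rho> (?B - [:?b:]) < absval ?b"
    using add by simp
  then have pos: "0 < absval ?b"
    using disk_norm_nonneg[OF assms(1)] by (metis order_le_less_trans)
  have "disk_norm a \<rho> ([:?b:] + (?B - [:?b:])) = disk_norm a \<rho> [:?b:]"
    using IH by (intro disk_norm_add_eq[OF assms(1)]) simp
  then have normB: "disk_norm a \<rho> ?B = absval ?b" by simp
  have "[:- \<beta>, 1:] * ?B - [:(a - \<beta>) * ?b:] = [:- a, 1:] * ?B + smult (a - \<beta>) (?B - [:?b:])"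
    by (simp add: algebra_simps smult_diff_right smult_diff_left)
  then have "disk_norm a \<rho> ([:- \<beta>, 1:] * ?B - [:(a - \<beta>) * ?b:])
      \<le> max (\<rho> * absval ?b) (absval (a - \<beta>) * disk_norm a \<rho> (?B - [:?b:]))"
    using disk_norm_add[OF assms(1), of a "[:- a, 1:] * ?B" "smult (a - \<beta>) (?B - [:?b:])"] assms(1)
    by (simp only: disk_norm_mult disk_norm_smult disk_norm_linear normB) simp
  also have "\<dots> < absval (a - \<beta>) * absval ?b"
    using far IH pos assms(1) by (auto intro: mult_strict_left_mono mult_strict_right_mono)
  finally show ?case
    by (simp only: absval_mult[symmetric] root_poly_add_mset poly_mult) (simp add: algebra_simps)
qed (simp add: one_pCons)

text \<open>
  In the division by \<open>A\<close>, each step subtracts a multiple of \<open>(z - a)\<^sup>m A\<close> that cancels the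
  leading term. Since \<open>A\<close> has norm \<open>\<rho>\<close> to the power \<open>degree A\<close>, this multiple has the same norm as
  the leading term itself.
\<close>

lemma disk_norm_mod_le:
  fixes A g :: "'a::nonarch_field poly"
  assumes "0 < \<rho>" "lead_coeff A = 1" "disk_norm a \<rho> A = \<rho> ^ degree A"
  shows "disk_norm a \<rho> (g mod A) \<le> disk_norm a \<rho> g"
proof (induction "degree g" arbitrary: g rule: less_induct)
  case less
  show ?case
  proof (cases "degree g < degree A \<or> g = 0")
    case True
    then show ?thesis by (auto simp: mod_poly_less)
  next
    case False
    (* Powers of z - a, not of z: they have norm \<rho>^m at any centre. *)
    define m where "m = [:- a, 1:] ^ (degree g - degree A)"
    define s where "s = smult (lead_coeff g) m * A"
    have lcm: "lead_coeff m = 1" "degree m = degree g - degree A"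
      using lead_coeff_power[of "[:- a, 1:]" "degree g - degree A"] by (simp_all add: m_def degree_linear_power)
    then have "m \<noteq> 0" by auto
    have "A \<noteq> 0" using assms(2) by auto
    have degs: "degree s = degree g"
      using False \<open>m \<noteq> 0\<close> \<open>A \<noteq> 0\<close> lcm(2) by (simp add: s_def degree_mult_eq)
    have lcs: "coeff s (degree g) = lead_coeff g"
      using degs lcm(1) assms(2) by (metis (no_types) lead_coeff_mult lead_coeff_smult mult.right_neutral s_def)
    have "disk_norm a \<rho> m = \<rho> ^ (degree g - degree A)"
      using assms(1) by (simp add: m_def disk_norm_power disk_norm_linear)
    then have "disk_norm a \<rho> s = absval (lead_coeff g) * \<rho> ^ degree g"
      using False assms by (simp add: s_def disk_norm_mult disk_norm_smult power_add[symmetric] mult.assoc)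
    then have norms: "disk_norm a \<rho> s \<le> disk_norm a \<rho> g"
      using disk_norm_lead_coeff[of \<rho> g a] assms(1) by simp
    have eq: "g mod A = (g - s) mod A"
      by (metis add.commute diff_add_cancel mod_mult_self2 mult.commute s_def)
    have le: "disk_norm a \<rho> (g - s) \<le> disk_norm a \<rho> g"
      using disk_norm_diff[of \<rho> a g s] norms assms(1) by simp
    have "g - s = 0 \<or> degree (g - s) < degree g"
      using lcs degs by (intro eq_zero_or_degree_less) (auto intro: degree_diff_le)
    then show ?thesis
      using less[of "g - s"] le eq disk_norm_nonneg[of \<rho> a g] assms(1) by auto
  qed
qed

text \<open>
  Here \<open>u / A\<close> is the part of \<open>g / (A B)\<close> with poles inside the disk, where the roots of \<open>A\<close> are
  inside and those of \<open>B\<close> outside. Modulo \<open>A\<close> one has \<open>u B \<equiv> g\<close>; as \<open>B\<close> is nearly constant,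
  the reduction modulo \<open>A\<close> multiplies the norm of \<open>u\<close> by that of \<open>B\<close>.
\<close>

lemma partial_fraction_bound:
  assumes "0 < \<rho>" "c \<noteq> 0"
    and inside: "\<And>\<alpha>. \<alpha> \<in># M \<Longrightarrow> absval (\<alpha> - a) \<le> \<rho>"
    and outside: "\<And>\<beta>. \<beta> \<in># N \<Longrightarrow> \<rho> < absval (\<beta> - a)"
    and g: "g = u * smult c (root_poly N) + w * root_poly M"
    and u: "u = 0 \<or> degree u < size M"
  shows "disk_norm a \<rho> u * disk_norm a \<rho> (smult c (root_poly N)) \<le> disk_norm a \<rho> g"
proof (cases "u = 0")
  case True
  then show ?thesis using assms(1) by (simp add: disk_norm_nonneg)
next
  case False
  let ?A = "root_poly M" and ?B = "smult c (root_poly N)"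
  let ?b = "c * poly (root_poly N) a"
  have \<rho>: "0 \<le> \<rho>" using assms(1) by simp
  have small: "disk_norm a \<rho> (?B - [:?b:]) < absval ?b"
  proof -
    have "?B - [:?b:] = smult c (root_poly N - [:poly (root_poly N) a:])"
      by (simp add: smult_diff_right)
    then show ?thesis
      using disk_norm_sub_value_less[OF \<rho> outside, of N] absval_pos[OF assms(2)] \<rho>
      by (simp add: disk_norm_smult absval_mult)
  qed
  have "disk_norm a \<rho> ([:?b:] + (?B - [:?b:])) = disk_norm a \<rho> [:?b:]"
    using small by (intro disk_norm_add_eq[OF \<rho>]) simp
  then have normB: "disk_norm a \<rho> ?B = absval ?b" by simp
  have modbound: "disk_norm a \<rho> (h mod ?A) \<le> disk_norm a \<rho> h" for h
    using disk_norm_mod_le[OF assms(1) lead_coeff_root_poly[of M], of a h]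
      disk_norm_root_poly_inside[of \<rho> M a] inside \<rho>
    by (simp add: degree_root_poly)
  have "u * [:?b:] mod ?A = u * [:?b:]"
    using u False by (intro mod_poly_less) (simp add: degree_root_poly)
  moreover have "u * [:?b:] = g - u * (?B - [:?b:]) - w * ?A"
    unfolding g by (simp add: algebra_simps)
  moreover have "(g - u * (?B - [:?b:]) - w * ?A) mod ?A = (g - u * (?B - [:?b:])) mod ?A"
    by (metis diff_add_cancel mod_mult_self2 mult.commute)
  ultimately have "u * [:?b:] = (g - u * (?B - [:?b:])) mod ?A"
    by metis
  then have "disk_norm a \<rho> (u * [:?b:]) \<le> disk_norm a \<rho> (g - u * (?B - [:?b:]))"
    using modbound by metis
  also have "\<dots> \<le> max (disk_norm a \<rho> g) (disk_norm a \<rho> (u * (?B - [:?b:])))"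
    by (rule disk_norm_diff[OF \<rho>])
  finally have "disk_norm a \<rho> u * absval ?b
      \<le> max (disk_norm a \<rho> g) (disk_norm a \<rho> u * disk_norm a \<rho> (?B - [:?b:]))"
    using \<rho> by (simp only: disk_norm_mult disk_norm_const)
  moreover have "disk_norm a \<rho> u * disk_norm a \<rho> (?B - [:?b:]) < disk_norm a \<rho> u * absval ?b"
    using small disk_norm_pos[OF assms(1) False] by simp
  ultimately show ?thesis unfolding normB by linarith
qed

lemma coeff_bound_disk_norm:
  assumes "0 \<le> \<rho>" "degree y \<le> n"
  shows "absval (coeff y n) * \<rho> ^ n \<le> disk_norm a \<rho> y"
proof (cases "degree y = n")
  case True
  then show ?thesis using disk_norm_lead_coeff[OF assms(1), of y a] by simp
next
  case False
  then show ?thesis using assms disk_norm_nonneg[of \<rho> a y] by (simp add: coeff_eq_0)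
qed

text \<open>
  The nonarchimedean form of the bound of a residue by the radius times the maximum on the circle:
  the hypothesis \<open>less\<close> says that \<open>|q / P| < 1 / \<rho>\<close>.
\<close>

lemma residue_small:
  assumes "0 < \<rho>" "c \<noteq> 0"
    and inside: "\<And>\<alpha>. \<alpha> \<in># M \<Longrightarrow> absval (\<alpha> - a) \<le> \<rho>"
    and outside: "\<And>\<beta>. \<beta> \<in># N \<Longrightarrow> \<rho> < absval (\<beta> - a)"
    and q: "q = u * smult c (root_poly N) + w * root_poly M"
    and u: "u = 0 \<or> degree u < size M"
    and less: "\<rho> * disk_norm a \<rho> q < disk_norm a \<rho> (smult c (root_poly N) * root_poly M)"
  shows "absval (coeff u (size M - 1)) < 1"
proof (cases "u = 0")
  case False
  let ?B = "smult c (root_poly N)"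
  obtain n where n: "size M = Suc n" using u False by (cases "size M") auto
  have B: "0 < disk_norm a \<rho> ?B"
    using assms(1,2) by (intro disk_norm_pos) auto
  have "absval (coeff u n) * \<rho> ^ n * disk_norm a \<rho> ?B \<le> disk_norm a \<rho> u * disk_norm a \<rho> ?B"
    using u False n assms(1) B by (intro mult_right_mono coeff_bound_disk_norm) auto
  also have "\<dots> \<le> disk_norm a \<rho> q"
    by (rule partial_fraction_bound[OF assms(1,2) inside outside q u])
  also have "\<dots> < \<rho> ^ n * disk_norm a \<rho> ?B"
    using less assms(1) n disk_norm_root_poly_inside[of \<rho> M a] inside
    by (simp add: disk_norm_mult disk_norm_smult mult_ac)
  finally show ?thesis using n assms(1) B by (simp add: mult_less_cancel_right)
qed simp

text \<open>
  The difference of \<open>q / P\<close> and \<open>1 / (z - a)\<close> is \<open>h / ((z - a) P)\<close>, which is smaller than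
  \<open>1 / \<rho>\<close> on the circle, so its residue is less than 1 in absolute value.
\<close>

lemma residue_near_one:
  assumes "0 < \<rho>" "c \<noteq> 0"
    and inside: "\<And>\<alpha>. \<alpha> \<in># M \<Longrightarrow> absval (\<alpha> - a) \<le> \<rho>"
    and outside: "\<And>\<beta>. \<beta> \<in># N \<Longrightarrow> \<rho> < absval (\<beta> - a)"
    and q: "q = v * smult c (root_poly N) + w * root_poly M"
    and v: "v = 0 \<or> degree v < size M"
    and P: "[:- a, 1:] * q - h = smult c (root_poly N) * root_poly M"
    and less: "disk_norm a \<rho> h < \<rho> * disk_norm a \<rho> q"
  shows "absval (coeff v (size M - 1) - 1) < 1"
proof -
  let ?A = "root_poly M" and ?B = "smult c (root_poly N)" and ?n = "size M"
  (* y / ((z - a) A) is the part of q / P - 1 / (z - a) with poles inside the disk. *)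
  define y where "y = [:- a, 1:] * v - ?A"
  have \<rho>: "0 \<le> \<rho>" using assms(1) by simp
  have B: "0 < disk_norm a \<rho> ?B"
    using assms(1,2) by (intro disk_norm_pos) auto
  have deg: "degree ([:- a, 1:] * v) \<le> ?n"
    using v by (cases "v = 0") (auto simp: degree_mult_eq simp del: mult_pCons_left)
  then have degy: "degree y \<le> ?n"
    unfolding y_def by (intro degree_diff_le) (auto simp: degree_root_poly)
  have coeffy: "coeff y ?n = coeff v (?n - 1) - 1"
  proof -
    have "coeff ([:- a, 1:] * v) ?n = coeff v (?n - 1)"
      using v by (cases ?n) (auto simp: coeff_eq_0)
    then show ?thesis
      using lead_coeff_root_poly[of M] by (simp only: y_def coeff_diff degree_root_poly)
  qed
  have h: "h = y * ?B + w * root_poly (add_mset a M)"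
  proof -
    have "h = [:- a, 1:] * q - ?B * ?A" using P by (simp add: algebra_simps)
    also have "\<dots> = ([:- a, 1:] * v - ?A) * ?B + w * ([:- a, 1:] * ?A)"
      by (subst q) (simp only: algebra_simps)
    finally show ?thesis by (simp only: y_def root_poly_add_mset)
  qed
  have "absval (coeff y ?n) * \<rho> ^ ?n * disk_norm a \<rho> ?B \<le> disk_norm a \<rho> y * disk_norm a \<rho> ?B"
    using degy \<rho> B by (intro mult_right_mono coeff_bound_disk_norm) auto
  also have "\<dots> \<le> disk_norm a \<rho> h"
    using degy by (intro partial_fraction_bound[OF assms(1,2) _ outside h]) (auto simp: \<rho> inside)
  also have "\<dots> < \<rho> * disk_norm a \<rho> q" by (rule less)
  also have "\<dots> = disk_norm a \<rho> (?B * ?A)"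
  proof -
    have "disk_norm a \<rho> ([:- a, 1:] * q) = \<rho> * disk_norm a \<rho> q"
      using \<rho> by (simp only: disk_norm_mult disk_norm_linear) simp
    then show ?thesis
      using disk_norm_add_eq[OF \<rho>, of a "- h" "[:- a, 1:] * q"] less
      unfolding P[symmetric] by (simp only: disk_norm_minus[OF \<rho>] add_uminus_conv_diff)
  qed
  also have "\<dots> = \<rho> ^ ?n * disk_norm a \<rho> ?B"
    using \<rho> disk_norm_root_poly_inside[OF \<rho> inside] by (simp only: disk_norm_mult) simp
  finally show ?thesis using coeffy assms(1) B by (simp add: mult_less_cancel_right)
qed

text \<open>
  The Bezout identity, over any field that contains the roots of one of the two polynomials, by
  induction over these roots. All partial fraction decompositions below come from it.
\<close>

lemma root_poly_comaximal:
  assumes "\<And>\<alpha>. \<alpha> \<in># M \<Longrightarrow> poly B \<alpha> \<noteq> 0"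
  shows "\<exists>u w. u * B + w * root_poly M = 1"
  using assms
proof (induction M)
  case empty
  then show ?case by (intro exI[of _ 0] exI[of _ 1]) simp
next
  case (add \<alpha> M)
  then obtain u w where uw: "u * B + w * root_poly M = 1" by force
  define b where "b = poly B \<alpha>"
  have b: "b \<noteq> 0" using add.prems[of \<alpha>] by (simp add: b_def)
  obtain k where k: "B - [:b:] = [:- \<alpha>, 1:] * k"
    using poly_eq_0_iff_dvd[of "B - [:b:]" \<alpha>] by (auto simp: b_def dvd_def)
  have "[:b:] = B - [:- \<alpha>, 1:] * k" using k by (simp add: algebra_simps)
  then have "smult (inverse b) [:b:] = smult (inverse b) B - [:- \<alpha>, 1:] * smult (inverse b) k"
    by (simp only: smult_diff_right mult_smult_right)
  moreover have "smult (inverse b) [:b:] = 1" using b by (simp add: one_pCons)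
  ultimately have one: "smult (inverse b) B - [:- \<alpha>, 1:] * smult (inverse b) k = 1" by simp
  have ring: "(u * B + w * R) * (c * B - X * Y) = (u * c * B - u * (X * Y) + w * R * c) * B + - (w * Y) * (X * R)"
    for c X Y R :: "'a poly"
    by (simp add: algebra_simps)
  have "1 = (u * B + w * root_poly M) * ([:inverse b:] * B - [:- \<alpha>, 1:] * smult (inverse b) k)"
    using uw one by simp
  also have "\<dots> = (u * [:inverse b:] * B - u * ([:- \<alpha>, 1:] * smult (inverse b) k) + w * root_poly M * [:inverse b:]) * B
      + (- (w * smult (inverse b) k)) * ([:- \<alpha>, 1:] * root_poly M)"
    by (rule ring)
  finally show ?case unfolding root_poly_add_mset by metis
qed

lemma partial_fractions:
  fixes M :: "'b \<Rightarrow> 'a::field multiset"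
  assumes "finite I"
    and "\<And>i j \<alpha>. i \<in> I \<Longrightarrow> j \<in> I \<Longrightarrow> i \<noteq> j \<Longrightarrow> \<alpha> \<in># M i \<Longrightarrow> \<alpha> \<notin># M j"
    and "\<And>i \<alpha>. i \<in> I \<Longrightarrow> \<alpha> \<in># M i \<Longrightarrow> poly B \<alpha> \<noteq> 0"
  shows "\<exists>u w. (\<forall>i\<in>I. u i = 0 \<or> degree (u i) < size (M i)) \<and>
    g = (\<Sum>i\<in>I. u i * (B * (\<Prod>j\<in>I - {i}. root_poly (M j)))) + w * (\<Prod>i\<in>I. root_poly (M i))"
  using assms
proof (induction I arbitrary: B rule: finite_induct)
  case empty
  then show ?case by auto
next
  case (insert k I)
  let ?A = "\<lambda>i. root_poly (M i)"
  have "\<exists>u w. (\<forall>i\<in>I. u i = 0 \<or> degree (u i) < size (M i)) \<and>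
    g = (\<Sum>i\<in>I. u i * (B * ?A k * (\<Prod>j\<in>I - {i}. ?A j))) + w * (\<Prod>i\<in>I. ?A i)"
    using insert.prems insert.hyps(2)
    by (intro insert.IH) (auto simp: poly_root_poly_eq_0, metis)
  then obtain u w where u: "\<And>i. i \<in> I \<Longrightarrow> u i = 0 \<or> degree (u i) < size (M i)"
    and g: "g = (\<Sum>i\<in>I. u i * (B * ?A k * (\<Prod>j\<in>I - {i}. ?A j))) + w * (\<Prod>i\<in>I. ?A i)"
    by blast
  obtain s t where st: "s * B + t * ?A k = 1"
    using root_poly_comaximal[of "M k" B] insert.prems(2) by auto
  define x where "x = (w * s) mod ?A k"
  define d where "d = (w * s) div ?A k"
  have x: "x = 0 \<or> degree x < size (M k)"
    using degree_mod_less[of "?A k" "w * s"] by (auto simp: x_def degree_root_poly)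
  have ws: "w * s = d * ?A k + x" by (simp add: d_def x_def)
  have "w = w * (s * B + t * ?A k)" using st by simp
  also have "\<dots> = (w * s) * B + w * t * ?A k" by (simp add: algebra_simps)
  also have "\<dots> = x * B + (d * B + w * t) * ?A k" unfolding ws by (simp add: algebra_simps)
  finally have w: "w = x * B + (d * B + w * t) * ?A k" .
  (* w = x B + (...) A_k splits off the fraction with denominator A_k; reducing modulo A_k has made
     its numerator x small in degree. *)
  define u' where "u' = u(k := x)"
  have prod: "(\<Prod>j\<in>insert k I - {i}. ?A j) = ?A k * (\<Prod>j\<in>I - {i}. ?A j)" if "i \<in> I" for i
  proof -
    have "insert k I - {i} = insert k (I - {i})" using that insert.hyps(2) by auto
    then show ?thesis using insert.hyps by simp
  qed
  have "(\<Sum>i\<in>insert k I. u' i * (B * (\<Prod>j\<in>insert k I - {i}. ?A j)))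
      = x * (B * (\<Prod>i\<in>I. ?A i)) + (\<Sum>i\<in>I. u i * (B * ?A k * (\<Prod>j\<in>I - {i}. ?A j)))"
  proof -
    have "insert k I - {k} = I" using insert.hyps(2) by auto
    moreover have "(\<Sum>i\<in>I. u' i * (B * (\<Prod>j\<in>insert k I - {i}. ?A j)))
        = (\<Sum>i\<in>I. u i * (B * ?A k * (\<Prod>j\<in>I - {i}. ?A j)))"
      using insert.hyps(2) by (intro sum.cong) (auto simp: u'_def prod mult.assoc)
    ultimately show ?thesis using insert.hyps by (simp add: u'_def)
  qed
  moreover have "g = (\<Sum>i\<in>I. u i * (B * ?A k * (\<Prod>j\<in>I - {i}. ?A j)))
      + (x * B + (d * B + w * t) * ?A k) * (\<Prod>i\<in>I. ?A i)"
    using g w by simp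
  ultimately have "g = (\<Sum>i\<in>insert k I. u' i * (B * (\<Prod>j\<in>insert k I - {i}. ?A j)))
      + (d * B + w * t) * (\<Prod>i\<in>insert k I. ?A i)"
    using insert.hyps by (simp add: algebra_simps)
  moreover have "\<forall>i\<in>insert k I. u' i = 0 \<or> degree (u' i) < size (M i)"
    using u x insert.hyps(2) by (auto simp: u'_def)
  ultimately show ?case by blast
qed

lemma coeff_mult_monic:
  assumes "u = 0 \<or> degree u < n" "lead_coeff A = 1" "0 < n"
  shows "coeff (u * A) (n - 1 + degree A) = (coeff u (n - 1) :: 'a::idom)"
proof (cases "u = 0 \<or> degree u \<noteq> n - 1")
  case True
  then show ?thesis
  proof
    assume ne: "degree u \<noteq> n - 1"
    then have "degree u < n - 1 \<or> u = 0" using assms by auto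
    then show ?thesis
      using degree_mult_le[of u A] by (auto intro!: coeff_eq_0 simp: coeff_eq_0)
  qed simp
next
  case False
  then show ?thesis using coeff_mult_degree_sum[of u A] assms(2) by simp
qed

text \<open>
  Residues are additive: when partial fractions over several disjoint sets of poles are put over a
  common denominator, the top coefficients of the numerators add up.
\<close>

lemma sum_partial_numerators:
  fixes M :: "'b \<Rightarrow> 'a::field multiset"
  assumes "finite I" "\<And>i. i \<in> I \<Longrightarrow> u i = 0 \<or> degree (u i) < size (M i)"
  defines "v \<equiv> \<Sum>i\<in>I. u i * (\<Prod>j\<in>I - {i}. root_poly (M j))"
    and "n \<equiv> size (\<Sum>i\<in>I. M i)"
  shows "v = 0 \<or> degree v < n"
    and "coeff v (n - 1) = (\<Sum>i\<in>I. coeff (u i) (size (M i) - 1))"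
proof -
  let ?A = "\<lambda>i. \<Prod>j\<in>I - {i}. root_poly (M j)"
  have A: "?A i = root_poly (\<Sum>j\<in>I - {i}. M j)" for i by (simp add: root_poly_sum)
  have size: "n = size (M i) + degree (?A i)" if "i \<in> I" for i
    using assms(1) that by (simp add: n_def A degree_root_poly sum.remove[of I i])
  have term0: "u i * ?A i = 0 \<or> degree (u i * ?A i) < n" if "i \<in> I" for i
    using assms(2)[OF that] size[OF that] degree_mult_le[of "u i" "?A i"] by force
  show "v = 0 \<or> degree v < n"
  proof (cases "n = 0")
    case True
    then have "v = 0" unfolding v_def using term0 by (intro sum.neutral) auto
    then show ?thesis ..
  next
    case False
    have "degree v \<le> n - 1"
      unfolding v_def using term0 False by (intro degree_sum_le[OF assms(1)]) force
    then show ?thesis using False by linarith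
  qed
  have "coeff (u i * ?A i) (n - 1) = coeff (u i) (size (M i) - 1)" if "i \<in> I" for i
  proof (cases "u i = 0")
    case False
    then have pos: "0 < size (M i)" using assms(2)[OF that] by auto
    have "n - 1 = size (M i) - 1 + degree (?A i)" using size[OF that] pos by simp
    then show ?thesis
      using coeff_mult_monic[OF assms(2)[OF that] _ pos, of "?A i"] by (simp only: A lead_coeff_root_poly)
  qed simp
  then show "coeff v (n - 1) = (\<Sum>i\<in>I. coeff (u i) (size (M i) - 1))"
    unfolding v_def coeff_sum by (intro sum.cong) auto
qed

lemma sum_filter_mset_disjoint:
  assumes "finite I" "\<And>i j x. i \<in> I \<Longrightarrow> j \<in> I \<Longrightarrow> i \<noteq> j \<Longrightarrow> x \<in># R \<Longrightarrow> Q i x \<Longrightarrow> \<not> Q j x"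
  shows "(\<Sum>i\<in>I. filter_mset (Q i) R) = filter_mset (\<lambda>x. \<exists>i\<in>I. Q i x) R"
proof (rule multiset_eqI)
  fix x
  show "count (\<Sum>i\<in>I. filter_mset (Q i) R) x = count (filter_mset (\<lambda>x. \<exists>i\<in>I. Q i x) R) x"
  proof (cases "x \<in># R \<and> (\<exists>i\<in>I. Q i x)")
    case True
    then obtain k where k: "k \<in> I" "Q k x" by blast
    then have "(\<Sum>i\<in>I - {k}. count (filter_mset (Q i) R) x) = 0"
      using assms(2)[of k _ x] True by (intro sum.neutral) auto
    then show ?thesis
      using k True assms(1) by (auto simp: count_sum sum.remove[of I k])
  next
    case False
    then show ?thesis by (auto simp: count_sum not_in_iff intro!: sum.neutral)
  qed
qed

text \<open>
  The counting argument. The disks indexed by \<open>I\<close> carry small total residues. In the first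
  alternative of \<open>outer\<close> they contain all poles and the total residue is 1, as read off from the
  leading coefficients; in the second, a further disk contains exactly the same poles and has total
  residue near 1.
\<close>

theorem fixed_point_residue_contradiction:
  fixes p q :: "'a::{nonarch_field, alg_closed_field} poly" and I :: "'b set"
  defines "P \<equiv> [:0, 1:] * q - p"
  assumes nz: "P \<noteq> 0" and fin: "finite I"
    and pos: "\<And>i. i \<in> I \<Longrightarrow> 0 < \<rho> i"
    and small: "\<And>i. i \<in> I \<Longrightarrow> \<rho> i * disk_norm (a i) (\<rho> i) q < disk_norm (a i) (\<rho> i) P"
    and disj: "\<And>i j \<alpha>. i \<in> I \<Longrightarrow> j \<in> I \<Longrightarrow> i \<noteq> j \<Longrightarrow> poly P \<alpha> = 0 \<Longrightarrow>
      absval (\<alpha> - a i) \<le> \<rho> i \<Longrightarrow> \<rho> j < absval (\<alpha> - a j)"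
    and outer: "q \<noteq> 0 \<and> degree p \<le> degree q \<and> (\<forall>\<alpha>. poly P \<alpha> = 0 \<longrightarrow> (\<exists>i\<in>I. absval (\<alpha> - a i) \<le> \<rho> i)) \<or>
      (\<exists>e \<sigma>. 0 < \<sigma> \<and> disk_norm e \<sigma> (p - smult e q) < \<sigma> * disk_norm e \<sigma> q \<and>
        (\<forall>\<alpha>. poly P \<alpha> = 0 \<longrightarrow> (absval (\<alpha> - e) \<le> \<sigma> \<longleftrightarrow> (\<exists>i\<in>I. absval (\<alpha> - a i) \<le> \<rho> i))))"
  shows False
proof -
  define R where "R = proots P"
  define c where "c = lead_coeff P"
  define M where "M i = filter_mset (\<lambda>\<alpha>. absval (\<alpha> - a i) \<le> \<rho> i) R" for i
  define N where "N = filter_mset (\<lambda>\<alpha>. \<not> (\<exists>i\<in>I. absval (\<alpha> - a i) \<le> \<rho> i)) R"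
  define S where "S = (\<Sum>i\<in>I. M i)"
  let ?A = "\<lambda>i. root_poly (M i)" and ?B = "smult c (root_poly N)"
  have R: "\<alpha> \<in># R \<longleftrightarrow> poly P \<alpha> = 0" for \<alpha> using nz by (simp add: R_def)
  have c: "c \<noteq> 0" using nz by (simp add: c_def)
  have P: "P = smult c (root_poly R)"
    using factor_root_poly[OF nz] by (simp add: R_def c_def)
  have S: "S = filter_mset (\<lambda>\<alpha>. \<exists>i\<in>I. absval (\<alpha> - a i) \<le> \<rho> i) R"
    unfolding S_def M_def using disj R by (intro sum_filter_mset_disjoint[OF fin]) force
  have RSN: "R = N + S"
    unfolding S N_def by (simp add: multiset_partition[symmetric] add.commute)
  have PBS: "P = ?B * root_poly S"
    unfolding P RSN by (simp add: root_poly_union)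
  have "\<exists>u w. (\<forall>i\<in>I. u i = 0 \<or> degree (u i) < size (M i)) \<and>
    q = (\<Sum>i\<in>I. u i * (?B * (\<Prod>j\<in>I - {i}. ?A j))) + w * (\<Prod>i\<in>I. ?A i)"
  proof (rule partial_fractions[OF fin])
    show "\<alpha> \<notin># M j" if "i \<in> I" "j \<in> I" "i \<noteq> j" "\<alpha> \<in># M i" for i j \<alpha>
      using disj[OF that(1-3), of \<alpha>] that(4) R by (auto simp: M_def)
    show "poly ?B \<alpha> \<noteq> 0" if "i \<in> I" "\<alpha> \<in># M i" for i \<alpha>
      using that c by (auto simp: poly_root_poly_eq_0 M_def N_def)
  qed
  then obtain u w where u: "\<And>i. i \<in> I \<Longrightarrow> u i = 0 \<or> degree (u i) < size (M i)"
    and q: "q = (\<Sum>i\<in>I. u i * (?B * (\<Prod>j\<in>I - {i}. ?A j))) + w * (\<Prod>i\<in>I. ?A i)"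
    by blast
  define v where "v = (\<Sum>i\<in>I. u i * (\<Prod>j\<in>I - {i}. ?A j))"
  have qv: "q = v * ?B + w * root_poly S"
  proof -
    have "v * ?B = (\<Sum>i\<in>I. u i * (?B * (\<Prod>j\<in>I - {i}. ?A j)))"
      unfolding v_def sum_distrib_right by (intro sum.cong) (simp_all add: mult_ac)
    then show ?thesis using q by (simp add: S_def root_poly_sum)
  qed
  have v: "v = 0 \<or> degree v < size S"
    and coeffv: "coeff v (size S - 1) = (\<Sum>i\<in>I. coeff (u i) (size (M i) - 1))"
    unfolding v_def S_def by (rule sum_partial_numerators[OF fin], use u in blast)+
  have "absval (coeff (u i) (size (M i) - 1)) < 1" if i: "i \<in> I" for i
  proof -
    let ?N = "N + (\<Sum>j\<in>I - {i}. M j)"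
    have S': "S = M i + (\<Sum>j\<in>I - {i}. M j)"
      unfolding S_def using i fin by (simp add: sum.remove)
    have PB: "P = smult c (root_poly ?N) * ?A i"
      unfolding PBS S' by (simp add: root_poly_union mult_ac)
    (* The terms with k \<noteq> i all contain the factor A_i, so u_i is also the numerator over A_i when
       all other poles are merged into one group. *)
    define w' where "w' = w * (\<Prod>j\<in>I - {i}. ?A j) + (\<Sum>k\<in>I - {i}. u k * (?B * (\<Prod>j\<in>I - {k} - {i}. ?A j)))"
    have qi: "q = u i * smult c (root_poly ?N) + w' * ?A i"
    proof -
      have "(\<Sum>k\<in>I - {i}. u k * (?B * (\<Prod>j\<in>I - {k}. ?A j))) =
          (\<Sum>k\<in>I - {i}. u k * (?B * (\<Prod>j\<in>I - {k} - {i}. ?A j))) * ?A i"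
        unfolding sum_distrib_right
      proof (rule sum.cong)
        fix k assume "k \<in> I - {i}"
        then have "(\<Prod>j\<in>I - {k}. ?A j) = ?A i * (\<Prod>j\<in>I - {k} - {i}. ?A j)"
          using fin i by (intro prod.remove) auto
        then show "u k * (?B * (\<Prod>j\<in>I - {k}. ?A j)) = u k * (?B * (\<Prod>j\<in>I - {k} - {i}. ?A j)) * ?A i"
          by (simp add: mult_ac)
      qed simp
      moreover have "(\<Prod>i\<in>I. ?A i) = ?A i * (\<Prod>j\<in>I - {i}. ?A j)"
        using fin i by (rule prod.remove)
      moreover have "q = u i * (?B * (\<Prod>j\<in>I - {i}. ?A j))
          + (\<Sum>k\<in>I - {i}. u k * (?B * (\<Prod>j\<in>I - {k}. ?A j))) + w * (\<Prod>i\<in>I. ?A i)"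
        by (subst q) (simp only: sum.remove[OF fin i])
      ultimately show ?thesis
        by (simp add: w'_def root_poly_union root_poly_sum algebra_simps)
    qed
    show ?thesis
    proof (rule residue_small[OF pos[OF i] c _ _ qi u[OF i]])
      show "absval (\<alpha> - a i) \<le> \<rho> i" if "\<alpha> \<in># M i" for \<alpha> using that by (simp add: M_def)
      show "\<rho> i < absval (\<beta> - a i)" if "\<beta> \<in># ?N" for \<beta>
      proof -
        have "\<beta> \<in># N \<or> (\<exists>j\<in>I - {i}. \<beta> \<in># M j)"
          using that fin by (auto simp: in_Union_mset_iff set_mset_sum)
        then show ?thesis
        proof
          assume "\<beta> \<in># N"
          then show ?thesis using i by (auto simp: N_def)
        next
          assume "\<exists>j\<in>I - {i}. \<beta> \<in># M j"
          then obtain j where "j \<in> I" "j \<noteq> i" "\<beta> \<in># M j" by blast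
          then show ?thesis using disj[of j i \<beta>] i R by (auto simp: M_def)
        qed
      qed
      show "\<rho> i * disk_norm (a i) (\<rho> i) q < disk_norm (a i) (\<rho> i) (smult c (root_poly ?N) * ?A i)"
        using small[OF i] PB by simp
    qed
  qed
  then have sum_small: "absval (coeff v (size S - 1)) < 1"
    unfolding coeffv by (intro absval_sum_less) auto
  from outer show False
  proof
    assume all: "q \<noteq> 0 \<and> degree p \<le> degree q \<and> (\<forall>\<alpha>. poly P \<alpha> = 0 \<longrightarrow> (\<exists>i\<in>I. absval (\<alpha> - a i) \<le> \<rho> i))"
    then have N: "N = {#}" using R by (auto simp: N_def filter_mset_eq_conv)
    have degP: "degree P = Suc (degree q)" "lead_coeff P = lead_coeff q"
    proof -
      have lt: "degree p < degree ([:0, 1:] * q)" using all by simp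
      then show "degree P = Suc (degree q)"
        unfolding P_def using all degree_add_eq_left[of "- p" "[:0, 1:] * q"] by simp
      then show "lead_coeff P = lead_coeff q"
        using all by (simp add: P_def coeff_eq_0)
    qed
    have sizeS: "size S = Suc (degree q)"
    proof -
      have "degree P = size S" using c by (simp add: PBS N degree_root_poly)
      then show ?thesis using degP by simp
    qed
    have "w * root_poly S = q - smult c v" using qv by (simp add: N)
    moreover have "degree (q - smult c v) < size S"
      using v sizeS c degree_diff_le[of q "degree q" "smult c v"] by (cases "v = 0") auto
    ultimately have "degree (w * root_poly S) < size S" by simp
    then have "w = 0"
      by (cases "w = 0") (simp_all add: degree_mult_eq degree_root_poly)
    then have "coeff q (degree q) = c * coeff v (size S - 1)"
      using qv sizeS by (simp add: N)
    then have "coeff v (size S - 1) = 1"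
      using degP c by (simp add: c_def)
    then show False using sum_small by simp
  next
    assume "\<exists>e \<sigma>. 0 < \<sigma> \<and> disk_norm e \<sigma> (p - smult e q) < \<sigma> * disk_norm e \<sigma> q \<and>
        (\<forall>\<alpha>. poly P \<alpha> = 0 \<longrightarrow> (absval (\<alpha> - e) \<le> \<sigma> \<longleftrightarrow> (\<exists>i\<in>I. absval (\<alpha> - a i) \<le> \<rho> i)))"
    then obtain e \<sigma> where \<sigma>: "0 < \<sigma>" and
      less: "disk_norm e \<sigma> (p - smult e q) < \<sigma> * disk_norm e \<sigma> q" and
      iff: "\<And>\<alpha>. \<alpha> \<in># R \<Longrightarrow> absval (\<alpha> - e) \<le> \<sigma> \<longleftrightarrow> (\<exists>i\<in>I. absval (\<alpha> - a i) \<le> \<rho> i)"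
      unfolding R by blast
    have "[:- e, 1:] * q - (p - smult e q) = ?B * root_poly S"
      unfolding PBS[symmetric] P_def by simp
    then have "absval (coeff v (size S - 1) - 1) < 1"
      using iff by (intro residue_near_one[OF \<sigma> c _ _ qv v _ less]) (auto simp: S N_def not_le[symmetric])
    then show False
      using sum_small absval_diff_le_max[of "coeff v (size S - 1)" "coeff v (size S - 1) - 1"] by simp
  qed
qed

section \<open>Points of the Berkovich line\<close>

lemma berk_affineD:
  assumes "s \<in> berk_affine"
  shows "0 \<le> s p" "s (p * q) = s p * s q" "s (p + q) \<le> max (s p) (s q)" "s [:c:] = absval c"
  using assms by (auto simp: berk_affine_def)

lemma berk_affine_more:
  assumes "s \<in> berk_affine"
  shows "s 0 = 0" "s 1 = 1" "s (- p) = s p" "s (p - q) \<le> max (s p) (s q)" "s (smult c p) = absval c * s p"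
proof -
  show "s 0 = 0" "s 1 = 1"
    using berk_affineD(4)[OF assms, of 0] berk_affineD(4)[OF assms, of 1] by (simp_all add: one_pCons)
  show sm: "s (smult c p) = absval c * s p" for c p
    using berk_affineD(2)[OF assms, of "[:c:]" p] berk_affineD(4)[OF assms, of c] by simp
  show mn: "s (- p) = s p" for p
    using sm[of "-1" p] by simp
  show "s (p - q) \<le> max (s p) (s q)"
    using berk_affineD(3)[OF assms, of p "- q"] by (simp add: mn)
qed

lemma disk_norm_in_berk_affine: "0 \<le> r \<Longrightarrow> disk_norm a r \<in> berk_affine"
  by (auto simp: berk_affine_def disk_norm_nonneg disk_norm_mult disk_norm_add)

lemma classical_point_Some: "classical_point (Some a) = Some (disk_norm a 0)"
  by (simp add: disk_norm_zero_radius fun_eq_iff)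

lemma topspace_berk_P1: "topspace berk_P1 = insert None (Some ` berk_affine)"
  by (simp add: berk_P1_def)

lemma classical_point_in_topspace: "classical_point c \<in> topspace berk_P1"
  by (cases c) (auto simp: topspace_berk_P1 classical_point_Some disk_norm_in_berk_affine simp del: classical_point.simps(1))

text \<open>
  Over an algebraically closed field every polynomial is a product of linear ones.
\<close>

lemma berk_affine_eqI:
  fixes s t :: "'a::{nonarch_field, alg_closed_field} poly \<Rightarrow> real"
  assumes "s \<in> berk_affine" "t \<in> berk_affine" "\<And>c. s [:- c, 1:] = t [:- c, 1:]"
  shows "s = t"
proof
  fix p
  have roots: "s (root_poly M) = t (root_poly M)" for M
    by (induction M) (simp_all only: root_poly_empty root_poly_add_mset berk_affine_more[OF assms(1)]
        berk_affine_more[OF assms(2)] berk_affineD(2)[OF assms(1)] berk_affineD(2)[OF assms(2)] assms(3))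
  show "s p = t p"
  proof (cases "p = 0")
    case False
    show ?thesis
      by (subst (1 2) factor_root_poly[OF False])
        (simp only: berk_affine_more[OF assms(1)] berk_affine_more[OF assms(2)] roots)
  qed (simp only: berk_affine_more(1)[OF assms(1)] berk_affine_more(1)[OF assms(2)])
qed

lemma disk_norm_recenter:
  fixes a b :: "'a::{nonarch_field, alg_closed_field}"
  assumes "0 \<le> r" "absval (a - b) \<le> r"
  shows "disk_norm a r = disk_norm b r"
proof (rule berk_affine_eqI)
  fix c
  show "disk_norm a r [:- c, 1:] = disk_norm b r [:- c, 1:]"
    using absval_add_le_max[of "a - b" "b - c"] absval_diff_le_max[of "a - c" "a - b"] assms
    by (auto simp: disk_norm_linear)
qed (use assms disk_norm_in_berk_affine in auto)

lemma absval_poly_le_disk_norm: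
  assumes "absval (z - a) \<le> r"
  shows "absval (poly p z) \<le> disk_norm a r p"
proof -
  have r: "0 \<le> r" using assms absval_ge_zero[of "z - a"] by linarith
  let ?p = "p \<circ>\<^sub>p [:a, 1:]"
  have "poly p z = poly ?p (z - a)" by (simp add: poly_pcompose)
  also have "\<dots> = (\<Sum>i\<le>degree ?p. coeff ?p i * (z - a) ^ i)" by (rule poly_altdef)
  also have "absval \<dots> \<le> gauss_norm r ?p"
  proof (rule absval_sum_le)
    fix i
    have "absval (coeff ?p i * (z - a) ^ i) \<le> absval (coeff ?p i) * r ^ i"
      using assms by (simp add: absval_mult absval_power power_mono mult_left_mono)
    then show "absval (coeff ?p i * (z - a) ^ i) \<le> gauss_norm r ?p"
      using gauss_norm_ge[OF r, of ?p i] by linarith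
  qed (use r gauss_norm_nonneg in auto)
  finally show ?thesis by (simp add: disk_norm_def)
qed

text \<open>
  The product of \<open>z - \<alpha>\<close> over the given \<open>\<alpha>\<close> takes the value \<open>-1\<close> at some \<open>z\<close>, because the field
  is algebraically closed. Such a \<open>z\<close> is integral, so all factors have absolute value at most 1; as
  their product has absolute value 1, so has each factor.
\<close>

lemma avoid_residue_classes:
  fixes S :: "'a::{nonarch_field, alg_closed_field} multiset"
  assumes "\<And>\<alpha>. \<alpha> \<in># S \<Longrightarrow> absval \<alpha> \<le> 1"
  shows "\<exists>z. absval z \<le> 1 \<and> (\<forall>\<alpha>\<in>#S. absval (z - \<alpha>) = 1)"
proof (cases "S = {#}")
  case True
  then show ?thesis by (intro exI[of _ 0]) simp
next
  case False
  have eval_abs: "absval (poly (root_poly M) z) = (\<Prod>\<alpha>\<in>#M. absval (z - \<alpha>))" for M and z :: 'a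
  proof (induction M)
    case (add x M)
    have "poly (root_poly (add_mset x M)) z = (z - x) * poly (root_poly M) z"
      by (simp only: root_poly_add_mset poly_mult) simp
    then show ?case by (simp only: absval_mult image_mset_add_mset prod_mset.add_mset add)
  qed simp
  have sz: "0 < size S" using False by (rule nonempty_has_size[THEN iffD1])
  have "degree (root_poly S + 1) = size S"
    using sz by (subst degree_add_eq_left) (simp_all add: degree_root_poly)
  then obtain z where "poly (root_poly S + 1) z = 0"
    using alg_closed_imp_poly_has_root[of "root_poly S + 1"] sz by auto
  then have "poly (root_poly S) z = - 1" by (simp add: eq_neg_iff_add_eq_0)
  then have prod1: "(\<Prod>\<alpha>\<in>#S. absval (z - \<alpha>)) = 1" using eval_abs[of S z] by simp
  have z: "absval z \<le> 1"
  proof (rule ccontr)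
    assume "\<not> absval z \<le> 1"
    then have "absval (z - \<alpha>) > 1" if "\<alpha> \<in># S" for \<alpha>
      using absval_add_le_max[of "z - \<alpha>" \<alpha>] assms[OF that] by auto
    then have "M \<subseteq># S \<Longrightarrow> M \<noteq> {#} \<Longrightarrow> (\<Prod>\<alpha>\<in>#M. absval (z - \<alpha>)) > 1" for M
    proof (induction M)
      case (add x M)
      then have "x \<in># S" "M \<subseteq># S"
        using mset_subset_eq_insertD[of x M S] by (simp_all add: subset_mset.less_imp_le)
      then have "1 < absval (z - x)" "M \<noteq> {#} \<Longrightarrow> 1 < (\<Prod>\<alpha>\<in>#M. absval (z - \<alpha>))"
        using add by blast+
      then show ?case by (cases "M = {#}") (simp_all add: less_1_mult)
    qed simp
    from this[of S] show False using prod1 False by simp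
  qed
  have le: "absval (z - \<alpha>) \<le> 1" if "\<alpha> \<in># S" for \<alpha>
    using absval_diff_le_max[of z \<alpha>] z assms[OF that] by simp
  have "absval (z - \<alpha>) = 1" if \<alpha>: "\<alpha> \<in># S" for \<alpha>
  proof -
    obtain T where T: "S = add_mset \<alpha> T" using multi_member_split[OF \<alpha>] by blast
    have "(\<Prod>\<beta>\<in>#M. absval (z - \<beta>)) \<le> 1 \<and> 0 \<le> (\<Prod>\<beta>\<in>#M. absval (z - \<beta>))" if "M \<subseteq># S" for M
      using that
    proof (induction M)
      case (add x M)
      then have "x \<in># S" "M \<subseteq># S"
        using mset_subset_eq_insertD[of x M S] by (simp_all add: subset_mset.less_imp_le)
      then have "absval (z - x) \<le> 1" using le by blast
      then show ?case using add.IH[OF \<open>M \<subseteq># S\<close>] by (simp add: mult_le_one)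
    qed simp
    from this[of T] have "absval (z - \<alpha>) * (\<Prod>\<beta>\<in>#T. absval (z - \<beta>)) \<le> absval (z - \<alpha>)"
      using T by (intro mult_left_le) auto
    then show ?thesis using prod1 le[OF \<alpha>] T by simp
  qed
  then show ?thesis using z by blast
qed

text \<open>
  The maximum over the disk is attained at any point that avoids the residue classes of the roots
  in the disk.
\<close>

lemma disk_norm_attained:
  fixes a b :: "'a::{nonarch_field, alg_closed_field}" and p :: "'a poly"
  assumes "b \<noteq> 0"
  shows "\<exists>z. absval (z - a) \<le> absval b \<and> absval (poly p z) = disk_norm a (absval b) p"
proof (cases "p = 0")
  case True
  then show ?thesis by (intro exI[of _ a]) simp
next
  case False
  have bpos: "0 < absval b" using assms by (rule absval_pos)
  define S where "S = image_mset (\<lambda>\<alpha>. (\<alpha> - a) / b) (filter_mset (\<lambda>\<alpha>. absval (\<alpha> - a) \<le> absval b) (proots p))"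
  have "absval \<alpha> \<le> 1" if "\<alpha> \<in># S" for \<alpha>
    using that bpos by (auto simp: S_def absval_divide)
  then obtain Z where Z: "absval Z \<le> 1" "\<And>\<alpha>. \<alpha> \<in># S \<Longrightarrow> absval (Z - \<alpha>) = 1"
    using avoid_residue_classes[of S] by blast
  define z where "z = a + b * Z"
  have za: "absval (z - a) \<le> absval b"
    using Z(1) bpos by (simp add: z_def absval_mult)
  have root: "absval (z - \<alpha>) = max (absval (a - \<alpha>)) (absval b)" if "\<alpha> \<in># proots p" for \<alpha>
  proof (cases "absval (\<alpha> - a) \<le> absval b")
    case True
    then have "absval (Z - (\<alpha> - a) / b) = 1" using that by (intro Z(2)) (auto simp: S_def)
    moreover have "z - \<alpha> = b * (Z - (\<alpha> - a) / b)" using assms by (simp add: z_def field_simps)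
    ultimately have "absval (z - \<alpha>) = absval b" by (simp add: absval_mult)
    then show ?thesis using True absval_diff_commute[of \<alpha> a] by simp
  next
    case far: False
    then have "absval ((a - \<alpha>) + (z - a)) = absval (a - \<alpha>)"
      using za absval_diff_commute[of \<alpha> a] by (intro absval_add_eq) simp
    then show ?thesis using far absval_diff_commute[of \<alpha> a] by simp
  qed
  have "absval (poly (root_poly M) z) = disk_norm a (absval b) (root_poly M)" if "M \<subseteq># proots p" for M
    using that
  proof (induction M)
    case (add x M)
    then have x: "x \<in># proots p" "M \<subseteq># proots p"
      using mset_subset_eq_insertD[of x M "proots p"] by (auto simp: subset_mset.less_imp_le)
    have "poly (root_poly (add_mset x M)) z = (z - x) * poly (root_poly M) z"
      by (simp only: root_poly_add_mset poly_mult) simp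
    then show ?case
      using add.IH[OF x(2)] root[OF x(1)]
      by (simp only: root_poly_add_mset absval_mult disk_norm_mult[OF absval_ge_zero] disk_norm_linear)
  qed simp
  then have "absval (poly p z) = disk_norm a (absval b) p"
    by (subst (1 2) factor_root_poly[OF False]) (simp add: absval_mult disk_norm_smult)
  then show ?thesis using za by blast
qed

lemma disk_point_eq:
  fixes a b :: "'a::{nonarch_field, alg_closed_field}"
  assumes "b \<noteq> 0"
  shows "disk_point a (absval b) = Some (disk_norm a (absval b))"
proof -
  have "(SUP z\<in>cball a (absval b). absval (poly p z)) = disk_norm a (absval b) p" for p
  proof (rule cSup_eq_maximum)
    show "disk_norm a (absval b) p \<in> (\<lambda>z. absval (poly p z)) ` cball a (absval b)"
    proof -
      obtain z where z: "absval (z - a) \<le> absval b" "absval (poly p z) = disk_norm a (absval b) p"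
        using disk_norm_attained[OF assms] by blast
      then have "z \<in> cball a (absval b)" by (simp add: dist_absval absval_diff_commute[of a])
      then show ?thesis using z(2) by (metis imageI)
    qed
  next
    fix y assume "y \<in> (\<lambda>z. absval (poly p z)) ` cball a (absval b)"
    then obtain z where "dist a z \<le> absval b" "y = absval (poly p z)" by auto
    then show "y \<le> disk_norm a (absval b) p"
      by (simp add: dist_absval absval_diff_commute[of a] absval_poly_le_disk_norm)
  qed
  then show ?thesis by (simp add: disk_point_def)
qed

section \<open>The topology of the Berkovich line\<close>

lemma continuous_on_Max_image:
  fixes g :: "'i \<Rightarrow> 'b::topological_space \<Rightarrow> real"
  assumes "finite A" "A \<noteq> {}" "\<And>i. i \<in> A \<Longrightarrow> continuous_on S (g i)"
  shows "continuous_on S (\<lambda>x. MAX i\<in>A. g i x)"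
  using assms
proof (induction A rule: finite_ne_induct)
  case (insert i A)
  then have "continuous_on S (\<lambda>x. max (g i x) (MAX i\<in>A. g i x))"
    by (intro continuous_on_max) auto
  then show ?case using insert by simp
qed simp

lemma continuous_map_disk_norm:
  "continuous_map (top_of_set {0..}) berk_P1 (\<lambda>r. Some (disk_norm a r))"
proof -
  have "continuous_on {0..} (disk_norm a)"
    unfolding disk_norm_def gauss_norm_def
  proof (intro continuous_on_coordinatewise_then_product continuous_on_Max_image)
    fix p :: "'a poly" and i
    show "continuous_on {0..} (\<lambda>r. absval (coeff (p \<circ>\<^sub>p [:a, 1:]) i) * r ^ i)"
      by (rule continuous_on_mult_left[OF continuous_on_power[OF continuous_on_id]])
  qed auto
  then have "continuous_map (top_of_set {0..}) (top_of_set berk_affine) (disk_norm a)"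
    by (auto simp: disk_norm_in_berk_affine)
  then show ?thesis
    using continuous_map_compose[OF _ continuous_map_Some] unfolding berk_P1_def comp_def by blast
qed

lemma connectedin_disk_path:
  assumes "connected T" "T \<subseteq> {0..}"
  shows "connectedin berk_P1 ((\<lambda>r. Some (disk_norm a r)) ` T)"
  using assms by (intro connectedin_continuous_map_image[OF continuous_map_disk_norm])
    (simp add: connectedin_subtopology)

lemma closed_berk_affine: "closed (berk_affine :: ('a::nonarch_field poly \<Rightarrow> real) set)"
proof -
  have "berk_affine = (\<Inter>p. {s :: 'a poly \<Rightarrow> real. 0 \<le> s p}) \<inter> (\<Inter>p q. {s. s (p * q) = s p * s q})
      \<inter> (\<Inter>p q. {s. s (p + q) \<le> max (s p) (s q)}) \<inter> (\<Inter>c. {s. s [:c:] = absval c})"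
    by (auto simp: berk_affine_def)
  also have "closed \<dots>"
  proof (intro closed_Int closed_INT ballI)
    note c = continuous_on_product_coordinates
    fix p q :: "'a poly" and k :: 'a
    show "closed {s :: 'a poly \<Rightarrow> real. 0 \<le> s p}"
      by (rule closed_Collect_le[OF continuous_on_const c])
    show "closed {s :: 'a poly \<Rightarrow> real. s (p * q) = s p * s q}"
      by (rule closed_Collect_eq[OF c continuous_on_mult[OF c c]])
    show "closed {s :: 'a poly \<Rightarrow> real. s (p + q) \<le> max (s p) (s q)}"
      by (rule closed_Collect_le[OF c continuous_on_max[OF c c]])
    show "closed {s :: 'a poly \<Rightarrow> real. s [:k:] = absval k}"
      by (rule closed_Collect_eq[OF c continuous_on_const])
  qed
  finally show ?thesis .
qed

text \<open>
  On a ball each polynomial is bounded in terms of \<open>R\<close> and its coefficients, so the ball is a closed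
  subset of a product of compact intervals, and Tychonoff's theorem applies. Hence complements of
  closed balls are neighbourhoods of infinity.
\<close>

lemma compact_berk_closed_ball:
  "compact {s \<in> berk_affine. s [:- a, 1:] \<le> (R::real)}" (is "compact ?C")
proof -
  have bound: "\<exists>B. \<forall>s\<in>?C. s p \<le> B" for p
  proof (induction p)
    case 0
    have "s 0 \<le> 0" if "s \<in> ?C" for s
      using that berk_affine_more(1)[of s] by simp
    then show ?case by blast
  next
    case (pCons c p)
    then obtain B where B: "\<And>s. s \<in> ?C \<Longrightarrow> s p \<le> B" by blast
    have "s (pCons c p) \<le> max (absval c) (max R (absval a) * max B 0)" if "s \<in> ?C" for s
    proof -
      have s: "s \<in> berk_affine" "s [:- a, 1:] \<le> R" using that by auto
      have "s [:0, 1:] \<le> max (s [:- a, 1:]) (s [:a:])"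
        using berk_affineD(3)[OF s(1), of "[:- a, 1:]" "[:a:]"] by simp
      then have "s [:0, 1:] \<le> max R (absval a)" using s(2) unfolding berk_affineD(4)[OF s(1)] by linarith
      then have "s [:0, 1:] * s p \<le> max R (absval a) * max B 0"
        using B[OF that] berk_affineD(1)[OF s(1), of p] berk_affineD(1)[OF s(1), of "[:0, 1:]"]
        by (intro mult_mono) linarith+
      moreover have "s (pCons c p) \<le> max (absval c) (s [:0, 1:] * s p)"
        using berk_affineD(3)[OF s(1), of "[:c:]" "[:0, 1:] * p"]
        unfolding berk_affineD(2)[OF s(1), of "[:0, 1:]" p] berk_affineD(4)[OF s(1)] by simp
      ultimately show ?thesis by linarith
    qed
    then show ?case by blast
  qed
  have "\<exists>B. \<forall>p. \<forall>s\<in>?C. s p \<le> B p"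
    by (rule choice, rule allI, rule bound)
  then obtain B where B: "\<And>s p. s \<in> ?C \<Longrightarrow> s p \<le> B p" by blast
  have "compactin (product_topology (\<lambda>_. euclidean) UNIV) (PiE UNIV (\<lambda>p. {0..B p}))"
    by (subst compactin_PiE) auto
  then have "compact (PiE UNIV (\<lambda>p. {0..B p}))"
    by (simp add: euclidean_product_topology)
  moreover have "?C = PiE UNIV (\<lambda>p. {0..B p}) \<inter> (berk_affine \<inter> {s. s [:- a, 1:] \<le> R})"
  proof (intro equalityI subsetI)
    fix s assume s: "s \<in> ?C"
    then have "s p \<in> {0..B p}" for p using B[OF s, of p] berk_affineD(1)[of s p] by simp
    then show "s \<in> PiE UNIV (\<lambda>p. {0..B p}) \<inter> (berk_affine \<inter> {s. s [:- a, 1:] \<le> R})"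
      using s by (simp add: PiE_UNIV_domain)
  qed simp
  moreover have "closed (berk_affine \<inter> {s. s [:- a, 1:] \<le> R})"
    by (intro closed_Int closed_berk_affine closed_Collect_le[OF continuous_on_product_coordinates continuous_on_const])
  ultimately show ?thesis by (simp only: compact_Int_closed)
qed

definition berk_ball :: "'a::nonarch_field \<Rightarrow> real \<Rightarrow> 'a berk_point set" where
  "berk_ball a r = Some ` {s \<in> berk_affine. s [:- a, 1:] < r}"

lemma openin_berk_ball: "openin berk_P1 (berk_ball a r)"
proof -
  have "open {s :: 'a poly \<Rightarrow> real. s [:- a, 1:] < r}"
    by (rule open_Collect_less[OF continuous_on_product_coordinates continuous_on_const])
  then have "openin (top_of_set berk_affine) (berk_affine \<inter> {s. s [:- a, 1:] < r})" by blast
  moreover have "berk_affine \<inter> {s. s [:- a, 1:] < r} = {s \<in> berk_affine. s [:- a, 1:] < r}" by auto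
  ultimately show ?thesis by (simp add: berk_ball_def berk_P1_def)
qed

lemma openin_complement_closed_ball:
  "openin berk_P1 (insert None (Some ` {s \<in> berk_affine. R < s [:- a, 1:]}))"
proof -
  let ?C = "{s \<in> berk_affine. s [:- a, 1:] \<le> R}"
  have "compactin (top_of_set berk_affine) ?C"
    unfolding compactin_subtopology using compact_berk_closed_ball[of a R] by auto
  moreover have "closedin (top_of_set berk_affine) ?C"
  proof (rule closed_subset)
    have "closed (berk_affine \<inter> {s. s [:- a, 1:] \<le> R})"
      by (intro closed_Int closed_berk_affine closed_Collect_le[OF continuous_on_product_coordinates continuous_on_const])
    then show "closed ?C" by (simp add: Int_def)
  qed auto
  moreover have "berk_affine - ?C = {s \<in> berk_affine. R < s [:- a, 1:]}" by auto
  ultimately show ?thesis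
    unfolding berk_P1_def openin_Alexandroff_compactification by (intro disjI2 exI[of _ ?C]) auto
qed

section \<open>Tangent directions at a disk point\<close>

lemma berk_affine_recenter:
  assumes s: "s \<in> berk_affine"
  shows "s [:- c, 1:] \<le> max (s [:- d, 1:]) (absval (c - d))"
    and "absval (c - d) \<le> max (s [:- c, 1:]) (s [:- d, 1:])"
proof -
  have "[:- c, 1:] = [:- d, 1:] + [:d - c:]" by simp
  then show "s [:- c, 1:] \<le> max (s [:- d, 1:]) (absval (c - d))"
    using berk_affineD(3)[OF s, of "[:- d, 1:]" "[:d - c:]"] berk_affineD(4)[OF s, of "d - c"]
      absval_diff_commute[of d c] by simp
  have "[:- d, 1:] - [:- c, 1:] = [:c - d:]" by simp
  then show "absval (c - d) \<le> max (s [:- c, 1:]) (s [:- d, 1:])"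
    using berk_affine_more(4)[OF s, of "[:- d, 1:]" "[:- c, 1:]"] berk_affineD(4)[OF s, of "c - d"]
    by simp
qed

lemma berk_ball_iff: "Some s \<in> berk_ball a r \<longleftrightarrow> s \<in> berk_affine \<and> s [:- a, 1:] < r"
  by (auto simp: berk_ball_def)

lemma None_notin_berk_ball [simp]: "None \<notin> berk_ball a r"
  by (auto simp: berk_ball_def)

lemma classical_in_berk_ball_iff: "classical_point (Some y) \<in> berk_ball a r \<longleftrightarrow> absval (y - a) < r"
  using absval_ge_zero[of "y - a"]
  by (simp add: classical_point_Some berk_ball_iff disk_norm_in_berk_affine disk_norm_linear del: classical_point.simps)

text \<open>
  The closure of a ball \<open>|z - e| < r\<close> adds only the point \<open>\<zeta>(e, r)\<close>. Indeed a seminorm with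
  \<open>|z - e| = r\<close> other than \<open>\<zeta>(e, r)\<close> differs from it at some linear polynomial \<open>z - c\<close>, and then lies
  in the ball of radius \<open>r\<close> around \<open>c\<close>, which is disjoint from the one around \<open>e\<close>.
\<close>

lemma openin_outside_ball:
  fixes e :: "'a::{nonarch_field, alg_closed_field}"
  assumes r: "0 < r"
  shows "openin berk_P1 (topspace berk_P1 - insert (Some (disk_norm e r)) (berk_ball e r))"
proof -
  let ?U = "insert None (Some ` {s \<in> berk_affine. r < s [:- e, 1:]}) \<union> (\<Union>e'\<in>{e'. absval (e' - e) = r}. berk_ball e' r)"
  have "topspace berk_P1 - insert (Some (disk_norm e r)) (berk_ball e r) = ?U"
  proof (intro equalityI subsetI)
    fix y assume y: "y \<in> topspace berk_P1 - insert (Some (disk_norm e r)) (berk_ball e r)"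
    show "y \<in> ?U"
    proof (cases y)
      case (Some s)
      then have s: "s \<in> berk_affine" "s \<noteq> disk_norm e r" "r \<le> s [:- e, 1:]"
        using y by (auto simp: topspace_berk_P1 berk_ball_iff)
      show ?thesis
      proof (cases "s [:- e, 1:] = r")
        case True
        obtain c where c: "s [:- c, 1:] \<noteq> disk_norm e r [:- c, 1:]"
          using berk_affine_eqI[OF s(1) disk_norm_in_berk_affine[OF less_imp_le[OF r]]] s(2) by blast
        then have c': "s [:- c, 1:] \<noteq> max (absval (e - c)) r" unfolding disk_norm_linear .
        have "s [:- c, 1:] < r" "absval (c - e) = r"
          using c' True berk_affine_recenter[OF s(1), of c e] berk_affine_recenter(1)[OF s(1), of e c]
            absval_diff_commute[of c e] by linarith+
        then show ?thesis using s(1) Some by (auto simp: berk_ball_iff)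
      next
        case False
        then show ?thesis using s Some by auto
      qed
    qed simp
  next
    fix y assume "y \<in> ?U"
    then consider "y = None" | s where "y = Some s" "s \<in> berk_affine" "r < s [:- e, 1:]"
      | e' s where "y = Some s" "s \<in> berk_affine" "s [:- e', 1:] < r" "absval (e' - e) = r"
      by (auto simp: berk_ball_def)
    then show "y \<in> topspace berk_P1 - insert (Some (disk_norm e r)) (berk_ball e r)"
    proof cases
      case 1
      then show ?thesis by (simp add: topspace_berk_P1)
    next
      case 2
      moreover have "disk_norm e r [:- e, 1:] = r" using r by (simp add: disk_norm_linear)
      ultimately show ?thesis by (auto simp: topspace_berk_P1 berk_ball_iff)
    next
      case 3
      have "disk_norm e r [:- e', 1:] \<ge> r" by (simp add: disk_norm_linear)
      then have "s \<noteq> disk_norm e r" using 3 by auto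
      moreover have "r \<le> s [:- e, 1:]"
        using berk_affine_recenter(2)[OF 3(2), of e' e] 3 by linarith
      ultimately show ?thesis using 3 by (auto simp: topspace_berk_P1 berk_ball_iff)
    qed
  qed
  moreover have "openin berk_P1 ?U"
    by (intro openin_Un openin_complement_closed_ball openin_Union) (auto simp: openin_berk_ball)
  ultimately show ?thesis by simp
qed

text \<open>
  The ball is open and closed in the complement of its boundary point.
\<close>

lemma connectedin_avoiding_disk_point:
  fixes e :: "'a::{nonarch_field, alg_closed_field}"
  assumes "0 < r" "connectedin berk_P1 C" "Some (disk_norm e r) \<notin> C" "C \<inter> berk_ball e r \<noteq> {}"
  shows "C \<subseteq> berk_ball e r"
proof (rule ccontr)
  assume "\<not> C \<subseteq> berk_ball e r"
  moreover have "C \<subseteq> topspace berk_P1" by (rule connectedin_subset_topspace[OF assms(2)])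
  ultimately have "C \<inter> (topspace berk_P1 - insert (Some (disk_norm e r)) (berk_ball e r)) \<noteq> {}"
      "C \<subseteq> berk_ball e r \<union> (topspace berk_P1 - insert (Some (disk_norm e r)) (berk_ball e r))"
    using assms(3) by auto
  then show False
    using connectedinD[OF assms(2) openin_berk_ball[of e r] openin_outside_ball[OF assms(1), of e]] assms(4)
    by blast
qed

lemma connectedin_direction_towards:
  "connectedin berk_P1 (direction_towards x y)" "x \<notin> direction_towards x y"
proof -
  have "connectedin (subtopology berk_P1 (topspace berk_P1 - {x})) (direction_towards x y)"
    unfolding direction_towards_def by (rule connectedin_connected_component_of)
  then show "connectedin berk_P1 (direction_towards x y)" "x \<notin> direction_towards x y"
    unfolding connectedin_subtopology by auto
qed

lemma in_direction_towards:
  assumes "connectedin berk_P1 C" "x \<notin> C" "y \<in> C" "z \<in> C"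
  shows "z \<in> direction_towards x y"
proof -
  have "connectedin (subtopology berk_P1 (topspace berk_P1 - {x})) C"
    using assms(1,2) connectedin_subset_topspace[OF assms(1)] by (auto simp: connectedin_subtopology)
  then show ?thesis
    using connected_component_of_maximal[OF _ assms(3)] assms(4) unfolding direction_towards_def by blast
qed

lemma direction_towards_self: "y \<in> topspace berk_P1 \<Longrightarrow> x \<noteq> y \<Longrightarrow> y \<in> direction_towards x y"
  by (rule in_direction_towards[of "{y}"]) auto

lemma direction_towards_in_directions:
  "y \<in> topspace berk_P1 \<Longrightarrow> x \<noteq> y \<Longrightarrow> direction_towards x y \<in> directions x"
  unfolding direction_towards_def directions_def
  by (auto simp: connected_component_in_connected_components_of)

lemma directions_eq:
  assumes "v \<in> directions x" "w \<in> directions x" "y \<in> v" "y \<in> w"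
  shows "v = w"
  using pairwise_disjoint_connected_components_of assms
  unfolding directions_def by (metis pairwiseD disjnt_iff)

context
  fixes a :: "'a::{nonarch_field, alg_closed_field}" and r :: real
  assumes r: "0 < r"
begin

lemma classical_ne_disk: "classical_point c \<noteq> Some (disk_norm a r)"
proof (cases c)
  case (Some y)
  have "disk_norm y 0 [:- y, 1:] \<noteq> disk_norm a r [:- y, 1:]" using r by (simp add: disk_norm_linear)
  then show ?thesis unfolding Some classical_point_Some by auto
qed simp

lemma direction_towards_classical_subset:
  assumes "absval (e - a) \<le> r"
  shows "direction_towards (Some (disk_norm a r)) (classical_point (Some e)) \<subseteq> berk_ball e r"
proof (rule connectedin_avoiding_disk_point[OF r connectedin_direction_towards(1)])
  have eq: "disk_norm e r = disk_norm a r"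
    using assms r by (intro disk_norm_recenter) auto
  show "Some (disk_norm e r) \<notin> direction_towards (Some (disk_norm a r)) (classical_point (Some e))"
    unfolding eq by (rule connectedin_direction_towards(2))
  have "classical_point (Some e) \<in> direction_towards (Some (disk_norm a r)) (classical_point (Some e))"
    by (intro direction_towards_self classical_point_in_topspace) (metis classical_ne_disk)
  moreover have "classical_point (Some e) \<in> berk_ball e r"
    unfolding classical_in_berk_ball_iff using r by simp
  ultimately show "direction_towards (Some (disk_norm a r)) (classical_point (Some e)) \<inter> berk_ball e r \<noteq> {}"
    by blast
qed

lemma None_in_direction_towards_None: "None \<in> direction_towards (Some (disk_norm a r)) None"
  by (rule direction_towards_self) (auto simp: topspace_berk_P1)

lemma direction_towards_None_disjoint:
  assumes "absval (e - a) \<le> r"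
  shows "direction_towards (Some (disk_norm a r)) None \<inter> berk_ball e r = {}"
proof (rule ccontr)
  assume "direction_towards (Some (disk_norm a r)) None \<inter> berk_ball e r \<noteq> {}"
  moreover have eq: "disk_norm e r = disk_norm a r"
    using assms r by (intro disk_norm_recenter) auto
  ultimately have "direction_towards (Some (disk_norm a r)) None \<subseteq> berk_ball e r"
    using connectedin_direction_towards
    by (intro connectedin_avoiding_disk_point[OF r]) (auto simp: eq)
  then show False using None_in_direction_towards_None by auto
qed

lemma disk_path_in_direction:
  assumes "absval (e - a) \<le> r" "0 \<le> t" "t < r"
  shows "Some (disk_norm e t) \<in> direction_towards (Some (disk_norm a r)) (classical_point (Some e))"
proof (rule in_direction_towards[OF connectedin_disk_path[of "{0..t}" e]])
  show "Some (disk_norm a r) \<notin> (\<lambda>r. Some (disk_norm e r)) ` {0..t}"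
  proof
    assume "Some (disk_norm a r) \<in> (\<lambda>r. Some (disk_norm e r)) ` {0..t}"
    then obtain u where u: "0 \<le> u" "u \<le> t" "disk_norm a r = disk_norm e u" by auto
    have "max (absval (a - e)) r = max 0 u"
      using fun_cong[OF u(3), of "[:- e, 1:]"] unfolding disk_norm_linear by simp
    then show False using u assms(3) by linarith
  qed
qed (use assms classical_point_Some[of e] in auto)

text \<open>
  The path of disk points around \<open>y\<close> and the one around \<open>e\<close> meet at the radius \<open>|y - e|\<close>, before
  they reach \<open>\<zeta>(a, r)\<close>.
\<close>

lemma classical_near_in_direction:
  assumes "absval (e - a) \<le> r" "absval (y - e) < r"
  shows "classical_point (Some y) \<in> direction_towards (Some (disk_norm a r)) (classical_point (Some e))"
proof -
  let ?x = "Some (disk_norm a r)" and ?t = "absval (y - e)"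
  have ya: "absval (y - a) \<le> r"
    using absval_add_le_max[of "y - e" "e - a"] assms by simp
  have same: "disk_norm y ?t = disk_norm e ?t"
    by (rule disk_norm_recenter) auto
  have 1: "Some (disk_norm e ?t) \<in> direction_towards ?x (classical_point (Some e))"
    by (rule disk_path_in_direction) (use assms in auto)
  have 2: "Some (disk_norm e ?t) \<in> direction_towards ?x (classical_point (Some y))"
    unfolding same[symmetric] by (rule disk_path_in_direction) (use ya assms in auto)
  have "direction_towards ?x (classical_point (Some y)) = direction_towards ?x (classical_point (Some e))"
    using 1 2 by (intro directions_eq[of _ ?x] direction_towards_in_directions classical_point_in_topspace)
      (metis classical_ne_disk)+
  moreover have "classical_point (Some y) \<in> direction_towards ?x (classical_point (Some y))"
    by (intro direction_towards_self classical_point_in_topspace) (metis classical_ne_disk)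
  ultimately show ?thesis by simp
qed

text \<open>
  The path \<open>\<zeta>(y, t)\<close> with \<open>t\<close> tending to infinity avoids \<open>\<zeta>(a, r)\<close>, and infinity is in its closure
  because \<open>|z - y|\<close> is bounded on compact sets.
\<close>

lemma classical_far_in_direction:
  assumes "r < absval (y - a)"
  shows "classical_point (Some y) \<in> direction_towards (Some (disk_norm a r)) None"
proof -
  let ?x = "Some (disk_norm a r)"
  let ?S = "(\<lambda>t. Some (disk_norm y t)) ` {0..}"
  have conn: "connectedin berk_P1 ?S" by (rule connectedin_disk_path) auto
  have xS: "?x \<notin> ?S"
  proof
    assume "?x \<in> ?S"
    then obtain u where u: "0 \<le> u" "disk_norm a r = disk_norm y u" by auto
    have "max (absval (a - y)) r = max 0 u" "max 0 r = max (absval (y - a)) u"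
      using fun_cong[OF u(2), of "[:- y, 1:]"] fun_cong[OF u(2), of "[:- a, 1:]"]
      unfolding disk_norm_linear by simp_all
    then show False using assms r by linarith
  qed
  have "None \<in> berk_P1 closure_of ?S"
    unfolding in_closure_of
  proof (intro conjI allI impI)
    show "None \<in> topspace berk_P1" by (simp add: topspace_berk_P1)
    fix T :: "'a berk_point set" assume T: "None \<in> T \<and> openin berk_P1 T"
    then obtain C where C: "compactin (top_of_set berk_affine) C" "T = insert None (Some ` (berk_affine - C))"
      unfolding berk_P1_def openin_Alexandroff_compactification by auto
    have "compact ((\<lambda>s. s [:- y, 1:]) ` C)"
      using C(1) continuous_on_subset[OF continuous_on_product_coordinates subset_UNIV]
      by (intro compact_continuous_image) (auto simp: compactin_subtopology)
    then obtain B where B: "\<And>s. s \<in> C \<Longrightarrow> s [:- y, 1:] \<le> B"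
      by (meson bounded_has_Sup(1) bounded_real compact_imp_bounded imageI abs_le_D1)
    (* At the radius ?t the path has left C, because |z - y| equals ?t there. *)
    let ?t = "max B 0 + 1"
    have "disk_norm y ?t [:- y, 1:] = ?t" by (simp add: disk_norm_linear)
    then have "disk_norm y ?t \<notin> C" using B[of "disk_norm y ?t"] by linarith
    then have "Some (disk_norm y ?t) \<in> T" unfolding C(2) by (simp add: disk_norm_in_berk_affine)
    then show "\<exists>z. z \<in> ?S \<and> z \<in> T" by (intro exI[of _ "Some (disk_norm y ?t)"]) auto
  qed
  then have "connectedin berk_P1 (insert None ?S)"
    using connectedin_subset_topspace[OF conn] closure_of_subset[of ?S berk_P1]
    by (intro connectedin_intermediate_closure_of[OF conn]) auto
  then show ?thesis
    by (rule in_direction_towards) (use xS classical_point_Some[of y] in auto)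
qed

text \<open>
  The point is in the closure of each of its bounded directions. This makes the direction chosen by
  the tangent map unique.
\<close>

lemma disk_point_approached:
  assumes "absval (e - a) \<le> r" "openin berk_P1 V" "Some (disk_norm a r) \<in> V"
  shows "\<exists>z. z \<in> V \<inter> direction_towards (Some (disk_norm a r)) (classical_point (Some e))"
proof -
  have eq: "disk_norm e r = disk_norm a r"
    using assms r by (intro disk_norm_recenter) auto
  have "openin (top_of_set {0..}) {t \<in> {0..}. Some (disk_norm e t) \<in> V}"
    using openin_continuous_map_preimage[OF continuous_map_disk_norm[of e] assms(2)] by simp
  moreover have "r \<in> {t \<in> {0..}. Some (disk_norm e t) \<in> V}" using eq assms(3) r by simp
  ultimately obtain d where d: "d > 0" "ball r d \<inter> {0..} \<subseteq> {t \<in> {0..}. Some (disk_norm e t) \<in> V}"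
    by (meson openin_contains_ball)
  (* Any radius in the interval from r - d to r; the maximum keeps it nonnegative. *)
  define t where "t = max 0 (r - d / 2)"
  have t: "0 \<le> t" "t < r" "t \<in> ball r d" using d(1) r by (auto simp: t_def dist_real_def max_def)
  then have "Some (disk_norm e t) \<in> V" using d(2) by auto
  then show ?thesis using disk_path_in_direction[OF assms(1) t(1,2)] by blast
qed

end

section \<open>Action of a rational function\<close>

lemma coprime_comaximal:
  fixes p q :: "'a::alg_closed_field poly"
  assumes "coprime p q" "q \<noteq> 0"
  shows "\<exists>u w. u * p + w * q = 1"
proof -
  let ?c = "lead_coeff q"
  have "poly p \<alpha> \<noteq> 0" if "\<alpha> \<in># proots q" for \<alpha>
  proof
    assume "poly p \<alpha> = 0"
    moreover have "poly q \<alpha> = 0" using that assms(2) by simp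
    ultimately have "[:- \<alpha>, 1:] dvd p" "[:- \<alpha>, 1:] dvd q" by (simp_all add: poly_eq_0_iff_dvd)
    then have "is_unit [:- \<alpha>, 1:]" by (rule coprime_common_divisor[OF assms(1)])
    then show False by (simp add: is_unit_iff_degree)
  qed
  then obtain u w where uw: "u * p + w * root_poly (proots q) = 1"
    using root_poly_comaximal[of "proots q" p] by blast
  have "smult (inverse ?c) w * q = smult (inverse ?c) w * smult ?c (root_poly (proots q))"
    using factor_root_poly[OF assms(2)] by (rule arg_cong)
  also have "\<dots> = w * root_poly (proots q)" using assms(2) by simp
  finally have "u * p + smult (inverse ?c) w * q = 1" using uw by simp
  then show ?thesis by blast
qed

lemma lowest_terms_Fract:
  fixes A B :: "'a::alg_closed_field poly"
  assumes "B \<noteq> 0"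
  shows "numer (Fract A B) * B = A * denom (Fract A B)" "denom (Fract A B) dvd B"
proof -
  let ?h = "Fract A B"
  have "Fract (numer ?h) (denom ?h) = Fract A B" by (rule lowest_terms(3)[symmetric])
  then show eq: "numer ?h * B = A * denom ?h"
    using assms lowest_terms(1)[of ?h] by (simp only: eq_fract(1) not_False_eq_True)
  obtain u w where uw: "u * numer ?h + w * denom ?h = 1"
    using coprime_comaximal[OF lowest_terms(2,1)] by blast
  have "B = u * (numer ?h * B) + w * denom ?h * B" using uw by (metis distrib_right mult.assoc mult_1)
  also have "\<dots> = denom ?h * (u * A + w * B)" unfolding eq by (simp add: algebra_simps)
  finally show "denom ?h dvd B" by (metis dvd_triv_left)
qed

text \<open>
  The extension of a seminorm to fractions does not depend on the representation: the reduced
  denominator divides every other one, so it is outside the kernel as soon as one denominator is.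
\<close>

lemma seminorm_fract_Fract:
  fixes A B :: "'a::{nonarch_field, alg_closed_field} poly"
  assumes s: "s \<in> berk_affine" and B: "s B \<noteq> 0"
  shows "seminorm_fract s (Fract A B) = s A / s B" "s (denom (Fract A B)) \<noteq> 0"
proof -
  let ?h = "Fract A B"
  have B0: "B \<noteq> 0" using B berk_affine_more(1)[OF s] by auto
  obtain C where "B = denom ?h * C" using lowest_terms_Fract(2)[OF B0] by (rule dvdE)
  then have "s B = s (denom ?h) * s C" using berk_affineD(2)[OF s] by metis
  then show nz: "s (denom ?h) \<noteq> 0" using B by auto
  have "s (numer ?h * B) = s (A * denom ?h)" using lowest_terms_Fract(1)[OF B0, of A] by simp
  then have "s (numer ?h) * s B = s A * s (denom ?h)" unfolding berk_affineD(2)[OF s] .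
  then show "seminorm_fract s ?h = s A / s B"
    unfolding seminorm_fract_def using nz B by (simp add: frac_eq_eq)
qed

lemma poly_comp_fract_0 [simp]: "poly_comp_fract 0 f = 0"
  by (simp add: poly_comp_fract_def)

lemma poly_comp_fract_pCons:
  "poly_comp_fract (pCons c g) f = to_fract [:c:] + f * poly_comp_fract g f"
  by (simp add: poly_comp_fract_def map_poly_pCons)

lemma poly_comp_fract_add: "poly_comp_fract (g + h) f = poly_comp_fract g f + poly_comp_fract h f"
proof (induction g h rule: poly_induct2)
  case (pCons a p b q)
  have "to_fract [:a + b:] = to_fract [:a:] + to_fract [:b:]"
    by (metis add_pCons add_0 to_fract_add)
  then show ?case using pCons by (simp add: poly_comp_fract_pCons algebra_simps)
qed simp

lemma poly_comp_fract_mult: "poly_comp_fract (g * h) f = poly_comp_fract g f * poly_comp_fract h f"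
proof (induction g)
  case (pCons a p)
  have "poly_comp_fract (smult a h) f = to_fract [:a:] * poly_comp_fract h f"
  proof (induction h)
    case (pCons b q)
    have "to_fract [:a * b:] = to_fract [:a:] * to_fract [:b:]"
      by (simp flip: to_fract_mult)
    then show ?case using pCons by (simp add: poly_comp_fract_pCons algebra_simps)
  qed simp
  then show ?case using pCons
    by (simp add: poly_comp_fract_pCons poly_comp_fract_add algebra_simps)
qed simp

text \<open>
  Only powers of \<open>q\<close> occur as denominators, so a seminorm that is nonzero at \<open>q\<close> can be evaluated at
  every \<open>g \<circ> f\<close>.
\<close>

lemma poly_comp_fract_form:
  assumes "q \<noteq> 0"
  shows "\<exists>A n. poly_comp_fract g (Fract p q) = Fract A (q ^ n)"
proof (induction g)
  case 0
  show ?case by (intro exI[of _ 0]) (simp add: fract_collapse)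
next
  case (pCons c g)
  then obtain A n where "poly_comp_fract g (Fract p q) = Fract A (q ^ n)" by blast
  then have "poly_comp_fract (pCons c g) (Fract p q) = Fract [:c:] 1 + Fract (p * A) (q ^ Suc n)"
    by (simp add: poly_comp_fract_pCons to_fract_def)
  also have "\<dots> = Fract ([:c:] * q ^ Suc n + p * A) (q ^ Suc n)"
    using assms by (subst add_fract) simp_all
  finally show ?case by blast
qed

context
  fixes f :: "'a::{nonarch_field, alg_closed_field} poly fract"
begin

definition image_norm :: "('a poly \<Rightarrow> real) \<Rightarrow> 'a poly \<Rightarrow> real" where
  "image_norm s g = seminorm_fract s (poly_comp_fract g f)"

lemma berk_map_Some: "s (denom f) \<noteq> 0 \<Longrightarrow> berk_map f (Some s) = Some (image_norm s)"
  by (simp add: image_norm_def[abs_def])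

lemma image_norm_form:
  assumes "s \<in> berk_affine" "s (denom f) \<noteq> 0"
  obtains A B where "poly_comp_fract g f = Fract A B" "B \<noteq> 0" "s B \<noteq> 0" "image_norm s g = s A / s B"
    "s (denom (poly_comp_fract g f)) \<noteq> 0"
proof -
  obtain A n where A: "poly_comp_fract g f = Fract A ((denom f) ^ n)"
    using poly_comp_fract_form[OF lowest_terms(1), of g "numer f" f] lowest_terms(3)[of f] by auto
  have pow: "s ((denom f) ^ n) = s (denom f) ^ n"
    by (induction n) (simp_all only: power_0 power_Suc berk_affine_more(2)[OF assms(1)] berk_affineD(2)[OF assms(1)])
  then have nz: "s ((denom f) ^ n) \<noteq> 0" using assms(2) by simp
  show ?thesis
    using that[OF A _ nz] seminorm_fract_Fract[OF assms(1) nz, of A] lowest_terms(1)[of f]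
    unfolding image_norm_def A by simp
qed

lemma image_norm_in_berk_affine:
  assumes s: "s \<in> berk_affine" "s (denom f) \<noteq> 0"
  shows "image_norm s \<in> berk_affine"
  unfolding berk_affine_def
proof (intro CollectI conjI allI)
  fix g h :: "'a poly" and c
  obtain A B where 1: "poly_comp_fract g f = Fract A B" "B \<noteq> 0" "s B \<noteq> 0" "image_norm s g = s A / s B"
    by (rule image_norm_form[OF s])
  obtain C D where 2: "poly_comp_fract h f = Fract C D" "D \<noteq> 0" "s D \<noteq> 0" "image_norm s h = s C / s D"
    by (rule image_norm_form[OF s])
  have nn: "0 \<le> s x" for x by (rule berk_affineD(1)[OF s(1)])
  have BD: "s (B * D) \<noteq> 0" using 1 2 berk_affineD(2)[OF s(1)] by simp
  show "0 \<le> image_norm s g" unfolding 1(4) using nn by simp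
  show "image_norm s (g * h) = image_norm s g * image_norm s h"
  proof -
    have "image_norm s (g * h) = s (A * C) / s (B * D)"
      unfolding image_norm_def poly_comp_fract_mult 1 2 mult_fract by (rule seminorm_fract_Fract[OF s(1) BD])
    then show ?thesis unfolding 1(4) 2(4) berk_affineD(2)[OF s(1)] by simp
  qed
  show "image_norm s (g + h) \<le> max (image_norm s g) (image_norm s h)"
  proof -
    have "image_norm s (g + h) = s (A * D + C * B) / s (B * D)"
      unfolding image_norm_def poly_comp_fract_add 1 2 add_fract[OF 1(2) 2(2)]
      by (rule seminorm_fract_Fract[OF s(1) BD])
    also have "\<dots> \<le> max (s A * s D) (s C * s B) / s (B * D)"
      using berk_affineD(3)[OF s(1), of "A * D" "C * B"] nn[of "B * D"] unfolding berk_affineD(2)[OF s(1)]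
      by (intro divide_right_mono) auto
    also have "\<dots> = max (s A / s B) (s C / s D)"
    proof -
      have "0 < s B" "0 < s D" using nn[of B] nn[of D] 1 2 by auto
      then show ?thesis unfolding berk_affineD(2)[OF s(1)] by (simp add: max_def field_simps)
    qed
    finally show ?thesis unfolding 1(4) 2(4) .
  qed
  show "image_norm s [:c:] = absval c"
  proof -
    have "s 1 \<noteq> 0" using berk_affine_more(2)[OF s(1)] by simp
    moreover have "poly_comp_fract [:c:] f = Fract [:c:] 1"
      by (simp add: poly_comp_fract_pCons to_fract_def)
    ultimately show ?thesis
      unfolding image_norm_def using seminorm_fract_Fract(1)[OF s(1), of 1 "[:c:]"]
      by (simp add: berk_affineD(4)[OF s(1)] berk_affine_more(2)[OF s(1)])
  qed
qed

lemma image_norm_linear: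
  assumes s: "s \<in> berk_affine" "s (denom f) \<noteq> 0"
  shows "image_norm s [:- c, 1:] = s ((numer f) - smult c (denom f)) / s (denom f)"
proof -
  have "to_fract [:1 :: 'a:] = 1" by (metis one_pCons to_fract_1)
  then have "poly_comp_fract [:- c, 1:] f = Fract [:- c:] 1 + f"
    by (simp add: poly_comp_fract_pCons) (simp add: to_fract_def)
  also have "\<dots> = Fract [:- c:] 1 + Fract (numer f) (denom f)"
    by (rule arg_cong[OF lowest_terms(3)])
  also have "\<dots> = Fract ((numer f) - smult c (denom f)) (denom f)"
    using lowest_terms(1)[of f] by (subst add_fract) (simp_all add: algebra_simps)
  finally show ?thesis
    unfolding image_norm_def using seminorm_fract_Fract(1)[OF s] by simp
qed

text \<open>
  Both sides are seminorms that agree at linear polynomials.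
\<close>

lemma berk_map_classical:
  assumes "poly (denom f) y \<noteq> 0"
  shows "berk_map f (classical_point (Some y)) = classical_point (Some (poly (numer f) y / poly (denom f) y))"
proof -
  let ?s = "disk_norm y 0"
  have s: "?s \<in> berk_affine" "?s (denom f) \<noteq> 0"
    using assms disk_norm_in_berk_affine[of 0 y] by (simp_all add: disk_norm_zero_radius)
  have "image_norm ?s = disk_norm (poly (numer f) y / poly (denom f) y) 0"
  proof (rule berk_affine_eqI[OF image_norm_in_berk_affine[OF s] disk_norm_in_berk_affine])
    fix c
    have "poly (numer f) y - c * poly (denom f) y = (poly (numer f) y / poly (denom f) y - c) * poly (denom f) y" using assms by (simp add: field_simps)
    then have "absval (poly (numer f) y - c * poly (denom f) y) = absval (poly (numer f) y / poly (denom f) y - c) * absval (poly (denom f) y)"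
      by (metis absval_mult)
    then show "image_norm ?s [:- c, 1:] = disk_norm (poly (numer f) y / poly (denom f) y) 0 [:- c, 1:]"
      unfolding image_norm_linear[OF s] using assms by (simp add: disk_norm_zero_radius)
  qed simp
  then show ?thesis
    unfolding classical_point_Some by (simp add: berk_map_Some[of ?s] s(2) del: berk_map.simps)
qed

lemma continuous_map_berk_map:
  "continuous_map (subtopology berk_P1 (Some ` {s \<in> berk_affine. s (denom f) \<noteq> 0})) berk_P1 (berk_map f)"
proof -
  let ?W = "{s \<in> berk_affine. s (denom f) \<noteq> 0}"
  have cont: "continuous_on ?W (\<lambda>s. s g)" for g
    by (rule continuous_on_subset[OF continuous_on_product_coordinates subset_UNIV])
  have "continuous_on ?W image_norm"
  proof (rule continuous_on_coordinatewise_then_product)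
    fix g
    have "s (denom (poly_comp_fract g f)) \<noteq> 0" if "s \<in> ?W" for s
    proof -
      have "s \<in> berk_affine" "s (denom f) \<noteq> 0" using that by auto
      then show ?thesis by (rule image_norm_form[where g = g])
    qed
    then show "continuous_on ?W (\<lambda>s. image_norm s g)"
      unfolding image_norm_def seminorm_fract_def by (intro continuous_on_divide cont) auto
  qed
  then have "continuous_map (top_of_set ?W) (top_of_set berk_affine) image_norm"
    using image_norm_in_berk_affine by auto
  then have cm: "continuous_map (top_of_set ?W) berk_P1 (\<lambda>s. Some (image_norm s))"
    using continuous_map_compose[OF _ continuous_map_Some] unfolding berk_P1_def comp_def by blast
  have W: "openin (top_of_set berk_affine) ?W"
  proof -
    have "open {s :: 'a poly \<Rightarrow> real. s (denom f) \<noteq> 0}"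
      by (rule open_Collect_neq[OF continuous_on_product_coordinates continuous_on_const])
    then have "openin (top_of_set berk_affine) (berk_affine \<inter> {s. s (denom f) \<noteq> 0})" by blast
    then show ?thesis by (simp add: Int_def)
  qed
  have top: "topspace (subtopology berk_P1 (Some ` ?W)) = Some ` ?W"
    by (auto simp: topspace_berk_P1)
  show ?thesis
    unfolding continuous_map_def top
  proof (intro conjI allI impI)
    show "berk_map f \<in> Some ` ?W \<rightarrow> topspace berk_P1"
      using image_norm_in_berk_affine by (auto simp: topspace_berk_P1 berk_map_Some simp del: berk_map.simps)
    fix U :: "'a berk_point set" assume U: "openin berk_P1 U"
    let ?T = "{s \<in> ?W. Some (image_norm s) \<in> U}"
    have "openin (top_of_set ?W) ?T"
      using openin_continuous_map_preimage[OF cm U] by simp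
    then have "openin (top_of_set berk_affine) ?T" by (rule openin_trans[OF _ W])
    then have "openin berk_P1 (Some ` ?T)" by (simp add: berk_P1_def)
    moreover have "{y \<in> Some ` ?W. berk_map f y \<in> U} = Some ` ?T"
      by (auto simp: berk_map_Some simp del: berk_map.simps)
    ultimately show "openin (subtopology berk_P1 (Some ` ?W)) {y \<in> Some ` ?W. berk_map f y \<in> U}"
      unfolding openin_subtopology by (intro exI[of _ "Some ` ?T"]) auto
  qed
qed

end

section \<open>Reduction modulo the maximal ideal\<close>

lemma residue_rel_self: "residue_rel x x \<longleftrightarrow> absval x \<le> 1"
  by (simp add: residue_rel_def)

lemma abs_residue_add:
  "absval x \<le> 1 \<Longrightarrow> absval y \<le> 1 \<Longrightarrow> abs_residue (x + y) = abs_residue x + abs_residue y"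
  by (simp add: plus_residue.abs_eq residue_rel_self)

lemma abs_residue_mult:
  "absval x \<le> 1 \<Longrightarrow> absval y \<le> 1 \<Longrightarrow> abs_residue (x * y) = abs_residue x * abs_residue y"
  by (simp add: times_residue.abs_eq residue_rel_self)

lemma abs_residue_diff:
  assumes "absval x \<le> 1" "absval y \<le> 1"
  shows "abs_residue (x - y) = abs_residue x - abs_residue y"
  using abs_residue_add[of "x - y" y] absval_diff_le_max[of x y] assms by (simp add: algebra_simps)

lemma abs_residue_0 [simp]: "abs_residue 0 = 0"
  by (simp add: zero_residue_def)

lemma abs_residue_eq_iff:
  "absval x \<le> 1 \<Longrightarrow> absval y \<le> 1 \<Longrightarrow> abs_residue x = abs_residue y \<longleftrightarrow> absval (x - y) < 1"
  using Quotient3_rel[OF Quotient3_residue, of x y] by (simp add: residue_rel_def)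

lemma abs_residue_eq_0_iff: "absval x \<le> 1 \<Longrightarrow> abs_residue x = 0 \<longleftrightarrow> absval x < 1"
  using abs_residue_eq_iff[of x 0] by simp

lemma rep_residue: "abs_residue (rep_residue u) = u" "absval (rep_residue u) \<le> 1"
  using Quotient3_abs_rep[OF Quotient3_residue] Quotient3_rep_reflp[OF Quotient3_residue, of u]
  by (simp_all add: residue_rel_self)

text \<open>
  A point that avoids finitely many residue classes lies in a further one.
\<close>

lemma infinite_residue_field: "infinite (UNIV :: 'a::{nonarch_field, alg_closed_field} residue set)"
proof
  assume fin: "finite (UNIV :: 'a residue set)"
  let ?S = "mset_set (range (rep_residue :: 'a residue \<Rightarrow> 'a))"
  have S: "\<alpha> \<in># ?S \<longleftrightarrow> \<alpha> \<in> range (rep_residue :: 'a residue \<Rightarrow> 'a)" for \<alpha> using fin by simp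
  have "absval \<alpha> \<le> 1" if "\<alpha> \<in># ?S" for \<alpha>
    using that rep_residue(2) unfolding S by blast
  then obtain z :: 'a where z: "absval z \<le> 1" "\<And>\<alpha>. \<alpha> \<in># ?S \<Longrightarrow> absval (z - \<alpha>) = 1"
    using avoid_residue_classes[of ?S] by blast
  have "absval (z - rep_residue (abs_residue z)) = 1" by (rule z(2)) (use S in blast)
  then show False
    using abs_residue_eq_iff[OF z(1) rep_residue(2), of "abs_residue z"] by (simp add: rep_residue(1))
qed

lemma poly_eq_on_infinite:
  fixes p q :: "'k::field poly"
  assumes "infinite S" "\<And>x. x \<in> S \<Longrightarrow> poly p x = poly q x"
  shows "p = q"
proof (rule ccontr)
  assume "p \<noteq> q"
  then have "finite {x. poly (p - q) x = 0}" by (intro poly_roots_finite) simp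
  then show False using assms finite_subset[of S "{x. poly (p - q) x = 0}"] by auto
qed

definition integral_poly :: "'a::nonarch_field poly \<Rightarrow> bool" where
  "integral_poly g \<longleftrightarrow> (\<forall>i. absval (coeff g i) \<le> 1)"

definition reduce_poly :: "'a::nonarch_field poly \<Rightarrow> 'a residue poly" where
  "reduce_poly g = map_poly abs_residue g"

lemma coeff_reduce_poly: "coeff (reduce_poly g) i = abs_residue (coeff g i)"
  by (simp add: reduce_poly_def coeff_map_poly)

lemma integral_polyI: "gauss_norm 1 g \<le> 1 \<Longrightarrow> integral_poly g"
  using gauss_norm_ge[of 1 g] unfolding integral_poly_def by (auto intro: order_trans)

lemma coeff_reduce_eq_0_iff: "integral_poly g \<Longrightarrow> coeff (reduce_poly g) i = 0 \<longleftrightarrow> absval (coeff g i) < 1"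
  by (simp add: coeff_reduce_poly abs_residue_eq_0_iff integral_poly_def)

lemma poly_reduce:
  assumes "integral_poly g" "absval y \<le> 1"
  shows "absval (poly g y) \<le> 1 \<and> poly (reduce_poly g) (abs_residue y) = abs_residue (poly g y)"
  using assms(1)
proof (induction g)
  case 0
  then show ?case by (simp add: reduce_poly_def)
next
  case (pCons c g)
  have c: "absval c \<le> 1" using pCons.prems by (auto simp: integral_poly_def dest: spec[of _ 0])
  have "integral_poly g"
    unfolding integral_poly_def
  proof
    fix i show "absval (coeff g i) \<le> 1"
      using pCons.prems[unfolded integral_poly_def, rule_format, of "Suc i"] by simp
  qed
  then have IH: "absval (poly g y) \<le> 1" "poly (reduce_poly g) (abs_residue y) = abs_residue (poly g y)"
    using pCons.IH by auto
  have yg: "absval (y * poly g y) \<le> 1" using IH(1) assms(2) by (simp add: absval_mult mult_le_one)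
  have "reduce_poly (pCons c g) = pCons (abs_residue c) (reduce_poly g)"
    by (simp add: reduce_poly_def map_poly_pCons)
  then show ?case
    using c yg IH assms(2) absval_add_le_max[of c "y * poly g y"]
    by (simp add: abs_residue_add abs_residue_mult)
qed

lemma gauss_norm_affine:
  fixes a b :: "'a::nonarch_field"
  assumes "0 \<le> t" "b \<noteq> 0"
  shows "gauss_norm t (g \<circ>\<^sub>p [:a, b:]) = disk_norm a (absval b * t) g"
proof -
  let ?h = "g \<circ>\<^sub>p [:a, 1:]"
  have "[:a, b:] = [:a, 1:] \<circ>\<^sub>p [:0, b:]" by (simp add: pcompose_pCons)
  then have "g \<circ>\<^sub>p [:a, b:] = ?h \<circ>\<^sub>p [:0, b:]" by (simp add: pcompose_assoc)
  then have coeff: "coeff (g \<circ>\<^sub>p [:a, b:]) i = b ^ i * coeff ?h i" for i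
    by (simp add: coeff_pcompose_linear)
  have eq: "absval (coeff (g \<circ>\<^sub>p [:a, b:]) i) * t ^ i = absval (coeff ?h i) * (absval b * t) ^ i" for i
    unfolding coeff by (simp add: absval_mult absval_power power_mult_distrib)
  show ?thesis
    unfolding disk_norm_def
  proof (rule antisym)
    show "gauss_norm t (g \<circ>\<^sub>p [:a, b:]) \<le> gauss_norm (absval b * t) ?h"
      by (rule gauss_norm_leI) (use assms in \<open>simp only: eq, simp add: gauss_norm_ge\<close>)
    show "gauss_norm (absval b * t) ?h \<le> gauss_norm t (g \<circ>\<^sub>p [:a, b:])"
      by (rule gauss_norm_leI) (use assms in \<open>simp only: eq[symmetric], simp add: gauss_norm_ge\<close>)
  qed
qed

lemma gauss_norm_smult: "0 \<le> t \<Longrightarrow> gauss_norm t (smult c g) = absval c * gauss_norm t g"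
  using gauss_norm_mult[of t "[:c:]" g] by simp

lemma berk_affine_le_disk_norm:
  assumes s: "s \<in> berk_affine" "s [:- e, 1:] \<le> r"
  shows "s h \<le> disk_norm e r h"
proof -
  have r: "0 \<le> r" using s(2) berk_affineD(1)[OF s(1), of "[:- e, 1:]"] by linarith
  have main: "s (g \<circ>\<^sub>p [:- e, 1:]) \<le> gauss_norm r g" for g
  proof (induction g)
    case 0
    then show ?case using berk_affine_more(1)[OF s(1)] gauss_norm_nonneg[OF r] by simp
  next
    case (pCons c g)
    have c: "absval c \<le> gauss_norm r (pCons c g)"
      using gauss_norm_ge[OF r, of "pCons c g" 0] by simp
    obtain i where "gauss_norm r g = absval (coeff g i) * r ^ i"
      using gauss_norm_attained by blast
    then have g: "r * gauss_norm r g \<le> gauss_norm r (pCons c g)"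
      using gauss_norm_ge[OF r, of "pCons c g" "Suc i"] by (simp add: mult_ac)
    have "s (pCons c g \<circ>\<^sub>p [:- e, 1:]) = s ([:c:] + [:- e, 1:] * (g \<circ>\<^sub>p [:- e, 1:]))"
      by (simp only: pcompose_pCons)
    also have "\<dots> \<le> max (absval c) (s [:- e, 1:] * s (g \<circ>\<^sub>p [:- e, 1:]))"
      using berk_affineD(3)[OF s(1)] unfolding berk_affineD(2)[OF s(1), symmetric] berk_affineD(4)[OF s(1), symmetric] .
    also have "s [:- e, 1:] * s (g \<circ>\<^sub>p [:- e, 1:]) \<le> r * gauss_norm r g"
      using s(2) pCons.IH berk_affineD(1)[OF s(1), of "g \<circ>\<^sub>p [:- e, 1:]"] r by (intro mult_mono) linarith+
    finally show ?case using c g by linarith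
  qed
  have "(h \<circ>\<^sub>p [:e, 1:]) \<circ>\<^sub>p [:- e, 1:] = h"
    by (simp add: pcompose_assoc[symmetric] pcompose_pCons)
  then show ?thesis using main[of "h \<circ>\<^sub>p [:e, 1:]"] by (simp add: disk_norm_def)
qed

text \<open>
  On an open disk every polynomial of norm at most \<open>M\<close> differs from its value at the centre by less
  than \<open>M\<close>, also at the points that are not classical.
\<close>

lemma berk_affine_near_value:
  assumes s: "s \<in> berk_affine" "s [:- e, 1:] < r" and M: "disk_norm e r g \<le> M" "0 < M"
  shows "s (g - [:poly g e:]) < M"
proof -
  have s0: "0 \<le> s [:- e, 1:]" by (rule berk_affineD(1)[OF s(1)])
  then have r: "0 < r" using s(2) by linarith
  obtain h where h: "g - [:poly g e:] = [:- e, 1:] * h"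
    using poly_eq_0_iff_dvd[of "g - [:poly g e:]" e] by (auto simp: dvd_def)
  have "absval (poly g e) \<le> M"
    using absval_poly_le_disk_norm[of e e r g] M(1) r by simp
  then have "disk_norm e r ([:- e, 1:] * h) \<le> M"
    using disk_norm_diff[of r e g "[:poly g e:]"] M(1) r unfolding h[symmetric] by simp
  then have le: "r * disk_norm e r h \<le> M"
    using r by (simp only: disk_norm_mult[OF less_imp_le[OF r]] disk_norm_linear) simp
  have "s (g - [:poly g e:]) = s [:- e, 1:] * s h"
    unfolding h by (rule berk_affineD(2)[OF s(1)])
  also have "\<dots> \<le> s [:- e, 1:] * disk_norm e r h"
    using berk_affine_le_disk_norm[OF s(1) less_imp_le[OF s(2)]] s0 by (rule mult_left_mono)
  also have "\<dots> < M"
  proof (cases "disk_norm e r h = 0")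
    case False
    then have "0 < disk_norm e r h" using disk_norm_nonneg[of r e h] r by linarith
    then show ?thesis using le s(2) mult_strict_right_mono[of "s [:- e, 1:]" r "disk_norm e r h"] by linarith
  qed (use M(2) in simp)
  finally show ?thesis .
qed

text \<open>
  Slightly above radius 1, the norm of an integral polynomial is governed by the degree of its
  reduction: a degree gap of two (the coefficients of \<open>q\<close> from \<open>D - 1\<close> on are small) leaves room for
  the additional factor \<open>t\<close>.
\<close>

lemma eventually_gauss_norm_grows:
  assumes p: "absval (coeff p D) = 1"
    and q: "integral_poly q" "\<And>i. D \<le> Suc i \<Longrightarrow> absval (coeff q i) < 1"
  shows "eventually (\<lambda>t. t * gauss_norm t q < gauss_norm t p) (at_right 1)"
proof -
  have "eventually (\<lambda>t. absval (coeff q i) * t ^ Suc i < t ^ D) (at_right 1)" for i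
  proof (cases "D \<le> Suc i")
    case True
    have "((\<lambda>t. t ^ D - absval (coeff q i) * t ^ Suc i) \<longlongrightarrow> 1 ^ D - absval (coeff q i) * 1 ^ Suc i) (at_right (1::real))"
      by (intro tendsto_intros)
    then have "eventually (\<lambda>t. 0 < t ^ D - absval (coeff q i) * t ^ Suc i) (at_right (1::real))"
      by (rule order_tendstoD(1)) (use q(2)[OF True] in simp)
    then show ?thesis by simp
  next
    case False
    have "eventually (\<lambda>t. 1 < t) (at_right (1::real))" by (rule eventually_at_right_less)
    then show ?thesis
    proof (rule eventually_mono)
      fix t :: real assume t: "1 < t"
      have "absval (coeff q i) * t ^ Suc i \<le> t ^ Suc i"
        using q(1) t by (simp add: integral_poly_def mult_left_le_one_le)
      also have "\<dots> < t ^ D" using t False by (simp only: power_strict_increasing_iff)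
      finally show "absval (coeff q i) * t ^ Suc i < t ^ D" .
    qed
  qed
  then have "eventually (\<lambda>t. \<forall>i\<in>{..degree q}. absval (coeff q i) * t ^ Suc i < t ^ D) (at_right 1)"
    by (intro eventually_ball_finite) auto
  moreover have "eventually (\<lambda>t. 1 < t) (at_right (1::real))" by (rule eventually_at_right_less)
  ultimately show ?thesis
  proof eventually_elim
    case (elim t)
    obtain i where i: "i \<le> degree q" "gauss_norm t q = absval (coeff q i) * t ^ i"
      using gauss_norm_attained by blast
    then have "t * gauss_norm t q = absval (coeff q i) * t ^ Suc i" by simp
    also have "\<dots> < t ^ D" using elim(1) i(1) by blast
    also have "\<dots> \<le> gauss_norm t p" using gauss_norm_ge[of t p D] p elim(2) by simp
    finally show ?case .
  qed
qed

text \<open>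
  Slightly below radius 1, the vanishing order of the reduction at 0 takes the place of its degree.
\<close>

lemma eventually_gauss_norm_shrinks:
  assumes p: "integral_poly p" "\<And>i. i < k + 2 \<Longrightarrow> absval (coeff p i) < 1"
    and q: "absval (coeff q k) = 1"
  shows "eventually (\<lambda>t. gauss_norm t p < t * gauss_norm t q) (at_left 1)"
proof -
  have pos: "eventually (\<lambda>t. 0 < t \<and> t < 1) (at_left (1::real))"
    using eventually_at_left_real[of 0 "1::real"] by simp
  have "eventually (\<lambda>t. absval (coeff p i) * t ^ i < t ^ Suc k) (at_left 1)" for i
  proof (cases "i < k + 2")
    case True
    have "((\<lambda>t. t ^ Suc k - absval (coeff p i) * t ^ i) \<longlongrightarrow> 1 ^ Suc k - absval (coeff p i) * 1 ^ i) (at_left (1::real))"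
      by (intro tendsto_intros)
    then have "eventually (\<lambda>t. 0 < t ^ Suc k - absval (coeff p i) * t ^ i) (at_left (1::real))"
      by (rule order_tendstoD(1)) (use p(2)[OF True] in simp)
    then show ?thesis by simp
  next
    case False
    from pos show ?thesis
    proof (rule eventually_mono)
      fix t :: real assume t: "0 < t \<and> t < 1"
      have "absval (coeff p i) * t ^ i \<le> t ^ i"
        using p(1) t by (simp add: integral_poly_def mult_left_le_one_le)
      also have "\<dots> < t ^ Suc k" using t False by (intro power_strict_decreasing) auto
      finally show "absval (coeff p i) * t ^ i < t ^ Suc k" .
    qed
  qed
  then have "eventually (\<lambda>t. \<forall>i\<in>{..degree p}. absval (coeff p i) * t ^ i < t ^ Suc k) (at_left 1)"
    by (intro eventually_ball_finite) auto
  with pos show ?thesis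
  proof eventually_elim
    case (elim t)
    obtain i where i: "i \<le> degree p" "gauss_norm t p = absval (coeff p i) * t ^ i"
      using gauss_norm_attained by blast
    then have "gauss_norm t p < t ^ Suc k" using elim(2) by auto
    also have "\<dots> \<le> t * gauss_norm t q" using gauss_norm_ge[of t q k] q elim(1) by simp
    finally show ?case .
  qed
qed

section \<open>The tangent map at a fixed disk point\<close>

lemma residue_direction_disk:
  fixes a b :: "'a::{nonarch_field, alg_closed_field}"
  assumes "b \<noteq> 0"
  shows "residue_direction a b (Some u) =
      direction_towards (Some (disk_norm a (absval b))) (classical_point (Some (a + b * rep_residue u)))"
    and "residue_direction a b None = direction_towards (Some (disk_norm a (absval b))) None"
  by (simp_all add: disk_point_eq[OF assms] del: classical_point.simps)

lemma absval_scaled_rep_le: "absval (a + b * rep_residue u - a) \<le> absval b"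
  using rep_residue(2)[of u] by (simp add: absval_mult mult_right_le_one_le)

lemma residue_direction_inj:
  fixes a b :: "'a::{nonarch_field, alg_closed_field}"
  assumes b: "b \<noteq> 0" and eq: "residue_direction a b u = residue_direction a b w"
  shows "u = w"
proof -
  have r: "0 < absval b" using b by (rule absval_pos)
  have sub: "residue_direction a b (Some u) \<subseteq> berk_ball (a + b * rep_residue u) (absval b)" for u
    unfolding residue_direction_disk(1)[OF b]
    by (rule direction_towards_classical_subset[OF r absval_scaled_rep_le])
  have None: "residue_direction a b None \<noteq> residue_direction a b (Some u)" for u
    using None_in_direction_towards_None[OF r, of a] sub[of u] None_notin_berk_ball
    unfolding residue_direction_disk(2)[OF b] by blast
  have Some: "u = w" if eq: "residue_direction a b (Some u) = residue_direction a b (Some w)" for u w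
  proof -
    have "classical_point (Some (a + b * rep_residue w)) \<in> residue_direction a b (Some w)"
      unfolding residue_direction_disk(1)[OF b]
      by (intro direction_towards_self classical_point_in_topspace) (metis classical_ne_disk[OF r])
    then have "absval ((a + b * rep_residue w) - (a + b * rep_residue u)) < absval b"
      using sub[of u] unfolding eq[symmetric] classical_in_berk_ball_iff[symmetric] by blast
    moreover have "(a + b * rep_residue w) - (a + b * rep_residue u) = b * (rep_residue w - rep_residue u)"
      by (simp add: algebra_simps)
    ultimately have "absval (rep_residue w - rep_residue u) < 1"
      using r by (simp add: absval_mult)
    then have "abs_residue (rep_residue w) = abs_residue (rep_residue u)"
      using abs_residue_eq_iff[OF rep_residue(2) rep_residue(2)] by blast
    then show ?thesis by (simp add: rep_residue(1))
  qed
  show ?thesis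
    using eq None Some by (cases u; cases w) (metis, metis, metis, metis)
qed

text \<open>
  In the coordinate \<open>y = (z - e) / b\<close> on source and target, \<open>f\<close> is the quotient of \<open>scaled_numer\<close>
  and \<open>scaled_denom\<close>. The scalar \<open>k\<close> will have the absolute value of \<open>q\<close> at the disk point, so that
  both become integral with nonzero reduction.
\<close>

definition scaled_denom :: "'a::nonarch_field poly fract \<Rightarrow> 'a \<Rightarrow> 'a \<Rightarrow> 'a \<Rightarrow> 'a poly" where
  "scaled_denom f k b e = smult (inverse k) (denom f \<circ>\<^sub>p [:e, b:])"

definition scaled_numer :: "'a::nonarch_field poly fract \<Rightarrow> 'a \<Rightarrow> 'a \<Rightarrow> 'a \<Rightarrow> 'a poly" where
  "scaled_numer f k b e = smult (inverse (k * b)) ((numer f - smult e (denom f)) \<circ>\<^sub>p [:e, b:])"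

lemma poly_scaled:
  "poly (scaled_denom f k b e) y = inverse k * poly (denom f) (e + b * y)"
  "poly (scaled_numer f k b e) y = inverse (k * b) * poly (numer f - smult e (denom f)) (e + b * y)"
  by (simp_all add: scaled_denom_def scaled_numer_def poly_pcompose mult.commute)

context
  fixes f :: "'a::{nonarch_field, alg_closed_field} poly fract" and a b k :: 'a
  assumes b: "b \<noteq> 0"
    and fixed: "berk_map f (Some (disk_norm a (absval b))) = Some (disk_norm a (absval b))"
    and k: "absval k = disk_norm a (absval b) (denom f)"
begin

lemma b_pos: "0 < absval b" using b by (rule absval_pos)

lemma k_pos: "0 < absval k" "k \<noteq> 0"
  using disk_norm_pos[OF b_pos lowest_terms(1)[of f], of a] k by auto

text \<open>
  That the disk point is fixed says that \<open>f - c\<close> has there the same absolute value as \<open>z - c\<close>.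
\<close>

lemma fixed_disk_norm:
  "disk_norm a (absval b) (numer f - smult c (denom f)) = absval k * max (absval (a - c)) (absval b)"
proof -
  let ?s = "disk_norm a (absval b)"
  have s: "?s \<in> berk_affine" "?s (denom f) \<noteq> 0"
    using disk_norm_in_berk_affine[of "absval b" a] k k_pos by auto
  have "image_norm f ?s = ?s" using fixed berk_map_Some[of ?s f] s(2) by simp
  then have "?s [:- c, 1:] = ?s (numer f - smult c (denom f)) / ?s (denom f)"
    using image_norm_linear[OF s, of c] by simp
  then show ?thesis using k_pos unfolding disk_norm_linear k[symmetric] by (simp add: field_simps)
qed

lemma gauss_norm_scaled:
  assumes "0 \<le> t"
  shows "gauss_norm t (scaled_denom f k b e) = disk_norm e (absval b * t) (denom f) / absval k"
    and "gauss_norm t (scaled_numer f k b e) =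
      disk_norm e (absval b * t) (numer f - smult e (denom f)) / (absval k * absval b)"
  unfolding scaled_denom_def scaled_numer_def
  using assms by (simp_all only: gauss_norm_smult gauss_norm_affine[OF assms b] absval_inverse absval_mult)
    (simp_all add: divide_inverse)

lemma integral_scaled:
  assumes "absval (e - a) \<le> absval b"
  shows "gauss_norm 1 (scaled_denom f k b e) = 1" "gauss_norm 1 (scaled_numer f k b e) = 1"
    "integral_poly (scaled_denom f k b e)" "integral_poly (scaled_numer f k b e)"
proof -
  have eq: "disk_norm e (absval b) = disk_norm a (absval b)"
    using assms by (intro disk_norm_recenter) auto
  have "absval (a - e) \<le> absval b" using assms absval_diff_commute[of a e] by simp
  then show "gauss_norm 1 (scaled_denom f k b e) = 1" "gauss_norm 1 (scaled_numer f k b e) = 1"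
    using k_pos b_pos b fixed_disk_norm[of e] k by (simp_all add: gauss_norm_scaled eq)
  then show "integral_poly (scaled_denom f k b e)" "integral_poly (scaled_numer f k b e)"
    by (auto intro: integral_polyI)
qed

abbreviation (input) "red_denom \<equiv> reduce_poly (scaled_denom f k b a)"
abbreviation (input) "red_numer \<equiv> reduce_poly (scaled_numer f k b a)"

lemma integral_scaled_center:
  "integral_poly (scaled_denom f k b a)" "integral_poly (scaled_numer f k b a)"
  using integral_scaled(3,4)[of a] by simp_all

lemma red_denom_nonzero: "red_denom \<noteq> 0"
proof
  assume 0: "red_denom = 0"
  obtain i where "gauss_norm 1 (scaled_denom f k b a) = absval (coeff (scaled_denom f k b a) i) * 1 ^ i"
    using gauss_norm_attained by blast
  then have "absval (coeff (scaled_denom f k b a) i) = 1" using integral_scaled(1)[of a] by simp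
  then show False using coeff_reduce_eq_0_iff[OF integral_scaled_center(1), of i] 0 by simp
qed

text \<open>
  On the open disk over \<open>u\<close>, the scaled numerator and denominator stay in their residue classes. If
  the reduced denominator does not vanish at \<open>u\<close>, then \<open>f\<close> has no pole there and sends the whole disk
  into the disk over the quotient of the two classes.
\<close>

lemma image_in_ball:
  assumes u: "poly red_denom u \<noteq> 0"
    and s: "s \<in> berk_affine" "s [:- (a + b * rep_residue u), 1:] < absval b"
  shows "s (denom f) \<noteq> 0"
    and "image_norm f s [:- (a + b * rep_residue (poly red_numer u / poly red_denom u)), 1:] < absval b"
proof -
  let ?e = "a + b * rep_residue u" and ?w = "poly red_numer u / poly red_denom u"
  let ?d = "a + b * rep_residue ?w"
  let ?q = "scaled_denom f k b a" and ?p = "scaled_numer f k b a"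
  have eq: "disk_norm ?e (absval b) = disk_norm a (absval b)"
    by (rule disk_norm_recenter) (use absval_scaled_rep_le in auto)
  have q: "absval (poly ?q (rep_residue u)) \<le> 1" "poly red_denom u = abs_residue (poly ?q (rep_residue u))"
    using poly_reduce[OF integral_scaled_center(1) rep_residue(2)[of u]] by (simp_all add: rep_residue(1))
  have p: "absval (poly ?p (rep_residue u)) \<le> 1" "poly red_numer u = abs_residue (poly ?p (rep_residue u))"
    using poly_reduce[OF integral_scaled_center(2) rep_residue(2)[of u]] by (simp_all add: rep_residue(1))
  have q1: "absval (poly ?q (rep_residue u)) = 1"
    using q u abs_residue_eq_0_iff[OF q(1)] by auto
  have qe: "absval (poly (denom f) ?e) = absval k"
  proof -
    have "inverse (absval k) * absval (poly (denom f) ?e) = 1"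
      using q1 by (simp only: poly_scaled absval_mult absval_inverse)
    then show ?thesis using k_pos by (simp add: field_simps)
  qed
  have "s (denom f - [:poly (denom f) ?e:]) < absval k"
  proof (rule berk_affine_near_value[OF s _ k_pos(1)])
    show "disk_norm ?e (absval b) (denom f) \<le> absval k" by (simp add: eq k)
  qed
  then have near: "s (denom f - [:poly (denom f) ?e:]) < s [:poly (denom f) ?e:]"
    unfolding berk_affineD(4)[OF s(1)] qe .
  have sq: "s (denom f) = absval k"
  proof -
    have "s (denom f) \<le> max (s (denom f - [:poly (denom f) ?e:])) (s [:poly (denom f) ?e:])"
      using berk_affineD(3)[OF s(1), of "denom f - [:poly (denom f) ?e:]" "[:poly (denom f) ?e:]"] by simp
    moreover have "s [:poly (denom f) ?e:] \<le> max (s (denom f)) (s (denom f - [:poly (denom f) ?e:]))"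
      using berk_affine_more(4)[OF s(1), of "denom f" "denom f - [:poly (denom f) ?e:]"] by simp
    ultimately have "s (denom f) = s [:poly (denom f) ?e:]" using near by linarith
    then show ?thesis unfolding berk_affineD(4)[OF s(1)] qe .
  qed
  then show sqnz: "s (denom f) \<noteq> 0" using k_pos by simp
  let ?h = "numer f - smult ?d (denom f)"
  have value_small: "absval (poly ?h ?e) < absval k * absval b"
  proof -
    have w: "absval (rep_residue ?w * poly ?q (rep_residue u)) \<le> 1"
      using rep_residue(2)[of ?w] q(1) by (simp add: absval_mult mult_le_one)
    have "abs_residue (rep_residue ?w * poly ?q (rep_residue u)) = ?w * poly red_denom u"
      using abs_residue_mult[OF rep_residue(2)[of ?w] q(1)] q(2) by (simp add: rep_residue(1))
    then have "abs_residue (poly ?p (rep_residue u)) = abs_residue (rep_residue ?w * poly ?q (rep_residue u))"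
      using u p(2) by simp
    then have lt: "absval (poly ?p (rep_residue u) - rep_residue ?w * poly ?q (rep_residue u)) < 1"
      using abs_residue_eq_iff[OF p(1) w] by blast
    have "poly ?h ?e = (k * b) * (poly ?p (rep_residue u) - rep_residue ?w * poly ?q (rep_residue u))"
      using k_pos b by (simp add: poly_scaled field_simps)
    then have "absval (poly ?h ?e) = absval k * absval b * absval (poly ?p (rep_residue u) - rep_residue ?w * poly ?q (rep_residue u))"
      by (simp add: absval_mult)
    then show ?thesis using lt k_pos b_pos by simp
  qed
  have "absval (a - ?d) \<le> absval b"
    using absval_scaled_rep_le[of a b ?w] absval_diff_commute[of a ?d] by simp
  then have normh: "disk_norm ?e (absval b) ?h \<le> absval k * absval b"
    using fixed_disk_norm[of ?d] by (simp add: eq)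
  have "s (?h - [:poly ?h ?e:]) < absval k * absval b"
    by (rule berk_affine_near_value[OF s normh]) (use k_pos b_pos in simp)
  moreover have "s ?h \<le> max (s (?h - [:poly ?h ?e:])) (absval (poly ?h ?e))"
    using berk_affineD(3)[OF s(1), of "?h - [:poly ?h ?e:]" "[:poly ?h ?e:]"]
    unfolding berk_affineD(4)[OF s(1)] by simp
  ultimately have "s ?h < absval k * absval b" using value_small by linarith
  then show "image_norm f s [:- ?d, 1:] < absval b"
    unfolding image_norm_linear[OF s(1) sqnz] sq using k_pos by (simp add: pos_divide_less_eq mult.commute)
qed

text \<open>
  The image of a direction is connected and avoids the disk point, so it lies in one direction; the
  image of the centre shows in which.
\<close>

lemma tangent_map_generic:
  assumes u: "poly red_denom u \<noteq> 0"
  shows "tangent_map f (Some (disk_norm a (absval b))) (residue_direction a b (Some u)) =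
    residue_direction a b (Some (poly red_numer u / poly red_denom u))"
proof -
  let ?x = "Some (disk_norm a (absval b))"
  let ?w = "poly red_numer u / poly red_denom u"
  let ?e = "a + b * rep_residue u" and ?d = "a + b * rep_residue ?w"
  let ?v = "direction_towards ?x (classical_point (Some ?e))"
  let ?dir = "direction_towards ?x (classical_point (Some ?d))"
  let ?W = "{s \<in> berk_affine. s (denom f) \<noteq> 0}"
  note r = b_pos
  have v: "?v \<subseteq> berk_ball ?e (absval b)"
    by (rule direction_towards_classical_subset[OF r absval_scaled_rep_le])
  have ev: "classical_point (Some ?e) \<in> ?v"
    by (intro direction_towards_self classical_point_in_topspace) (metis classical_ne_disk[OF r])
  have vW: "?v \<subseteq> Some ` ?W"
  proof
    fix y assume "y \<in> ?v"
    then obtain s where s: "y = Some s" "s \<in> berk_affine" "s [:- ?e, 1:] < absval b"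
      using v by (auto simp: berk_ball_def)
    then show "y \<in> Some ` ?W" using image_in_ball(1)[OF u s(2,3)] by blast
  qed
  have img: "berk_map f ` ?v \<subseteq> berk_ball ?d (absval b)"
  proof
    fix y assume "y \<in> berk_map f ` ?v"
    then obtain s where s: "y = berk_map f (Some s)" "s \<in> berk_affine" "s [:- ?e, 1:] < absval b"
      using v by (auto simp: berk_ball_def)
    have nz: "s (denom f) \<noteq> 0" by (rule image_in_ball(1)[OF u s(2,3)])
    have "y = Some (image_norm f s)" unfolding s(1) by (rule berk_map_Some[of s f, OF nz])
    then show "y \<in> berk_ball ?d (absval b)"
      using image_in_ball(2)[OF u s(2,3)] image_norm_in_berk_affine[OF s(2) nz] by (simp add: berk_ball_iff)
  qed
  have conn: "connectedin berk_P1 (berk_map f ` ?v)"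
    using connectedin_direction_towards(1) vW
    by (intro connectedin_continuous_map_image[OF continuous_map_berk_map[of f]]) (auto simp: connectedin_subtopology)
  have xnot: "?x \<notin> berk_map f ` ?v"
  proof
    assume "?x \<in> berk_map f ` ?v"
    then have "?x \<in> berk_ball ?d (absval b)" using img by blast
    then have "disk_norm a (absval b) [:- ?d, 1:] < absval b" unfolding berk_ball_iff by blast
    then show False unfolding disk_norm_linear by simp
  qed
  have imge: "berk_map f (classical_point (Some ?e)) \<in> ?dir"
  proof -
    have "disk_norm ?e 0 \<in> berk_affine" "disk_norm ?e 0 [:- ?e, 1:] < absval b"
      unfolding disk_norm_linear using r by (simp_all add: disk_norm_in_berk_affine)
    then have "poly (denom f) ?e \<noteq> 0" using image_in_ball(1)[OF u] by (fastforce simp: disk_norm_zero_radius)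
    then have eq: "berk_map f (classical_point (Some ?e)) = classical_point (Some (poly (numer f) ?e / poly (denom f) ?e))"
      by (rule berk_map_classical)
    moreover have "berk_map f (classical_point (Some ?e)) \<in> berk_ball ?d (absval b)" using img ev by blast
    ultimately show ?thesis
      using classical_near_in_direction[OF r absval_scaled_rep_le] by (simp only: classical_in_berk_ball_iff)
  qed
  have sub: "berk_map f ` ?v \<subseteq> ?dir"
  proof
    fix y assume y: "y \<in> berk_map f ` ?v"
    have y': "y \<in> direction_towards ?x (berk_map f (classical_point (Some ?e)))"
      by (rule in_direction_towards[OF conn xnot imageI[OF ev] y])
    have top: "berk_map f (classical_point (Some ?e)) \<in> topspace berk_P1" "?x \<noteq> berk_map f (classical_point (Some ?e))"
      using connectedin_subset_topspace[OF conn] imageI[OF ev, of "berk_map f"] xnot by (blast, metis)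
    have "direction_towards ?x (berk_map f (classical_point (Some ?e))) = ?dir"
      using direction_towards_self[OF top] imge
      by (intro directions_eq[of _ ?x] direction_towards_in_directions top classical_point_in_topspace)
        (metis classical_ne_disk[OF r])+
    then show "y \<in> ?dir" using y' by simp
  qed
  have dir: "?dir \<in> directions ?x"
    by (intro direction_towards_in_directions classical_point_in_topspace) (metis classical_ne_disk[OF r])
  have "tangent_map f ?x ?v = ?dir"
    unfolding tangent_map_def fixed
  proof (rule the_equality)
    have "?x \<in> topspace berk_P1" by (simp add: topspace_berk_P1 disk_norm_in_berk_affine)
    then show "?dir \<in> directions ?x \<and> (\<exists>V. openin berk_P1 V \<and> ?x \<in> V \<and> berk_map f ` (V \<inter> ?v) \<subseteq> ?dir)"
      using dir sub by (intro conjI exI[of _ "topspace berk_P1"]) auto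
  next
    fix w assume w: "w \<in> directions ?x \<and> (\<exists>V. openin berk_P1 V \<and> ?x \<in> V \<and> berk_map f ` (V \<inter> ?v) \<subseteq> w)"
    then obtain V where V: "openin berk_P1 V" "?x \<in> V" "berk_map f ` (V \<inter> ?v) \<subseteq> w" by blast
    obtain z where "z \<in> V \<inter> ?v"
      using disk_point_approached[OF r absval_scaled_rep_le V(1,2)] by blast
    then have "berk_map f z \<in> w" "berk_map f z \<in> ?dir" using V(3) sub by auto
    then show "w = ?dir" using directions_eq w dir by metis
  qed
  then show ?thesis unfolding residue_direction_disk(1)[OF b] .
qed

end

section \<open>Critically fixed directions\<close>

lemma disk_norm_value_attained:
  fixes a b :: "'a::nonarch_field"
  shows "\<exists>k::'a. absval k = disk_norm a (absval b) g"
proof -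
  let ?h = "g \<circ>\<^sub>p [:a, 1:]"
  obtain i where "gauss_norm (absval b) ?h = absval (coeff ?h i) * absval b ^ i"
    using gauss_norm_attained by blast
  then have "absval (coeff ?h i * b ^ i) = disk_norm a (absval b) g"
    by (simp add: disk_norm_def absval_mult absval_power)
  then show ?thesis by blast
qed

lemma nonconstant_numer_ne:
  assumes "nonconstant \<phi>"
  shows "numer \<phi> \<noteq> smult u (denom \<phi>)"
proof
  assume eq: "numer \<phi> = smult u (denom \<phi>)"
  have "\<phi> = Fract (numer \<phi>) (denom \<phi>)" by (rule lowest_terms(3))
  also have "\<dots> = Fract [:u:] 1" unfolding eq using lowest_terms(1)[of \<phi>] by (subst eq_fract(1)) simp_all
  finally show False using assms unfolding nonconstant_def to_fract_def by blast
qed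

context
  fixes f :: "'a::{nonarch_field, alg_closed_field} poly fract" and a b k :: 'a
    and \<phi> :: "'a residue poly fract"
  assumes b: "b \<noteq> 0"
    and fixed: "berk_map f (Some (disk_norm a (absval b))) = Some (disk_norm a (absval b))"
    and k: "absval k = disk_norm a (absval b) (denom f)"
    and \<phi>: "nonconstant \<phi>"
    and tangent: "\<And>u. tangent_map f (Some (disk_norm a (absval b))) (residue_direction a b u) =
      residue_direction a b (rat_eval \<phi> u)"
begin

text \<open>
  Both sides agree wherever the reduced denominator does not vanish, which is at infinitely many
  residue classes.
\<close>

lemma tangent_map_is_reduction: "numer \<phi> * (red_denom f a b k) = (red_numer f a b k) * denom \<phi>"
proof (rule poly_eq_on_infinite)
  have "finite {u. poly (red_denom f a b k) u = 0}"
    using red_denom_nonzero[OF b fixed k] by (rule poly_roots_finite)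
  then have "infinite (UNIV - {u. poly (red_denom f a b k) u = 0})"
    using infinite_residue_field by (rule Diff_infinite_finite)
  then show "infinite {u. poly (red_denom f a b k) u \<noteq> 0}" by (simp add: set_diff_eq)
  fix u assume "u \<in> {u. poly (red_denom f a b k) u \<noteq> 0}"
  then have u: "poly (red_denom f a b k) u \<noteq> 0" by simp
  have "residue_direction a b (rat_eval \<phi> (Some u)) = residue_direction a b (Some (poly (red_numer f a b k) u / poly (red_denom f a b k) u))"
    using tangent[of "Some u"] tangent_map_generic[OF b fixed k u] by simp
  then have "rat_eval \<phi> (Some u) = Some (poly (red_numer f a b k) u / poly (red_denom f a b k) u)"
    by (rule residue_direction_inj[OF b])
  then have "poly (denom \<phi>) u \<noteq> 0" "poly (numer \<phi>) u / poly (denom \<phi>) u = poly (red_numer f a b k) u / poly (red_denom f a b k) u"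
    by (auto split: if_splits)
  then show "poly (numer \<phi> * (red_denom f a b k)) u = poly ((red_numer f a b k) * denom \<phi>) u"
    using u by (simp add: frac_eq_eq)
qed

text \<open>
  Ramification at the fixed point infinity is the difference of the degrees of numerator and
  denominator, which passes from \<open>\<phi>\<close> to the two reductions.
\<close>

lemma expansion_towards_infinity:
  assumes ram: "2 \<le> ramification_index \<phi> None" and fix_inf: "rat_eval \<phi> None = None"
  shows "\<exists>R>absval b. \<forall>\<rho>. absval b < \<rho> \<and> \<rho> < R \<longrightarrow>
    \<rho> * disk_norm a \<rho> (denom f) < disk_norm a \<rho> (numer f - smult a (denom f))"
proof -
  have bpos: "0 < absval b" using b by (rule absval_pos)
  have kpos: "0 < absval k" by (rule k_pos(1)[OF b fixed k])
  have deg: "degree (denom \<phi>) + 2 \<le> degree (numer \<phi>)"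
    using ram fix_inf by (auto simp: ramification_index_def rat_degree_def split: if_splits)
  then have nz: "numer \<phi> \<noteq> 0" by auto
  have rd: "(red_denom f a b k) \<noteq> 0" by (rule red_denom_nonzero[OF b fixed k])
  have rn: "(red_numer f a b k) \<noteq> 0" using tangent_map_is_reduction nz rd by auto
  have "degree (numer \<phi>) + degree (red_denom f a b k) = degree (red_numer f a b k) + degree (denom \<phi>)"
    using tangent_map_is_reduction nz rd rn lowest_terms(1)[of \<phi>] by (metis degree_mult_eq)
  then have D: "degree (red_denom f a b k) + 2 \<le> degree (red_numer f a b k)" using deg by simp
  note int = integral_scaled_center[OF b fixed k]
  have "eventually (\<lambda>t. t * gauss_norm t (scaled_denom f k b a) < gauss_norm t (scaled_numer f k b a)) (at_right 1)"
  proof (rule eventually_gauss_norm_grows[OF _ int(1)])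
    have "\<not> absval (coeff (scaled_numer f k b a) (degree (red_numer f a b k))) < 1"
      using coeff_reduce_eq_0_iff[OF int(2), of "degree (red_numer f a b k)"] rn by simp
    then show "absval (coeff (scaled_numer f k b a) (degree (red_numer f a b k))) = 1"
      using int(2) unfolding integral_poly_def by (simp add: antisym)
    fix i assume "degree (red_numer f a b k) \<le> Suc i"
    then have "coeff (red_denom f a b k) i = 0" using D by (intro coeff_eq_0) simp
    then show "absval (coeff (scaled_denom f k b a) i) < 1"
      using coeff_reduce_eq_0_iff[OF int(1)] by simp
  qed
  then obtain T where T: "1 < T"
    "\<And>t. 1 < t \<Longrightarrow> t < T \<Longrightarrow> t * gauss_norm t (scaled_denom f k b a) < gauss_norm t (scaled_numer f k b a)"
    unfolding eventually_at_right_field by blast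
  show ?thesis
  proof (intro exI[of _ "absval b * T"] conjI allI impI)
    show "absval b < absval b * T" using bpos T(1) by simp
    fix \<rho> assume \<rho>: "absval b < \<rho> \<and> \<rho> < absval b * T"
    let ?t = "\<rho> / absval b"
    have t: "1 < ?t" "?t < T" "absval b * ?t = \<rho>" "0 \<le> ?t" using \<rho> bpos by (auto simp: field_simps)
    have "?t * (disk_norm a \<rho> (denom f) / absval k) <
        disk_norm a \<rho> (numer f - smult a (denom f)) / (absval k * absval b)"
      using T(2)[OF t(1,2)] by (simp only: gauss_norm_scaled[OF b fixed k t(4)] t(3))
    then show "\<rho> * disk_norm a \<rho> (denom f) < disk_norm a \<rho> (numer f - smult a (denom f))"
      using bpos kpos b by (simp add: field_simps split: if_splits)
  qed
qed

text \<open>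
  With the centre moved to the residue class \<open>u\<close>, ramification at \<open>u\<close> says that the reduction of
  \<open>p - e q\<close> vanishes there to an order larger by two than that of \<open>q\<close>.
\<close>

lemma contraction_towards_residue:
  assumes ram: "2 \<le> ramification_index \<phi> (Some u)" and fix_u: "rat_eval \<phi> (Some u) = Some u"
  defines "e \<equiv> a + b * rep_residue u"
  shows "\<exists>R<absval b. \<forall>\<rho>. R < \<rho> \<and> \<rho> < absval b \<longrightarrow>
    disk_norm e \<rho> (numer f - smult e (denom f)) < \<rho> * disk_norm e \<rho> (denom f)"
proof -
  have bpos: "0 < absval b" using b by (rule absval_pos)
  have kpos: "0 < absval k" "k \<noteq> 0" by (rule k_pos[OF b fixed k])+
  note int = integral_scaled_center[OF b fixed k]
  have ea: "absval (e - a) \<le> absval b" unfolding e_def by (rule absval_scaled_rep_le)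
  note int_e = integral_scaled(3,4)[OF b fixed k ea]
  have du: "poly (denom \<phi>) u \<noteq> 0" using fix_u by (auto split: if_splits)
  let ?h = "numer \<phi> - smult u (denom \<phi>)"
  let ?d = "(red_numer f a b k) - smult u (red_denom f a b k)"
  have ord: "2 \<le> order u ?h"
    using ram unfolding ramification_index_def fix_u by simp
  have hnz: "?h \<noteq> 0" using nonconstant_numer_ne[OF \<phi>, of u] by simp
  have rd: "(red_denom f a b k) \<noteq> 0" by (rule red_denom_nonzero[OF b fixed k])
  have eq: "?h * (red_denom f a b k) = ?d * denom \<phi>"
    using tangent_map_is_reduction by (simp add: algebra_simps)
  define n where "n = order u (red_denom f a b k)"
  have dnz: "?d \<noteq> 0" using eq hnz rd by (metis mult_zero_left no_zero_divisors)
  have prod_nz: "?h * (red_denom f a b k) \<noteq> 0" "?d * denom \<phi> \<noteq> 0"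
    using no_zero_divisors[OF hnz rd] no_zero_divisors[OF dnz lowest_terms(1)[of \<phi>]] by blast+
  have "order u ?h + n = order u ?d + order u (denom \<phi>)"
    unfolding n_def prod_nz[THEN order_mult, symmetric] by (simp only: eq)
  moreover have "order u (denom \<phi>) = 0" using du by (rule order_0I)
  ultimately have "n + 2 \<le> order u ?d" using ord by simp
  then have "[:- u, 1:] ^ (n + 2) dvd ?d" by (rule order_divides[THEN iffD2, OF disjI2])
  then obtain d' where d': "?d = [:- u, 1:] ^ (n + 2) * d'" by (rule dvdE)
  obtain q' where q': "(red_denom f a b k) = [:- u, 1:] ^ n * q'" "\<not> [:- u, 1:] dvd q'"
    using order_decomp[OF rd, of u] unfolding n_def by blast
  have q'u: "poly q' u \<noteq> 0" using q'(2) by (simp add: poly_eq_0_iff_dvd)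
  have shift: "([:- u, 1:] ^ m * g) \<circ>\<^sub>p [:u, 1:] = monom 1 m * (g \<circ>\<^sub>p [:u, 1:])" for m g
  proof -
    have lin: "[:- u, 1:] \<circ>\<^sub>p [:u, 1:] = [:0, 1:]" by (simp add: pcompose_pCons)
    have "([:- u, 1:] ^ m) \<circ>\<^sub>p [:u, 1:] = [:0, 1:] ^ m"
      by (induction m) (simp_all only: power_0 power_Suc pcompose_1 pcompose_mult lin)
    then show ?thesis by (simp only: pcompose_mult monom_altdef smult_1_left)
  qed
  (* The expansion at e is the expansion at a shifted by rep_residue u. *)
  have vals: "poly (reduce_poly (scaled_denom f k b e)) w = poly ((red_denom f a b k) \<circ>\<^sub>p [:u, 1:]) w \<and>
      poly (reduce_poly (scaled_numer f k b e)) w = poly (?d \<circ>\<^sub>p [:u, 1:]) w" for w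
  proof -
    let ?y = "rep_residue w" and ?z = "rep_residue u + rep_residue w"
    let ?Q = "scaled_denom f k b a" and ?P = "scaled_numer f k b a"
    have y: "absval ?y \<le> 1" "abs_residue ?y = w" by (rule rep_residue)+
    have z: "absval ?z \<le> 1" "abs_residue ?z = u + w"
      using abs_residue_add[OF rep_residue(2)[of u] y(1)] absval_add_le_max[of "rep_residue u" ?y]
        rep_residue[of u] y by simp_all
    have "e + b * ?y = a + b * ?z" by (simp add: e_def algebra_simps)
    then have pe: "poly (scaled_denom f k b e) ?y = poly ?Q ?z"
        "poly (scaled_numer f k b e) ?y = poly ?P ?z - rep_residue u * poly ?Q ?z"
      using b kpos by (simp_all add: poly_scaled e_def field_simps)
    note PQ = poly_reduce[OF int(1) z(1), unfolded z(2)] poly_reduce[OF int(2) z(1), unfolded z(2)]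
    have uQ: "absval (rep_residue u * poly ?Q ?z) \<le> 1"
      using PQ(1) rep_residue(2)[of u] by (simp add: absval_mult mult_le_one)
    have "poly (reduce_poly (scaled_denom f k b e)) w = poly (red_denom f a b k) (u + w)"
      using poly_reduce[OF int_e(1) y(1)] PQ(1) pe(1) y(2) by simp
    moreover have "poly (reduce_poly (scaled_numer f k b e)) w = poly ?d (u + w)"
      using poly_reduce[OF int_e(2) y(1)] PQ pe(2) y(2) uQ rep_residue[of u]
      by (simp add: abs_residue_diff abs_residue_mult)
    ultimately show ?thesis by (simp add: poly_pcompose)
  qed
  have red_e: "reduce_poly (scaled_denom f k b e) = monom 1 n * (q' \<circ>\<^sub>p [:u, 1:])"
    "reduce_poly (scaled_numer f k b e) = monom 1 (n + 2) * (d' \<circ>\<^sub>p [:u, 1:])"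
    unfolding shift[symmetric] q'(1)[symmetric] d'[symmetric]
    using vals by (auto intro!: poly_eq_on_infinite[OF infinite_residue_field])
  have "eventually (\<lambda>t. gauss_norm t (scaled_numer f k b e) < t * gauss_norm t (scaled_denom f k b e)) (at_left 1)"
  proof (rule eventually_gauss_norm_shrinks[OF int_e(2)])
    fix i assume "i < n + 2"
    then have "coeff (reduce_poly (scaled_numer f k b e)) i = 0"
      unfolding red_e by (simp add: coeff_monom_mult)
    then show "absval (coeff (scaled_numer f k b e) i) < 1"
      using coeff_reduce_eq_0_iff[OF int_e(2)] by simp
  next
    have "coeff (reduce_poly (scaled_denom f k b e)) n \<noteq> 0"
      unfolding red_e using q'u by (simp add: coeff_monom_mult coeff_pcompose_0)
    then have "\<not> absval (coeff (scaled_denom f k b e) n) < 1"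
      using coeff_reduce_eq_0_iff[OF int_e(1)] by simp
    then show "absval (coeff (scaled_denom f k b e) n) = 1"
      using int_e(1) unfolding integral_poly_def by (simp add: antisym)
  qed
  then obtain T where T: "T < 1"
    "\<And>t. T < t \<Longrightarrow> t < 1 \<Longrightarrow> gauss_norm t (scaled_numer f k b e) < t * gauss_norm t (scaled_denom f k b e)"
    unfolding eventually_at_left_field by blast
  show ?thesis
  proof (intro exI[of _ "absval b * max T 0"] conjI allI impI)
    show "absval b * max T 0 < absval b" using bpos T(1) by simp
    fix \<rho> assume \<rho>: "absval b * max T 0 < \<rho> \<and> \<rho> < absval b"
    let ?t = "\<rho> / absval b"
    have "max T 0 < ?t" 
      unfolding pos_less_divide_eq[OF bpos] using \<rho> by (simp only: mult.commute[of "max T 0"])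
    then have t: "T < ?t" "?t < 1" "absval b * ?t = \<rho>" "0 \<le> ?t"
      using \<rho> bpos b by (simp_all add: divide_less_eq_1_pos del: zero_le_divide_iff)
    have "disk_norm e \<rho> (numer f - smult e (denom f)) / (absval k * absval b) <
        ?t * (disk_norm e \<rho> (denom f) / absval k)"
      using T(2)[OF t(1,2)] by (simp only: gauss_norm_scaled[OF b fixed k t(4)] t(3))
    then show "disk_norm e \<rho> (numer f - smult e (denom f)) < \<rho> * disk_norm e \<rho> (denom f)"
      using bpos kpos b by (simp add: field_simps split: if_splits)
  qed
qed

end

text \<open>
  For a direction that does not contain infinity, the disk point is written with a centre \<open>a\<close> inside
  the direction.
\<close>

theorem critically_fixed_cases [consumes 1, case_names towards_infinity bounded]:
  fixes f :: "'a::{nonarch_field, alg_closed_field} poly fract"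
  assumes "critically_fixed f x v"
  obtains (towards_infinity) a r R where "0 < r" "x = Some (disk_norm a r)" "v = direction_towards x None"
      "r < R" "\<And>\<rho>. r < \<rho> \<Longrightarrow> \<rho> < R \<Longrightarrow>
        \<rho> * disk_norm a \<rho> (denom f) < disk_norm a \<rho> (numer f - smult a (denom f))"
    | (bounded) a r R where "0 < r" "x = Some (disk_norm a r)" "v = direction_towards x (classical_point (Some a))"
      "R < r" "\<And>\<rho>. R < \<rho> \<Longrightarrow> \<rho> < r \<Longrightarrow>
        disk_norm a \<rho> (numer f - smult a (denom f)) < \<rho> * disk_norm a \<rho> (denom f)"
proof -
  have fx: "berk_map f x = x" and tv: "tangent_map f x v = v"
    using assms by (simp_all add: critically_fixed_def)
  obtain a b \<phi> c where b: "b \<noteq> 0" and x0: "x = disk_point a (absval b)" and \<phi>: "nonconstant \<phi>"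
    and tangent: "\<And>u. tangent_map f x (residue_direction a b u) = residue_direction a b (rat_eval \<phi> u)"
    and v: "v = residue_direction a b c" and ram: "2 \<le> ramification_index \<phi> c"
    using assms unfolding critically_fixed_def by blast
  have x: "x = Some (disk_norm a (absval b))" using x0 disk_point_eq[OF b] by simp
  obtain k :: 'a where k: "absval k = disk_norm a (absval b) (denom f)"
    using disk_norm_value_attained by blast
  have r: "0 < absval b" using b by (rule absval_pos)
  have fx': "berk_map f (Some (disk_norm a (absval b))) = Some (disk_norm a (absval b))"
    using fx unfolding x .
  have tangent': "tangent_map f (Some (disk_norm a (absval b))) (residue_direction a b u) =
      residue_direction a b (rat_eval \<phi> u)" for u
    using tangent[of u] unfolding x .
  have fixc: "rat_eval \<phi> c = c"
    using tangent[of c] tv v by (intro residue_direction_inj[OF b, of a]) simp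
  show ?thesis
  proof (cases c)
    case None
    obtain R where "absval b < R" "\<And>\<rho>. absval b < \<rho> \<and> \<rho> < R \<Longrightarrow>
      \<rho> * disk_norm a \<rho> (denom f) < disk_norm a \<rho> (numer f - smult a (denom f))"
      using expansion_towards_infinity[OF b fx' k \<phi> tangent' ram[unfolded None] fixc[unfolded None]] by blast
    moreover have "v = direction_towards x None"
      unfolding v None x by (rule residue_direction_disk(2)[OF b])
    ultimately show ?thesis using towards_infinity[OF r x] by blast
  next
    case (Some u)
    let ?e = "a + b * rep_residue u"
    obtain R where "R < absval b" "\<And>\<rho>. R < \<rho> \<and> \<rho> < absval b \<Longrightarrow>
      disk_norm ?e \<rho> (numer f - smult ?e (denom f)) < \<rho> * disk_norm ?e \<rho> (denom f)"
      using contraction_towards_residue[OF b fx' k \<phi> tangent' ram[unfolded Some] fixc[unfolded Some]] by blast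
    moreover have "v = direction_towards x (classical_point (Some ?e))"
      unfolding v Some x by (rule residue_direction_disk(1)[OF b])
    moreover have "x = Some (disk_norm ?e (absval b))"
      unfolding x using absval_scaled_rep_le[of a b u] absval_diff_commute[of a ?e]
      by (simp add: disk_norm_recenter)
    ultimately show ?thesis using bounded[OF r] by blast
  qed
qed

section \<open>Classical fixed points in compressive domains\<close>

text \<open>
  Radii are chosen close enough to the boundary radius that no root is added or lost.
\<close>

lemma radius_above:
  fixes r R :: real
  assumes "finite S" "r < R"
  obtains \<rho> where "r < \<rho>" "\<rho> < R" "\<And>s. s \<in> S \<Longrightarrow> s \<le> \<rho> \<Longrightarrow> s \<le> r"
proof -
  (* No value of S lies strictly between r and Min T. *)
  define T where "T = insert R {s \<in> S. r < s}"
  have T: "finite T" "T \<noteq> {}" "\<And>t. t \<in> T \<Longrightarrow> r < t" using assms by (auto simp: T_def)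
  have m: "r < Min T" "Min T \<le> R"
    using T(3)[OF Min_in[OF T(1,2)]] Min_le[OF T(1), of R] by (simp_all add: T_def)
  have below: "s \<le> r" if "s \<in> S" "s \<le> (r + Min T) / 2" for s
  proof (rule ccontr)
    assume "\<not> s \<le> r"
    then have "Min T \<le> s" using that T(1) by (intro Min_le) (auto simp: T_def)
    then show False using that m by simp
  qed
  show ?thesis by (rule that[of "(r + Min T) / 2"]) (use m below in auto)
qed

lemma radius_below:
  fixes r R :: real
  assumes "finite S" "R < r"
  obtains \<rho> where "R < \<rho>" "\<rho> < r" "\<And>s. s \<in> S \<Longrightarrow> s < r \<Longrightarrow> s \<le> \<rho>"
proof -
  define T where "T = insert R {s \<in> S. s < r}"
  have T: "finite T" "T \<noteq> {}" "\<And>t. t \<in> T \<Longrightarrow> t < r" using assms by (auto simp: T_def)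
  have m: "Max T < r" "R \<le> Max T"
    using T(3)[OF Max_in[OF T(1,2)]] Max_ge[OF T(1), of R] by (simp_all add: T_def)
  have above: "s \<le> (r + Max T) / 2" if "s \<in> S" "s < r" for s
  proof -
    have "s \<le> Max T" using that T(1) by (intro Max_ge) (auto simp: T_def)
    then show ?thesis using m by simp
  qed
  show ?thesis by (rule that[of "(r + Max T) / 2"]) (use m above in auto)
qed

text \<open>
  A root of \<open>z q - p\<close> is no root of \<open>q\<close>, since \<open>p\<close> and \<open>q\<close> are coprime.
\<close>

lemma fixed_classical_point:
  fixes f :: "'a::{nonarch_field, alg_closed_field} poly fract"
  assumes "poly ([:0, 1:] * denom f - numer f) \<alpha> = 0"
  shows "berk_map f (classical_point (Some \<alpha>)) = classical_point (Some \<alpha>)"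
proof -
  have eq: "poly (numer f) \<alpha> = \<alpha> * poly (denom f) \<alpha>" using assms by simp
  have nz: "poly (denom f) \<alpha> \<noteq> 0"
  proof
    assume 0: "poly (denom f) \<alpha> = 0"
    obtain u w where "u * numer f + w * denom f = 1"
      using coprime_comaximal[OF lowest_terms(2,1)] by blast
    then have "poly (u * numer f + w * denom f) \<alpha> = 1" by (simp only: poly_1)
    then show False using eq 0 by simp
  qed
  then have "poly (numer f) \<alpha> / poly (denom f) \<alpha> = \<alpha>" using eq by simp
  then show ?thesis using berk_map_classical[OF nz] by simp
qed

theorem theoremC:
  fixes f :: "'a::{nonarch_field, complete_space, alg_closed_field} poly fract"
    and U :: "'a berk_point set"
  assumes "nonconstant f"
    and "compressive_domain f U"
  shows "\<exists>y \<in> range classical_point \<inter> U. berk_map f y = y"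
proof (rule ccontr)
  assume none: "\<not> (\<exists>y \<in> range classical_point \<inter> U. berk_map f y = y)"
  obtain n :: nat and x v where inj: "inj_on x {..<n}"
    and U: "U = topspace berk_P1 \<inter> (\<Inter>i<n. v i)"
    and frontier: "berk_P1 frontier_of U = x ` {..<n}"
    and crit: "\<And>i. i < n \<Longrightarrow> critically_fixed f (x i) (v i)"
    using assms(2) unfolding compressive_domain_def
  proof (elim exE conjE)
    fix n :: nat and x v
    assume "inj_on x {..<n}" "U = topspace berk_P1 \<inter> (\<Inter>i<n. v i)" "berk_P1 frontier_of U = x ` {..<n}"
      and "\<forall>i<n. berk_map f (x i) = x i \<and> critically_fixed f (x i) (v i)"
    then show thesis using that by simp
  qed
  define p where "p = numer f"
  define q where "q = denom f"
  define P where "P = [:0, 1:] * q - p"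
  have q0: "q \<noteq> 0" by (simp add: q_def lowest_terms(1))
  (* The two cases of critically_fixed_cases, packed into one predicate so that the data can be chosen
     for all boundary points at once; unb tells whether the direction is unbounded. *)
  define D where "D i t = (case t of (unb, a, r, R) \<Rightarrow> 0 < r \<and> x i = Some (disk_norm a r) \<and>
      (if unb then v i = direction_towards (x i) None \<and> r < R \<and>
          (\<forall>\<rho>. r < \<rho> \<longrightarrow> \<rho> < R \<longrightarrow> \<rho> * disk_norm a \<rho> q < disk_norm a \<rho> (p - smult a q))
       else v i = direction_towards (x i) (classical_point (Some a)) \<and> R < r \<and>
          (\<forall>\<rho>. R < \<rho> \<longrightarrow> \<rho> < r \<longrightarrow> disk_norm a \<rho> (p - smult a q) < \<rho> * disk_norm a \<rho> q)))"
    for i and t :: "bool \<times> 'a \<times> real \<times> real"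
  have "\<exists>t. D i t" if i: "i < n" for i
    using crit[OF i]
  proof (cases rule: critically_fixed_cases)
    case (towards_infinity a r R)
    then have "D i (True, a, r, R)" unfolding D_def p_def q_def by simp
    then show ?thesis by blast
  next
    case (bounded a r R)
    then have "D i (False, a, r, R)" unfolding D_def p_def q_def by (simp del: classical_point.simps)
    then show ?thesis by blast
  qed
  then have "\<exists>t. \<forall>i\<in>{..<n}. D i (t i)" by (intro bchoice) auto
  then obtain t where t: "\<And>i. i < n \<Longrightarrow> D i (t i)" by auto
  define unb where "unb i = fst (t i)" for i
  define a where "a i = fst (snd (t i))" for i
  define r where "r i = fst (snd (snd (t i)))" for i
  define R where "R i = snd (snd (snd (t i)))" for i
  have Dt: "D i (unb i, a i, r i, R i)" if "i < n" for i
    using t[OF that] by (simp add: unb_def a_def r_def R_def)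
  have r0: "0 < r i" and x: "x i = Some (disk_norm (a i) (r i))" if "i < n" for i
    using Dt[OF that] by (simp_all add: D_def)
  have v_unb: "v i = direction_towards (x i) None" and R_unb: "r i < R i"
    and expand: "\<And>\<rho>. r i < \<rho> \<Longrightarrow> \<rho> < R i \<Longrightarrow> \<rho> * disk_norm (a i) \<rho> q < disk_norm (a i) \<rho> (p - smult (a i) q)"
    if "i < n" "unb i" for i
    using Dt[OF that(1)] that(2) by (simp_all add: D_def)
  have v_bdd: "v i = direction_towards (x i) (classical_point (Some (a i)))" and R_bdd: "R i < r i"
    and contract: "\<And>\<rho>. R i < \<rho> \<Longrightarrow> \<rho> < r i \<Longrightarrow> disk_norm (a i) \<rho> (p - smult (a i) q) < \<rho> * disk_norm (a i) \<rho> q"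
    if "i < n" "\<not> unb i" for i
    using Dt[OF that(1)] that(2) by (simp_all add: D_def del: classical_point.simps)
  have far_in: "absval (\<alpha> - a i) \<le> r i" if "i < n" "unb i" "classical_point (Some \<alpha>) \<notin> v i" for i \<alpha>
  proof (rule ccontr)
    assume "\<not> absval (\<alpha> - a i) \<le> r i"
    then have "r i < absval (\<alpha> - a i)" by simp
    then show False
      using classical_far_in_direction[OF r0[OF that(1)]] that(3)
      unfolding v_unb[OF that(1,2)] x[OF that(1)] by blast
  qed
  have near_in: "\<not> absval (\<alpha> - a i) < r i" if "i < n" "\<not> unb i" "classical_point (Some \<alpha>) \<notin> v i" for i \<alpha>
  proof
    have "absval (a i - a i) \<le> r i" using r0[OF that(1)] by simp
    moreover assume "absval (\<alpha> - a i) < r i"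
    ultimately show False
      using classical_near_in_direction[OF r0[OF that(1)]] that(3)
      unfolding v_bdd[OF that(1,2)] x[OF that(1)] by blast
  qed
  (* All boundary points are in the closure of U, hence of each direction. This places
     the boundary points relative to each other. *)
  have meets: "V \<inter> v i \<noteq> {}" if i: "i < n" and j: "j < n" and V: "openin berk_P1 V" "x j \<in> V" for i j V
  proof -
    have "x j \<in> berk_P1 closure_of U"
      using frontier j unfolding frontier_of_def by blast
    then obtain y where "y \<in> U" "y \<in> V" using V unfolding in_closure_of by blast
    then show ?thesis using i U by blast
  qed
  (* x j is not interior to the complement of the unbounded direction v i, whatever centre e is used
     for that complement. *)
  have unb_sep: "r i \<le> max (absval (a j - e)) (r j)"
    if i: "i < n" "unb i" and j: "j < n" and e: "absval (e - a i) \<le> r i" for i j e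
  proof (rule ccontr)
    assume "\<not> r i \<le> max (absval (a j - e)) (r j)"
    then have "max (absval (a j - e)) (r j) < r i" by (rule not_le_imp_less)
    then have "x j \<in> berk_ball e (r i)"
      unfolding x[OF j] berk_ball_iff disk_norm_linear using r0[OF j] by (simp add: disk_norm_in_berk_affine)
    then have "berk_ball e (r i) \<inter> v i \<noteq> {}" by (rule meets[OF i(1) j openin_berk_ball])
    then show False
      using direction_towards_None_disjoint[OF r0[OF i(1)] e] unfolding v_unb[OF i] x[OF i(1)] by blast
  qed
  have bdd_sep: "max (absval (a j - a i)) (r j) < r i" if i: "i < n" "\<not> unb i" and j: "j < n" "j \<noteq> i" for i j
  proof -
    have sub: "v i \<subseteq> berk_ball (a i) (r i)"
      unfolding v_bdd[OF i] x[OF i(1)]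
      using r0[OF i(1)] by (intro direction_towards_classical_subset) auto
    have "x j \<noteq> x i" using inj i(1) j by (auto simp: inj_on_def)
    moreover have "x j \<in> topspace berk_P1"
      using r0[OF j(1)] by (simp add: x[OF j(1)] topspace_berk_P1 disk_norm_in_berk_affine)
    ultimately have "x j \<in> berk_ball (a i) (r i)"
      using meets[OF i(1) j(1) openin_outside_ball[OF r0[OF i(1)], of "a i"]] sub x[OF i(1)] by auto
    then show ?thesis unfolding x[OF j(1)] berk_ball_iff disk_norm_linear by blast
  qed
  have unb_disjoint: "max (r i) (r j) < absval (a i - a j)"
    if "i < n" "unb i" "j < n" "unb j" "i \<noteq> j" for i j
  proof (rule ccontr)
    assume neg: "\<not> max (r i) (r j) < absval (a i - a j)"
    have sym: "absval (a j - a i) = absval (a i - a j)" by (rule absval_diff_commute)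
    have "r i = r j" "absval (a i - a j) \<le> r i"
      using neg sym unb_sep[OF that(1,2,3), of "a j"] unb_sep[OF that(3,4,1), of "a i"] r0[OF that(1)] r0[OF that(3)]
      by (auto simp: max_def split: if_splits)
    then have "x i = x j"
      unfolding x[OF that(1)] x[OF that(3)] using r0[OF that(1)] by (simp add: disk_norm_recenter)
    then show False using inj that by (auto simp: inj_on_def)
  qed
  have root_outside: "\<exists>i<n. classical_point (Some \<alpha>) \<notin> v i" if "poly P \<alpha> = 0" for \<alpha>
  proof (rule ccontr)
    assume "\<not> ?thesis"
    then have "classical_point (Some \<alpha>) \<in> U"
      unfolding U using classical_point_in_topspace by blast
    moreover have "berk_map f (classical_point (Some \<alpha>)) = classical_point (Some \<alpha>)"
      using that unfolding P_def p_def q_def by (rule fixed_classical_point)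
    ultimately show False using none by blast
  qed
  have shift: "p - smult c q = [:- c, 1:] * q - P" for c by (simp add: P_def)
  have norm_zq: "disk_norm c \<rho> ([:- c, 1:] * q) = \<rho> * disk_norm c \<rho> q" if "0 \<le> \<rho>" for c \<rho>
    using that by (simp only: disk_norm_mult disk_norm_linear) simp
  (* If P = 0, then f is the identity, which neither expands nor contracts. For n = 0 the root 0 of P
     would have to lie outside the whole space. *)
  have P0: "P \<noteq> 0"
  proof
    assume "P = 0"
    then obtain i where i: "i < n" using root_outside[of 0] by auto
    have eq: "p - smult c q = [:- c, 1:] * q" for c using shift[of c] \<open>P = 0\<close> by simp
    show False
    proof (cases "unb i")
      case True
      then obtain \<rho> where "r i < \<rho>" "\<rho> < R i" using R_unb[OF i] dense by blast
      then show False
        using expand[OF i True, of \<rho>] r0[OF i] norm_zq[of \<rho> "a i"] by (simp only: eq) simp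
    next
      case False
      then obtain \<rho> where "max 0 (R i) < \<rho>" "\<rho> < r i"
        using R_bdd[OF i] r0[OF i] dense[of "max 0 (R i)" "r i"] by auto
      then show False
        using contract[OF i False, of \<rho>] norm_zq[of \<rho> "a i"] by (simp only: eq) simp
    qed
  qed
  define S where "S c = (\<lambda>\<alpha>. absval (\<alpha> - c)) ` {\<alpha>. poly P \<alpha> = 0}" for c
  have finS: "finite (S c)" for c using poly_roots_finite[OF P0] by (simp add: S_def)
  define I where "I = {i. i < n \<and> unb i}"
  have finI: "finite I" by (simp add: I_def)
  have "\<forall>i\<in>I. \<exists>\<rho>. r i < \<rho> \<and> \<rho> < R i \<and> (\<forall>s\<in>S (a i). s \<le> \<rho> \<longrightarrow> s \<le> r i)"
  proof
    fix i assume "i \<in> I"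
    then have "r i < R i" using R_unb[of i] by (simp add: I_def)
    then obtain \<rho> where "r i < \<rho>" "\<rho> < R i" "\<And>s. s \<in> S (a i) \<Longrightarrow> s \<le> \<rho> \<Longrightarrow> s \<le> r i"
      using radius_above[OF finS] by metis
    then show "\<exists>\<rho>. r i < \<rho> \<and> \<rho> < R i \<and> (\<forall>s\<in>S (a i). s \<le> \<rho> \<longrightarrow> s \<le> r i)" by blast
  qed
  from bchoice[OF this] obtain \<rho> where
    \<rho>_all: "\<forall>i\<in>I. r i < \<rho> i \<and> \<rho> i < R i \<and> (\<forall>s\<in>S (a i). s \<le> \<rho> i \<longrightarrow> s \<le> r i)" ..
  then have \<rho>: "\<And>i. i \<in> I \<Longrightarrow> r i < \<rho> i" "\<And>i. i \<in> I \<Longrightarrow> \<rho> i < R i"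
    "\<And>i s. i \<in> I \<Longrightarrow> s \<in> S (a i) \<Longrightarrow> s \<le> \<rho> i \<Longrightarrow> s \<le> r i"
    by blast+
  have root_in: "absval (\<alpha> - a i) \<le> \<rho> i \<longleftrightarrow> absval (\<alpha> - a i) \<le> r i" if "i \<in> I" "poly P \<alpha> = 0" for i \<alpha>
    using \<rho>(1)[OF that(1)] \<rho>(3)[OF that(1), of "absval (\<alpha> - a i)"] that(2) unfolding S_def by auto
  show False
  proof (rule fixed_point_residue_contradiction[of q p I \<rho> a, folded P_def, OF P0 finI])
    fix i assume i: "i \<in> I"
    then have i': "i < n" "unb i" by (auto simp: I_def)
    show \<rho>0: "0 < \<rho> i" using \<rho>(1)[OF i] r0[OF i'(1)] by simp
    let ?N = "disk_norm (a i) (\<rho> i)"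
    have big: "\<rho> i * ?N q < ?N (p - smult (a i) q)"
      by (rule expand[OF i' \<rho>(1,2)[OF i]])
    have "P = - (p - smult (a i) q) + [:- a i, 1:] * q" using shift[of "a i"] by simp
    then have "?N P = ?N (- (p - smult (a i) q))"
      using big \<rho>0 norm_zq[of "\<rho> i" "a i"] disk_norm_add_eq[of "\<rho> i" "a i" "[:- a i, 1:] * q" "- (p - smult (a i) q)"]
      by (simp only: disk_norm_minus[OF less_imp_le[OF \<rho>0]] less_imp_le)
    then show "\<rho> i * ?N q < ?N P"
      using big \<rho>0 by (simp only: disk_norm_minus[OF less_imp_le[OF \<rho>0]])
  next
    fix i j \<alpha> assume ij: "i \<in> I" "j \<in> I" "i \<noteq> j" and \<alpha>: "poly P \<alpha> = 0" "absval (\<alpha> - a i) \<le> \<rho> i"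
    show "\<rho> j < absval (\<alpha> - a j)"
    proof (rule ccontr)
      assume "\<not> \<rho> j < absval (\<alpha> - a j)"
      then have "absval (\<alpha> - a j) \<le> r j" "absval (\<alpha> - a i) \<le> r i"
        using root_in[OF ij(2) \<alpha>(1)] root_in[OF ij(1) \<alpha>(1)] \<alpha>(2) by auto
      then have "absval (a i - a j) \<le> max (r i) (r j)"
        using absval_diff_le_max[of "\<alpha> - a j" "\<alpha> - a i"] by simp
      moreover have "max (r i) (r j) < absval (a i - a j)"
        using ij by (intro unb_disjoint) (auto simp: I_def)
      ultimately show False by linarith
    qed
  next
    show "q \<noteq> 0 \<and> degree p \<le> degree q \<and> (\<forall>\<alpha>. poly P \<alpha> = 0 \<longrightarrow> (\<exists>i\<in>I. absval (\<alpha> - a i) \<le> \<rho> i)) \<or>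
      (\<exists>e \<sigma>. 0 < \<sigma> \<and> disk_norm e \<sigma> (p - smult e q) < \<sigma> * disk_norm e \<sigma> q \<and>
        (\<forall>\<alpha>. poly P \<alpha> = 0 \<longrightarrow> (absval (\<alpha> - e) \<le> \<sigma> \<longleftrightarrow> (\<exists>i\<in>I. absval (\<alpha> - a i) \<le> \<rho> i))))"
    proof (cases "\<forall>i<n. unb i")
      case True
      have "None \<in> v i" if "i < n" for i
        unfolding v_unb[OF that True[rule_format, OF that]] x[OF that]
        by (rule None_in_direction_towards_None[OF r0[OF that]])
      then have "classical_point None \<in> U" unfolding U by (auto simp: topspace_berk_P1)
      then have moved: "berk_map f (classical_point None) \<noteq> classical_point None" using none by blast
      have "degree p \<le> degree q"
      proof (rule ccontr)
        assume "\<not> degree p \<le> degree q"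
        then have "rat_eval f None = None" by (simp add: p_def q_def)
        then show False using moved by simp
      qed
      moreover have "\<exists>i\<in>I. absval (\<alpha> - a i) \<le> \<rho> i" if \<alpha>: "poly P \<alpha> = 0" for \<alpha>
      proof -
        obtain i where i: "i < n" "classical_point (Some \<alpha>) \<notin> v i" using root_outside[OF \<alpha>] by blast
        then have "i \<in> I" "absval (\<alpha> - a i) \<le> r i" using True far_in[of i \<alpha>] by (auto simp: I_def)
        then show ?thesis using root_in \<alpha> by blast
      qed
      ultimately show ?thesis using q0 by blast
    next
      case False
      then obtain k where k: "k < n" "\<not> unb k" by blast
      let ?e = "a k"
      have "max 0 (R k) < r k" using R_bdd[OF k] r0[OF k(1)] by simp
      then obtain \<sigma> where \<sigma>: "max 0 (R k) < \<sigma>" "\<sigma> < r k" "\<And>s. s \<in> S ?e \<Longrightarrow> s < r k \<Longrightarrow> s \<le> \<sigma>"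
        using radius_below[OF finS[of "a k"]] by metis
      have "absval (\<alpha> - ?e) \<le> \<sigma> \<longleftrightarrow> (\<exists>i\<in>I. absval (\<alpha> - a i) \<le> \<rho> i)" if \<alpha>: "poly P \<alpha> = 0" for \<alpha>
      proof
        assume "absval (\<alpha> - ?e) \<le> \<sigma>"
        then have lt: "absval (\<alpha> - ?e) < r k" using \<sigma>(2) by simp
        obtain i where i: "i < n" "classical_point (Some \<alpha>) \<notin> v i" using root_outside[OF \<alpha>] by blast
        have "i \<noteq> k" using near_in[OF k] lt i(2) by blast
        (* Two bounded directions would each have the smaller boundary radius. *)
        have "unb i"
        proof (rule ccontr)
          assume "\<not> unb i"
          then show False
            using bdd_sep[OF k i(1) \<open>i \<noteq> k\<close>] bdd_sep[OF i(1) _ k(1)] \<open>i \<noteq> k\<close> by fastforce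
        qed
        then have "i \<in> I" "absval (\<alpha> - a i) \<le> r i" using i far_in by (auto simp: I_def)
        then show "\<exists>i\<in>I. absval (\<alpha> - a i) \<le> \<rho> i" using root_in \<alpha> by blast
      next
        assume "\<exists>i\<in>I. absval (\<alpha> - a i) \<le> \<rho> i"
        then obtain i where i: "i \<in> I" "absval (\<alpha> - a i) \<le> r i" using root_in \<alpha> by blast
        then have "i < n" "i \<noteq> k" using k by (auto simp: I_def)
        then have "max (absval (a i - ?e)) (r i) < r k" by (rule bdd_sep[OF k])
        then have "absval (\<alpha> - ?e) < r k"
          using absval_add_le_max[of "\<alpha> - a i" "a i - ?e"] i(2) by simp linarith
        then show "absval (\<alpha> - ?e) \<le> \<sigma>" using \<sigma>(3) \<alpha> by (auto simp: S_def)
      qed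
      moreover have "disk_norm ?e \<sigma> (p - smult ?e q) < \<sigma> * disk_norm ?e \<sigma> q"
        using \<sigma> by (intro contract[OF k]) auto
      moreover have "0 < \<sigma>" using \<sigma>(1) by simp
      ultimately show ?thesis by blast
    qed
  qed
qed

end
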